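(* Let $p$ be an odd prime. Then $$\sum_{k=0}^{p-1}\frac{\binom{2k}k^3}{(-8)^k(2k-1)}\equiv\begin{cases}-4x^2\pmod{p^2}&\text{if } p\equiv1\pmod 4\text{ and } p=x^2+4y^2 \text{ with } x,y\in\mathbb Z,\\ 2p-2R_1(p)\pmod{p^2}&\text{if } p\equiv 3\pmod 4,\end{cases}$$ $$\sum_{k=0}^{p-1}\frac{\binom{2k}k^3}{(-8)^k(2k-1)^2}\equiv\begin{cases}-4x^2+2p\pmod{p^2}&\text{if } p\equiv1\pmod 4\text{ and } p=x^2+4y^2 \text{ with } x,y\in\mathbb Z,\\ 6R_1(p)\pmod{p^2}&\text{if } p\equiv 3\pmod 4.\end{cases}$$
   Context: For an odd prime $p$, $R_1(p)=(2p+2-2^{p-1})\binom{(p-1)/2}{[p/4]}^2$, where $[u]$ denotes the greatest integer not exceeding $u$. Congruences modulo $p^r$ between rational numbers with denominators prime to $p$ mean that the difference is $p^r$ times such a rational number. *)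

theory Defs
  imports Complex_Main "HOL-Computational_Algebra.Primes"
begin

definition qcong :: "rat \<Rightarrow> rat \<Rightarrow> nat \<Rightarrow> nat \<Rightarrow> bool" where
  "qcong a b p r \<longleftrightarrow>
     (\<exists>c::rat. a - b = of_nat (p ^ r) * c \<and> coprime (snd (quotient_of c)) (int p))"

definition R1 :: "nat \<Rightarrow> int" where
  "R1 p = (2 * int p + 2 - 2 ^ (p - 1)) * int (((p - 1) div 2) choose (p div 4)) ^ 2"

end

theory Submission
  imports Defs "HOL-Number_Theory.Number_Theory" "HOL-Computational_Algebra.Polynomial"
begin

text \<open>
  Write \<open>n = (p - 1) / 2\<close>. Modulo \<open>p\<^sup>2\<close> one has \<open>binom(2k, k) / (-16)\<^sup>k = binom(n + k, 2k)\<close> for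
  \<open>k \<le> n\<close>, so after removing the factors \<open>1 / (2k - 1)\<close> by contiguity relations both sums
  become values of \<open>\<Sum> k\<^sup>i binom(n + k, 2k) binom(2k, k)\<^sup>2 2\<^sup>k\<close> for \<open>i \<le> 2\<close>. By Clausen's formula these
  are quadratic forms in \<open>u = P\<^sub>n(3)\<close> and \<open>P\<^sub>n'(3)\<close>; with a suitable combination \<open>w\<close> of the two the sums
  are \<open>- 2 w\<^sup>2 - 2 u w - u\<^sup>2\<close> and \<open>6 w\<^sup>2 - u\<^sup>2\<close>.

  Both \<open>u\<close> and \<open>2 w\<close> are congruent to truncations of Kummer's series \<open>F(a) = \<Sum> (-1)\<^sup>k ((a)\<^sub>k / k!)\<^sup>2\<close>, at
  \<open>a = 1/2\<close> and \<open>a = -1/2\<close>. Since \<open>F\<close> is linear along \<open>a + p t\<close> modulo \<open>p\<^sup>2\<close>, \<open>F(\<plusminus>1/2)\<close> is the mean of two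
  values at integers, and these follow from \<open>4 (a + 1) F(a + 2) = - a F(a)\<close>, whose truncation error
  contains the square of \<open>(a)\<^sub>p\<close>. This gives \<open>u w = \<plusminus>p\<close>, with \<open>w\<^sup>2 = 0\<close> for \<open>p = 1\<close> modulo 4 and
  \<open>u\<^sup>2 = 0\<close>, \<open>w\<^sup>2 = R\<^sub>1(p)\<close> for \<open>p = 3\<close> modulo 4.

  For \<open>p = 1\<close> modulo 4 the Jacobsthal sum \<open>T = \<Sum> \<chi>(a) \<chi>(a\<^sup>2 - 1)\<close> satisfies \<open>T\<^sup>2 = 4 x\<^sup>2\<close>. Summing over
  the representatives \<open>a\<^sup>p\<close> and using \<open>2 \<chi>(b) = 3 b\<^sup>n - b\<^bsup>3n\<^esup>\<close> modulo \<open>p\<^sup>2\<close> expresses \<open>T\<close> by three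
  binomial coefficients, from which \<open>T = - (u + p / u)\<close> and hence \<open>u\<^sup>2 = 4 x\<^sup>2 - 2 p\<close>.
\<close>

section \<open>Rational numbers with denominator prime to \<open>p\<close>\<close>

text \<open>The local ring of the integers at \<open>p\<close>, described by reduced denominators so
  that it matches the condition in \<open>qcong\<close> literally.\<close>

definition pint :: "nat \<Rightarrow> rat set" where
  "pint p = {c. coprime (snd (quotient_of c)) (int p)}"

lemma qcong_iff: "qcong a b p r \<longleftrightarrow> (\<exists>c\<in>pint p. a - b = of_nat (p ^ r) * c)"
  by (auto simp: qcong_def pint_def)

text \<open>The reduced denominator divides every other denominator of the same number, so any
  fraction with denominator prime to \<open>p\<close> may serve. Closure under ring operations then
  needs no reduction of fractions.\<close>

lemma pint_iff:
  assumes "prime p"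
  shows "c \<in> pint p \<longleftrightarrow> (\<exists>a b::int. \<not> int p dvd b \<and> c = of_int a / of_int b)"
proof
  assume c: "c \<in> pint p"
  obtain a b where ab: "quotient_of c = (a, b)" by fastforce
  then have "c = of_int a / of_int b" by (rule quotient_of_div)
  moreover have "\<not> int p dvd b"
  proof
    assume "int p dvd b"
    then have "is_unit (int p)"
      using c ab by (metis coprime_common_divisor dvd_refl mem_Collect_eq pint_def snd_conv)
    with assms show False by simp
  qed
  ultimately show "\<exists>a b::int. \<not> int p dvd b \<and> c = of_int a / of_int b" by blast
next
  assume "\<exists>a b::int. \<not> int p dvd b \<and> c = of_int a / of_int b"
  then obtain a b :: int where nd: "\<not> int p dvd b" and c: "c = of_int a / of_int b" by blast
  obtain a' b' where q: "quotient_of c = (a', b')" by fastforce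
  have b': "b' > 0" "coprime a' b'" "c = of_int a' / of_int b'"
    using q quotient_of_denom_pos quotient_of_coprime quotient_of_div by auto
  have "b \<noteq> 0" using nd by auto
  have "(of_int (a' * b) :: rat) = of_int (a * b')"
    using c b' \<open>b \<noteq> 0\<close> by (simp add: field_simps)
  then have "a' * b = a * b'" by linarith
  then have "b' dvd a' * b" by simp
  then have "b' dvd b" using b'(2) by (simp add: coprime_commute coprime_dvd_mult_right_iff)
  then have "\<not> int p dvd b'" using nd dvd_trans by blast
  then have "coprime (int p) b'" using assms by (simp add: prime_imp_coprime)
  then show "c \<in> pint p" by (simp add: pint_def q coprime_commute)
qed

locale odd_prime =
  fixes p :: nat
  assumes prime: "prime p" and odd: "odd p"
begin

definition n :: nat where "n = (p - 1) div 2"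

lemma p_eq: "p = 2 * n + 1"
  using odd by (auto simp: n_def elim!: oddE)

lemma p_ge_3: "p \<ge> 3"
  using prime odd prime_ge_2_nat[OF prime] by (cases "p = 2") auto

lemma n_pos: "n \<ge> 1"
  using p_ge_3 p_eq by simp

lemma p_nonzero [simp]: "(of_nat p :: rat) \<noteq> 0"
  using p_ge_3 by simp

abbreviation cong1 (infix "\<sim>" 50) where "a \<sim> b \<equiv> qcong a b p 1"
abbreviation cong2 (infix "\<approx>" 50) where "a \<approx> b \<equiv> qcong a b p 2"

lemma pint_of_int [intro, simp]: "of_int a \<in> pint p"
proof -
  have "\<not> int p dvd 1" using p_ge_3 by simp
  then show ?thesis unfolding pint_iff[OF prime] by (metis div_by_1 of_int_1)
qed

lemma pint_of_nat [intro, simp]: "of_nat a \<in> pint p"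
  using pint_of_int[of "int a"] by simp

lemma pint_numeral [intro, simp]: "numeral a \<in> pint p" "0 \<in> pint p" "1 \<in> pint p"
  using pint_of_int[of "numeral a"] pint_of_int[of 0] pint_of_int[of 1] by simp_all

lemma pint_add [intro]:
  assumes "a \<in> pint p" "b \<in> pint p" shows "a + b \<in> pint p"
proof -
  obtain a1 a2 b1 b2 :: int where
    "\<not> int p dvd a2" "a = of_int a1 / of_int a2" "\<not> int p dvd b2" "b = of_int b1 / of_int b2"
    using assms unfolding pint_iff[OF prime] by blast
  moreover from this have "a2 \<noteq> 0" "b2 \<noteq> 0" by auto
  moreover have "\<not> int p dvd a2 * b2" using calculation prime by (simp add: prime_dvd_mult_iff)
  ultimately show ?thesis unfolding pint_iff[OF prime]
    by (intro exI[of _ "a1 * b2 + b1 * a2"] exI[of _ "a2 * b2"]) (simp add: field_simps)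
qed

lemma pint_mult [intro]:
  assumes "a \<in> pint p" "b \<in> pint p" shows "a * b \<in> pint p"
proof -
  obtain a1 a2 b1 b2 :: int where
    "\<not> int p dvd a2" "a = of_int a1 / of_int a2" "\<not> int p dvd b2" "b = of_int b1 / of_int b2"
    using assms unfolding pint_iff[OF prime] by blast
  moreover have "\<not> int p dvd a2 * b2" using calculation prime by (simp add: prime_dvd_mult_iff)
  ultimately show ?thesis unfolding pint_iff[OF prime]
    by (intro exI[of _ "a1 * b1"] exI[of _ "a2 * b2"]) simp
qed

lemma pint_uminus [intro]: "a \<in> pint p \<Longrightarrow> - a \<in> pint p"
  using pint_mult[OF pint_of_int[of "-1"], of a] by simp

lemma pint_diff [intro]: "a \<in> pint p \<Longrightarrow> b \<in> pint p \<Longrightarrow> a - b \<in> pint p"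
  using pint_add[of a "- b"] pint_uminus[of b] by simp

lemma pint_power [intro]: "a \<in> pint p \<Longrightarrow> a ^ k \<in> pint p"
  by (induction k) auto

lemma pint_sum [intro]: "(\<And>i. i \<in> A \<Longrightarrow> f i \<in> pint p) \<Longrightarrow> sum f A \<in> pint p"
  by (induction A rule: infinite_finite_induct) auto

lemma pint_inverse_int [intro]: "\<not> int p dvd a \<Longrightarrow> inverse (of_int a) \<in> pint p"
  unfolding pint_iff[OF prime] by (metis inverse_eq_divide of_int_1)

lemma pint_inverse_nat [intro]: "\<not> p dvd a \<Longrightarrow> inverse (of_nat a) \<in> pint p"
  using pint_inverse_int[of "int a"] by simp

lemma pint_half [intro, simp]: "1 / 2 \<in> pint p"
proof -
  have "\<not> p dvd 2" using p_ge_3 by (auto dest: dvd_imp_le)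
  then show ?thesis using pint_inverse_nat[of 2] by simp
qed

lemma pint_inverse_2 [intro]: "inverse 2 \<in> pint p"
  by simp

lemma pint_divide [intro]: "a \<in> pint p \<Longrightarrow> inverse b \<in> pint p \<Longrightarrow> a / b \<in> pint p"
  by (simp add: divide_inverse pint_mult)

lemma pint_inverse_power [intro]: "inverse a \<in> pint p \<Longrightarrow> inverse (a ^ k) \<in> pint p"
  by (metis pint_power power_inverse)

lemma pint_inverse_mult [intro]:
  "inverse a \<in> pint p \<Longrightarrow> inverse b \<in> pint p \<Longrightarrow> inverse (a * b) \<in> pint p"
  by (simp add: pint_mult)

section \<open>Arithmetic of congruences modulo powers of \<open>p\<close>\<close>

lemma qcong_refl [intro, simp]: "qcong a a p r"
  unfolding qcong_iff by (intro bexI[of _ 0]) auto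

lemma qcong_sym: "qcong a b p r \<Longrightarrow> qcong b a p r"
  unfolding qcong_iff by (metis minus_diff_eq mult_minus_right pint_uminus)

lemma qcong_trans [trans]: "qcong a b p r \<Longrightarrow> qcong b c p r \<Longrightarrow> qcong a c p r"
  unfolding qcong_iff
proof (elim bexE)
  fix d e assume "d \<in> pint p" "e \<in> pint p" "a - b = of_nat (p ^ r) * d" "b - c = of_nat (p ^ r) * e"
  then show "\<exists>d\<in>pint p. a - c = of_nat (p ^ r) * d"
    by (intro bexI[of _ "d + e"]) (auto simp: algebra_simps)
qed

lemma qcong_add [intro]: "qcong a b p r \<Longrightarrow> qcong c d p r \<Longrightarrow> qcong (a + c) (b + d) p r"
  unfolding qcong_iff
proof (elim bexE)
  fix x y assume "x \<in> pint p" "y \<in> pint p" "a - b = of_nat (p ^ r) * x" "c - d = of_nat (p ^ r) * y"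
  then show "\<exists>x\<in>pint p. a + c - (b + d) = of_nat (p ^ r) * x"
    by (intro bexI[of _ "x + y"]) (auto simp: algebra_simps)
qed

lemma qcong_cmult [intro]: "qcong a b p r \<Longrightarrow> c \<in> pint p \<Longrightarrow> qcong (c * a) (c * b) p r"
  unfolding qcong_iff
proof (elim bexE)
  fix x assume "x \<in> pint p" "c \<in> pint p" "a - b = of_nat (p ^ r) * x"
  then show "\<exists>x\<in>pint p. c * a - c * b = of_nat (p ^ r) * x"
    by (intro bexI[of _ "c * x"]) (auto simp flip: right_diff_distrib)
qed

lemma qcong_uminus [intro]: "qcong a b p r \<Longrightarrow> qcong (- a) (- b) p r"
  using qcong_cmult[of a b r "-1"] by auto

lemma qcong_diff [intro]: "qcong a b p r \<Longrightarrow> qcong c d p r \<Longrightarrow> qcong (a - c) (b - d) p r"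
  using qcong_add[of a b r "- c" "- d"] by auto

lemma qcong_pint: "qcong a b p r \<Longrightarrow> b \<in> pint p \<Longrightarrow> a \<in> pint p"
  unfolding qcong_iff by (metis diff_add_cancel pint_add pint_mult pint_of_nat)

lemma qcong_mult:
  assumes "qcong a b p r" "qcong c d p r" "b \<in> pint p" "d \<in> pint p"
  shows "qcong (a * c) (b * d) p r"
proof -
  have "qcong (c * a) (c * b) p r" using assms qcong_pint by blast
  moreover have "qcong (b * c) (b * d) p r" using assms by blast
  ultimately show ?thesis by (metis mult.commute qcong_trans)
qed

lemma qcong_power: "qcong a b p r \<Longrightarrow> b \<in> pint p \<Longrightarrow> qcong (a ^ k) (b ^ k) p r"
  by (induction k) (auto intro: qcong_mult)

lemma qcong_sum: "(\<And>i. i \<in> A \<Longrightarrow> qcong (f i) (g i) p r) \<Longrightarrow> qcong (sum f A) (sum g A) p r"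
  by (induction A rule: infinite_finite_induct) auto

lemma qcong_cancel:
  assumes "qcong (c * a) (c * b) p r" "inverse c \<in> pint p" "c \<noteq> 0" shows "qcong a b p r"
  using qcong_cmult[OF assms(1,2)] assms(3) by (simp flip: mult.assoc)

lemma cong2_imp_cong1: "a \<approx> b \<Longrightarrow> a \<sim> b"
  unfolding qcong_iff
proof (elim bexE)
  fix x assume "x \<in> pint p" "a - b = of_nat (p ^ 2) * x"
  then show "\<exists>x\<in>pint p. a - b = of_nat (p ^ 1) * x"
    by (intro bexI[of _ "of_nat p * x"]) (auto simp: power2_eq_square)
qed

text \<open>A factor \<open>p\<close> raises the precision by one power, so cofactors of
  \<open>p\<close> have to be known only modulo \<open>p\<close>.\<close>

lemma cong1_mult_p: "a \<sim> b \<Longrightarrow> of_nat p * a \<approx> of_nat p * b"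
  unfolding qcong_iff by (auto simp: power2_eq_square simp flip: right_diff_distrib)

lemma cong1_zero_mult:
  assumes "a \<sim> 0" "b \<sim> 0" shows "a * b \<approx> 0"
proof -
  obtain x y where "x \<in> pint p" "y \<in> pint p" "a = of_nat p * x" "b = of_nat p * y"
    using assms unfolding qcong_iff by auto
  then show ?thesis unfolding qcong_iff
    by (intro bexI[of _ "x * y"]) (auto simp: power2_eq_square)
qed

lemma p_mult_cong1: "a \<in> pint p \<Longrightarrow> of_nat p * a \<sim> 0"
  unfolding qcong_iff by auto

lemma p2_mult_cong2: "a \<in> pint p \<Longrightarrow> of_nat p ^ 2 * a \<approx> 0"
  unfolding qcong_iff by auto

lemma qcong_of_int: 
  assumes "[a = b] (mod int p ^ r)" shows "qcong (of_int a) (of_int b) p r"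
proof -
  obtain c where "a - b = int p ^ r * c"
    using assms by (auto simp: cong_iff_dvd_diff)
  then have "(of_int (a - b) :: rat) = of_int (int p ^ r * c)" by simp
  then show ?thesis unfolding qcong_iff by (intro bexI[of _ "of_int c"]) auto
qed

end

section \<open>Clausen's formula for Legendre polynomials\<close>

text \<open>The coefficient of \<open>x^k\<close> in the Legendre polynomial
  \<open>P_n(1 + 2x)\<close>.\<close>

definition leg_coeff :: "nat \<Rightarrow> nat \<Rightarrow> rat" where
  "leg_coeff n k = of_nat (((n + k) choose (2 * k)) * ((2 * k) choose k))"

text \<open>The coefficient of \<open>t^k\<close> in the polynomial that becomes
  \<open>P_n(1 + 2x)^2\<close> at \<open>t = x^2 + x\<close>.\<close>

definition sq_coeff :: "nat \<Rightarrow> nat \<Rightarrow> rat" where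
  "sq_coeff n k = of_nat (((n + k) choose (2 * k)) * ((2 * k) choose k) ^ 2)"

lemma central_binomial_Suc:
  "(of_nat k + 1) * (of_nat ((2 * Suc k) choose Suc k) :: rat) = 2 * (2 * of_nat k + 1) * of_nat ((2 * k) choose k)"
proof -
  have "((2 * Suc k) choose Suc k) * Suc k = 2 * Suc k * ((2 * k + 1) choose k)"
    using Suc_times_binomial_eq[of "2 * k + 1" k] by simp
  then have "(2 * Suc k) choose Suc k = 2 * ((2 * k + 1) choose k)"
    by (metis (no_types, lifting) mult.assoc mult.commute mult_cancel1 nat.distinct(1))
  moreover have "(2 * k + 1) choose k = (2 * k + 1) choose Suc k"
    using binomial_symmetric[of k "2 * k + 1"] by simp
  moreover have "((2 * k + 1) choose Suc k) * Suc k = (2 * k + 1) * ((2 * k) choose k)"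
    using Suc_times_binomial_eq[of "2 * k" k] by simp
  ultimately have "Suc k * ((2 * Suc k) choose Suc k) = 2 * ((2 * k + 1) * ((2 * k) choose k))"
    by (metis mult.assoc mult.commute)
  from arg_cong[OF this, of "of_nat :: nat \<Rightarrow> rat"] show ?thesis
    by (simp only: of_nat_mult of_nat_Suc of_nat_add of_nat_numeral of_nat_1 mult.assoc add.commute)
qed

text \<open>The natural factor is \<open>(n - k) * (n + k + 1)\<close>; writing it as a difference
  keeps the Legendre eigenvalue \<open>n * (n + 1)\<close> visible. For \<open>k > n\<close> both
  binomials vanish.\<close>

lemma binomial_double_Suc:
  "(2 * of_nat k + 1) * (2 * of_nat k + 2) * (of_nat ((n + Suc k) choose (2 * Suc k)) :: rat)
    = (of_nat n * (of_nat n + 1) - of_nat k * (of_nat k + 1)) * of_nat ((n + k) choose (2 * k))"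
proof (cases "k \<le> n")
  case True
  have "Suc (2 * k + 1) * ((n + Suc k) choose (2 * Suc k)) = Suc (n + k) * ((n + k) choose (2 * k + 1))"
    using Suc_times_binomial_eq[of "n + k" "2 * k + 1"] by (simp add: mult.commute)
  from arg_cong[OF this, of "of_nat :: nat \<Rightarrow> rat"]
  have 1: "(2 * of_nat k + 2) * (of_nat ((n + Suc k) choose (2 * Suc k)) :: rat)
      = (of_nat n + of_nat k + 1) * of_nat ((n + k) choose (2 * k + 1))"
    unfolding of_nat_mult by (simp add: add_ac)
  have "Suc (2 * k) * ((n + k) choose (2 * k + 1)) = (n - k) * ((n + k) choose (2 * k))"
    using binomial_absorb_comp[of "n + k" "2 * k"] binomial_absorption[of "2 * k" "n + k"] True
    by simp
  from arg_cong[OF this, of "of_nat :: nat \<Rightarrow> rat"]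
  have 2: "(2 * of_nat k + 1) * (of_nat ((n + k) choose (2 * k + 1)) :: rat)
      = (of_nat n - of_nat k) * of_nat ((n + k) choose (2 * k))"
    unfolding of_nat_mult using True by (simp add: add_ac of_nat_diff)
  have "(2 * of_nat k + 1) * (2 * of_nat k + 2) * (of_nat ((n + Suc k) choose (2 * Suc k)) :: rat)
      = (of_nat n + of_nat k + 1) * ((2 * of_nat k + 1) * of_nat ((n + k) choose (2 * k + 1)))"
    unfolding mult.assoc 1 by (rule mult.left_commute)
  then show ?thesis unfolding 2 by (simp add: algebra_simps)
next
  case False
  then have "n + k < 2 * k" "n + Suc k < 2 * Suc k" by auto
  then show ?thesis by (simp only: binomial_eq_0)
qed

text \<open>This is the Legendre equation, read on coefficients.\<close>

lemma leg_coeff_Suc: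
  "(of_nat k + 1) ^ 2 * leg_coeff n (Suc k)
    = (of_nat n * (of_nat n + 1) - of_nat k * (of_nat k + 1)) * leg_coeff n k"
proof -
  let ?B = "of_nat ((n + Suc k) choose (2 * Suc k)) :: rat" and ?b = "of_nat ((n + k) choose (2 * k)) :: rat"
  let ?C = "of_nat ((2 * Suc k) choose Suc k) :: rat" and ?c = "of_nat ((2 * k) choose k) :: rat"
  have "2 * (2 * of_nat k + 1) * ((of_nat k + 1) ^ 2 * (?B * ?C))
      = ((2 * of_nat k + 1) * (2 * of_nat k + 2) * ?B) * ((of_nat k + 1) * ?C)"
    by (simp add: power2_eq_square algebra_simps)
  also have "\<dots> = 2 * (2 * of_nat k + 1) * ((of_nat n * (of_nat n + 1) - of_nat k * (of_nat k + 1)) * (?b * ?c))"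
    unfolding binomial_double_Suc central_binomial_Suc by (simp add: algebra_simps)
  finally have *: "2 * (2 * of_nat k + 1) * ((of_nat k + 1) ^ 2 * (?B * ?C)) = \<dots>" .
  have "(2 * (2 * of_nat k + 1) :: rat) \<noteq> 0"
    using of_nat_0_le_iff[of k, where ?'a = rat] by (simp add: add_nonneg_eq_0_iff)
  with * have "(of_nat k + 1) ^ 2 * (?B * ?C) = (of_nat n * (of_nat n + 1) - of_nat k * (of_nat k + 1)) * (?b * ?c)"
    by (metis mult_left_cancel)
  then show ?thesis by (simp add: leg_coeff_def)
qed

lemma sq_coeff_leg: "sq_coeff n k = leg_coeff n k * of_nat ((2 * k) choose k)"
  by (simp add: sq_coeff_def leg_coeff_def power2_eq_square)

lemma sq_coeff_Suc:
  "(of_nat k + 1) ^ 3 * sq_coeff n (Suc k)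
    = 2 * (2 * of_nat k + 1) * (of_nat n * (of_nat n + 1) - of_nat k * (of_nat k + 1)) * sq_coeff n k"
proof -
  have "(of_nat k + 1) ^ 3 * sq_coeff n (Suc k)
      = ((of_nat k + 1) ^ 2 * leg_coeff n (Suc k)) * ((of_nat k + 1) * of_nat ((2 * Suc k) choose Suc k))"
    unfolding sq_coeff_leg by (simp add: power3_eq_cube power2_eq_square mult_ac)
  also have "\<dots> = 2 * (2 * of_nat k + 1) * (of_nat n * (of_nat n + 1) - of_nat k * (of_nat k + 1)) * sq_coeff n k"
    unfolding leg_coeff_Suc central_binomial_Suc sq_coeff_leg by simp
  finally show ?thesis .
qed

lemma leg_coeff_eq_0 [simp]: "k > n \<Longrightarrow> leg_coeff n k = 0"
  and sq_coeff_eq_0 [simp]: "k > n \<Longrightarrow> sq_coeff n k = 0"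
  by (simp_all add: leg_coeff_def sq_coeff_def)

definition gen_poly :: "nat \<Rightarrow> (nat \<Rightarrow> rat) \<Rightarrow> rat poly" where
  "gen_poly n f = (\<Sum>k\<le>n. monom (f k) k)"

lemma coeff_gen_poly: "coeff (gen_poly n f) k = (if k \<le> n then f k else 0)"
  by (simp add: gen_poly_def coeff_sum)

lemma poly_gen_poly: "poly (gen_poly n f) x = (\<Sum>k\<le>n. f k * x ^ k)"
  by (simp add: gen_poly_def poly_sum poly_monom)

lemma euler_deriv_gen_poly: "[:0, 1:] * pderiv (gen_poly n f) = gen_poly n (\<lambda>k. of_nat k * f k)"
proof (rule poly_eqI)
  fix k show "coeff ([:0, 1:] * pderiv (gen_poly n f)) k = coeff (gen_poly n (\<lambda>k. of_nat k * f k)) k"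
    by (cases k) (auto simp: coeff_gen_poly coeff_pderiv)
qed

text \<open>If \<open>L\<close> solves \<open>(W L')' = N L\<close> with \<open>W = x\<^sup>2 + x\<close> and \<open>R = W L'\<close>, then \<open>L\<^sup>2\<close>, \<open>L R\<close>, \<open>R\<^sup>2\<close>
  solve the following first-order system, which has only one solution with a given value at \<open>0\<close>.\<close>

definition sym_square_system :: "rat \<Rightarrow> rat poly \<Rightarrow> rat poly \<Rightarrow> rat poly \<Rightarrow> bool" where
  "sym_square_system N q r s \<longleftrightarrow>
     [:0, 1, 1:] * pderiv q = smult 2 r \<and>
     [:0, 1, 1:] * pderiv r = s + smult N ([:0, 1, 1:] * q) \<and>
     pderiv s = smult (2 * N) r"

lemma coeff_W_mult:
  "coeff ([:0, 1, 1:] * f) (Suc k) = coeff f k + (case k of 0 \<Rightarrow> 0 | Suc j \<Rightarrow> coeff (f :: rat poly) j)"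
  by (cases k) auto

text \<open>Although \<open>0\<close> is a singular point, the coefficients of degree
  \<open>k + 1\<close> are determined by lower ones when taken in the order \<open>s\<close>,
  \<open>r\<close>, \<open>q\<close>: each carries the nonzero factor \<open>k + 1\<close>.\<close>

lemma sym_square_system_zero:
  assumes sys: "sym_square_system N q r s" and "coeff q 0 = 0" "coeff r 0 = 0" "coeff s 0 = 0"
  shows "q = 0" "r = 0" "s = 0"
proof -
  have e1: "coeff ([:0, 1, 1:] * pderiv q) (Suc k) = 2 * coeff r (Suc k)" for k
    using sys by (simp only: sym_square_system_def coeff_smult)
  have e2: "coeff ([:0, 1, 1:] * pderiv r) (Suc k) = coeff s (Suc k) + N * coeff ([:0, 1, 1:] * q) (Suc k)" for k
    using sys by (simp only: sym_square_system_def coeff_smult coeff_add)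
  have e3: "coeff (pderiv s) k = 2 * N * coeff r k" for k
    using sys by (simp only: sym_square_system_def coeff_smult)
  have "\<forall>j\<le>k. coeff q j = 0 \<and> coeff r j = 0 \<and> coeff s j = 0" for k
  proof (induction k)
    case (Suc k)
    have z: "coeff q k = 0" "coeff r k = 0" "coeff s k = 0" using Suc by auto
    have z': "coeff q j = 0" "coeff r j = 0" if "k = Suc j" for j using Suc that by auto
    have s: "coeff s (Suc k) = 0" using e3[of k] z by (simp add: coeff_pderiv)
    have r: "coeff r (Suc k) = 0" using e2[of k] z z' s unfolding coeff_W_mult
      by (auto simp: coeff_pderiv split: nat.splits)
    have q: "coeff q (Suc k) = 0" using e1[of k] z z' r unfolding coeff_W_mult
      by (auto simp: coeff_pderiv split: nat.splits)
    show ?case using Suc s r q by (auto simp: le_Suc_eq)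
  qed (use assms in auto)
  then have "coeff q k = 0" "coeff r k = 0" "coeff s k = 0" for k by blast+
  then show "q = 0" "r = 0" "s = 0" by (simp_all add: poly_eq_iff)
qed

lemma sym_square_system_unique:
  assumes "sym_square_system N q r s" "sym_square_system N q' r' s'"
    and "coeff q 0 = coeff q' 0" "coeff r 0 = coeff r' 0" "coeff s 0 = coeff s' 0"
  shows "q = q'" "r = r'" "s = s'"
proof -
  have "sym_square_system N (q - q') (r - r') (s - s')"
    using assms(1,2) unfolding sym_square_system_def
    by (simp add: pderiv_diff right_diff_distrib smult_diff_right)
  from sym_square_system_zero[OF this] assms(3-5)
  show "q = q'" "r = r'" "s = s'" by simp_all
qed

text \<open>The coefficient recurrence gives \<open>(W L')' = N L\<close>; the three equations then
  follow from the product rule.\<close>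

lemma legendre_system:
  fixes n :: nat
  defines "L \<equiv> gen_poly n (leg_coeff n)"
  defines "R \<equiv> [:0, 1, 1:] * pderiv L"
  shows "sym_square_system (of_nat n * (of_nat n + 1)) (L * L) (L * R) (R * R)"
proof -
  define N :: rat where "N = of_nat n * (of_nat n + 1)"
  have L: "coeff L k = leg_coeff n k" for k by (auto simp: L_def coeff_gen_poly)
  have ode: "pderiv R = smult N L"
  proof (rule poly_eqI)
    fix k
    have "coeff (pderiv R) k = (of_nat k + 1) * coeff R (Suc k)" by (simp add: coeff_pderiv add.commute)
    also have "coeff R (Suc k) = (of_nat k + 1) * leg_coeff n (Suc k) + of_nat k * leg_coeff n k"
      unfolding R_def coeff_W_mult by (auto simp: coeff_pderiv L add.commute split: nat.splits)
    also have "(of_nat k + 1) * \<dots> = (of_nat k + 1) ^ 2 * leg_coeff n (Suc k) + of_nat k * (of_nat k + 1) * leg_coeff n k"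
      by (simp add: power2_eq_square algebra_simps)
    also have "\<dots> = N * leg_coeff n k" unfolding leg_coeff_Suc N_def by (simp add: algebra_simps)
    finally show "coeff (pderiv R) k = coeff (smult N L) k" by (simp add: L)
  qed
  have "[:0, 1, 1:] * pderiv (L * L) = smult 2 (L * R)"
    by (simp add: R_def pderiv_mult mult_ac smult_add_left numeral_poly algebra_simps flip: mult_2)
  moreover have "[:0, 1, 1:] * pderiv (L * R) = R * R + smult N ([:0, 1, 1:] * (L * L))"
  proof -
    have "[:0, 1, 1:] * pderiv (L * R) = ([:0, 1, 1:] * pderiv L) * R + [:0, 1, 1:] * L * pderiv R"
      by (simp add: pderiv_mult algebra_simps)
    also have "\<dots> = R * R + smult N ([:0, 1, 1:] * (L * L))"
      unfolding ode R_def[symmetric] by (simp only: mult_smult_right mult_smult_left mult_ac)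
    finally show ?thesis .
  qed
  moreover have "pderiv (R * R) = smult (2 * N) (L * R)"
    by (simp add: pderiv_mult ode mult_ac flip: smult_add_left)
  ultimately show ?thesis by (simp add: sym_square_system_def N_def)
qed

text \<open>Substituting \<open>t = x\<^sup>2 + x\<close>, where \<open>dt/dx = 2x + 1\<close> and \<open>(2x + 1)\<^sup>2 = 1 + 4t\<close>, turns the hypergeometric equation
  of \<open>Y(t) = \<Sum> sq_coeff n k t\<^sup>k\<close> into the same system.\<close>

lemma sq_coeff_system:
  fixes n :: nat
  defines "N \<equiv> (of_nat n * (of_nat n + 1) :: rat)"
  defines "Y \<equiv> gen_poly n (sq_coeff n)"
    and "Z1 \<equiv> gen_poly n (\<lambda>k. of_nat k * sq_coeff n k)"
    and "Z2 \<equiv> gen_poly n (\<lambda>k. of_nat k * (of_nat k * sq_coeff n k))"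
  defines "S \<equiv> [:1/2, 2:] * Z2 + [:0, 1:] * Z1 - [:0, N:] * Y"
  shows "sym_square_system N (pcompose Y [:0, 1, 1:]) ([:1/2, 1:] * pcompose Z1 [:0, 1, 1:]) (pcompose S [:0, 1, 1:])"
proof -
  let ?W = "[:0, 1, 1:] :: rat poly"
  have Z1: "[:0, 1:] * pderiv Y = Z1" and Z2: "[:0, 1:] * pderiv Z1 = Z2"
    by (simp_all only: Y_def Z1_def Z2_def euler_deriv_gen_poly)
  have cc: "coeff Y k = sq_coeff n k" "coeff Z1 k = of_nat k * sq_coeff n k"
    "coeff Z2 k = of_nat k * (of_nat k * sq_coeff n k)" for k
    by (auto simp: Y_def Z1_def Z2_def coeff_gen_poly)
  \<comment> \<open>\<open>S\<close> is what the second equation of the system forces as third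
    component. The third equation then amounts to the recurrence
    \<open>sq_coeff_Suc\<close>.\<close>
  have dS: "pderiv S = smult N Z1"
  proof (rule poly_eqI)
    fix k
    let ?k = "of_nat k :: rat"
    have "coeff (pderiv S) k = (?k + 1) * ((?k + 1) ^ 2 * sq_coeff n (Suc k) / 2
        + 2 * ?k ^ 2 * sq_coeff n k + ?k * sq_coeff n k - N * sq_coeff n k)"
      by (simp add: coeff_pderiv S_def cc power2_eq_square algebra_simps add_divide_distrib)
    also have "\<dots> = (?k + 1) ^ 3 * sq_coeff n (Suc k) / 2
        + (?k + 1) * (2 * ?k ^ 2 + ?k - N) * sq_coeff n k"
      by (simp add: power3_eq_cube power2_eq_square algebra_simps add_divide_distrib)
    also have "\<dots> = N * (?k * sq_coeff n k)"
      unfolding sq_coeff_Suc N_def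
      by (simp add: power2_eq_square algebra_simps add_divide_distrib diff_divide_distrib)
    finally show "coeff (pderiv S) k = coeff (smult N Z1) k" by (simp add: cc)
  qed
  have comp: "?W * pcompose f ?W = pcompose ([:0, 1:] * f) ?W" for f
    by (simp add: pcompose_mult pcompose_pCons)
  have dW: "pderiv ?W = [:1, 2:]" by (simp add: pderiv_pCons)
  have "?W * pderiv (pcompose Y ?W) = [:1, 2:] * (?W * pcompose (pderiv Y) ?W)"
    by (simp only: pderiv_pcompose dW mult_ac)
  also have "\<dots> = smult 2 ([:1/2, 1:] * pcompose Z1 ?W)"
    unfolding comp Z1 by (simp add: smult_add_right)
  finally have 1: "?W * pderiv (pcompose Y ?W) = smult 2 ([:1/2, 1:] * pcompose Z1 ?W)" .
  have "?W * pderiv ([:1/2, 1:] * pcompose Z1 ?W)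
      = ?W * pcompose Z1 ?W + [:1/2, 1:] * [:1, 2:] * (?W * pcompose (pderiv Z1) ?W)"
    by (simp only: pderiv_mult pderiv_pcompose dW ring_distribs mult_ac) (simp add: pderiv_pCons mult_ac)
  also have "[:1/2, 1:] * [:1, 2:] = pcompose [:1/2, 2:] ?W" by (simp add: pcompose_pCons)
  also have "?W * pcompose Z1 ?W + \<dots> * (?W * pcompose (pderiv Z1) ?W)
      = pcompose S ?W + smult N (?W * pcompose Y ?W)"
    unfolding comp Z2 S_def
    by (simp add: pcompose_add pcompose_diff pcompose_mult pcompose_pCons pcompose_smult smult_add_right)
  finally have 2: "?W * pderiv ([:1/2, 1:] * pcompose Z1 ?W) = pcompose S ?W + smult N (?W * pcompose Y ?W)" .
  have 3: "pderiv (pcompose S ?W) = smult (2 * N) ([:1/2, 1:] * pcompose Z1 ?W)"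
    by (simp add: pderiv_pcompose dW dS pcompose_smult smult_add_right)
  from 1 2 3 show ?thesis by (simp add: sym_square_system_def)
qed

text \<open>The polynomial identities given by uniqueness are evaluated at \<open>x = 1\<close>,
  where \<open>x^2 + x = 2\<close> and the Legendre argument \<open>2x + 1\<close> is
  \<open>3\<close>. \<open>R\<close> is the value of \<open>W L'\<close> there.\<close>

lemma clausen:
  fixes n :: nat
  defines "N \<equiv> (of_nat n * (of_nat n + 1) :: rat)"
  defines "u \<equiv> (\<Sum>k\<le>n. leg_coeff n k)" and "R \<equiv> 2 * (\<Sum>k\<le>n. of_nat k * leg_coeff n k)"
  defines "A \<equiv> \<lambda>i. \<Sum>k\<le>n. of_nat k ^ i * (sq_coeff n k * 2 ^ k)"
  shows "A 0 = u ^ 2" "3 * A 1 = 2 * u * R" "9 * A 2 = 2 * R ^ 2 - 4 * A 1 + 4 * N * A 0"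
proof -
  define L where "L = gen_poly n (leg_coeff n)"
  define R' where "R' = [:0, 1, 1:] * pderiv L"
  define Y where "Y = gen_poly n (sq_coeff n)"
  define Z1 where "Z1 = gen_poly n (\<lambda>k. of_nat k * sq_coeff n k)"
  define Z2 where "Z2 = gen_poly n (\<lambda>k. of_nat k * (of_nat k * sq_coeff n k))"
  define S where "S = [:1/2, 2:] * Z2 + [:0, 1:] * Z1 - [:0, N:] * Y"
  have s1: "sym_square_system N (L * L) (L * R') (R' * R')"
    using legendre_system[of n] by (simp only: N_def L_def R'_def)
  have s2: "sym_square_system N (pcompose Y [:0, 1, 1:]) ([:1/2, 1:] * pcompose Z1 [:0, 1, 1:]) (pcompose S [:0, 1, 1:])"
    using sq_coeff_system[of n] by (simp only: N_def Y_def Z1_def Z2_def S_def)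
  have c0: "leg_coeff n 0 = 1" "sq_coeff n 0 = 1" by (simp_all add: leg_coeff_def sq_coeff_def)
  have p0: "poly L 0 = 1" "poly R' 0 = 0" "poly Y 0 = 1" "poly Z1 0 = 0" "poly Z2 0 = 0"
    by (simp_all add: poly_0_coeff_0 L_def R'_def Y_def Z1_def Z2_def coeff_gen_poly c0)
  note eqs = sym_square_system_unique[OF s1 s2, unfolded poly_0_coeff_0[symmetric]]
  have S0: "poly S 0 = 0" by (simp add: S_def p0)
  \<comment> \<open>Both triples have the values \<open>1\<close>, \<open>0\<close>,
    \<open>0\<close> at the origin.\<close>
  have e: "L * L = pcompose Y [:0, 1, 1:]" "L * R' = [:1/2, 1:] * pcompose Z1 [:0, 1, 1:]" "R' * R' = pcompose S [:0, 1, 1:]"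
    by (rule eqs; simp add: poly_pcompose p0 S0)+
  have u: "poly L 1 = u" by (simp add: L_def poly_gen_poly u_def)
  have "poly ([:0, 1:] * pderiv L) 1 = (\<Sum>k\<le>n. of_nat k * leg_coeff n k)"
    by (simp only: L_def euler_deriv_gen_poly poly_gen_poly) simp
  then have R: "poly R' 1 = R" by (simp add: R'_def R_def)
  have A: "poly Y 2 = A 0" "poly Z1 2 = A 1" "poly Z2 2 = A 2"
    by (simp_all add: Y_def Z1_def Z2_def poly_gen_poly A_def power2_eq_square mult_ac)
  show "A 0 = u ^ 2" using arg_cong[OF e(1), of "\<lambda>f. poly f 1"]
    by (simp add: poly_pcompose u A power2_eq_square)
  show "3 * A 1 = 2 * u * R" using arg_cong[OF e(2), of "\<lambda>f. poly f 1"]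
    by (simp add: poly_pcompose u R A)
  show "9 * A 2 = 2 * R ^ 2 - 4 * A 1 + 4 * N * A 0" using arg_cong[OF e(3), of "\<lambda>f. poly f 1"]
    by (simp add: poly_pcompose u R A S_def power2_eq_square algebra_simps)
qed

section \<open>Contiguity relations\<close>

definition cube_term :: "nat \<Rightarrow> rat" where
  "cube_term k = of_nat ((2 * k) choose k) ^ 3 / (-8) ^ k"

definition square_term :: "nat \<Rightarrow> rat" where
  "square_term k = of_nat ((2 * k) choose k) ^ 2 / (-16) ^ k"

lemma cube_term_Suc: "(2 * of_nat k + 1) ^ 3 * cube_term k = - ((of_nat k + 1) ^ 3 * cube_term (Suc k))"
proof -
  have "((of_nat k + 1) * of_nat ((2 * Suc k) choose Suc k)) ^ 3
      = (2 * (2 * of_nat k + 1) * (of_nat ((2 * k) choose k) :: rat)) ^ 3"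
    unfolding central_binomial_Suc ..
  then show ?thesis by (simp only: cube_term_def power_Suc[of "-8"] power_mult_distrib) (simp add: divide_simps)
qed

lemma square_term_Suc: "(2 * of_nat k + 1) ^ 2 * square_term k = - 4 * (of_nat k + 1) ^ 2 * square_term (Suc k)"
proof -
  have "((of_nat k + 1) * of_nat ((2 * Suc k) choose Suc k)) ^ 2
      = (2 * (2 * of_nat k + 1) * (of_nat ((2 * k) choose k) :: rat)) ^ 2"
    unfolding central_binomial_Suc ..
  then show ?thesis by (simp only: square_term_def power_Suc[of "-16"] power_mult_distrib) (simp add: divide_simps)
qed

lemma two_k_plus_1_nonzero [simp]: "(2 * of_nat k + 1 :: rat) \<noteq> 0"
  using of_nat_0_le_iff[of k, where ?'a = rat] by (simp add: add_nonneg_eq_0_iff)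

text \<open>Telescoping: the summand plus its polynomial companion is the difference of
  \<open>8 * (2k + 1)^2 * cube_term k\<close> at consecutive indices. The new sum has no factor
  \<open>2k - 1\<close> in the denominator.\<close>

lemma sum_cube_term_div:
  "(\<Sum>k\<le>N. cube_term k / (2 * of_nat k - 1))
    = 8 * (2 * of_nat N + 1) ^ 2 * cube_term N - (\<Sum>k\<le>N. (36 * of_nat k ^ 2 + 34 * of_nat k + 9) * cube_term k)"
proof (induction N)
  case (Suc N)
  let ?d = "2 * of_nat N + 1 :: rat" and ?a = "cube_term N" and ?b = "cube_term (Suc N)"
  have "?d * (8 * ?d ^ 2 * ?a) = 8 * (?d ^ 3 * ?a)" by (simp only: power3_eq_cube power2_eq_square mult_ac)
  also have "\<dots> = 8 * (- ((of_nat N + 1) ^ 3 * ?b))" by (simp only: cube_term_Suc)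
  finally have a: "8 * ?d ^ 2 * ?a = 8 * (- ((of_nat N + 1) ^ 3 * ?b)) / ?d"
    by (metis nonzero_mult_div_cancel_left two_k_plus_1_nonzero)
  have "8 * ?d ^ 2 * ?a + ?b / ?d = 8 * (2 * of_nat N + 3) ^ 2 * ?b
      - (36 * (of_nat N + 1) ^ 2 + 34 * (of_nat N + 1) + 9) * ?b"
    unfolding a by (simp add: divide_simps) (simp add: power3_eq_cube power2_eq_square algebra_simps)
  then show ?case using Suc by (simp add: algebra_simps)
qed (simp add: cube_term_def)

text \<open>The same telescoping with \<open>8 * (2k + 1) * cube_term k\<close>, which lowers the
  order of the denominator by one.\<close>

lemma sum_cube_term_div_sq:
  "(\<Sum>k\<le>N. cube_term k / (2 * of_nat k - 1) ^ 2)
    = 8 * (2 * of_nat N + 1) * cube_term N - 3 * (\<Sum>k\<le>N. cube_term k / (2 * of_nat k - 1))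
      - (\<Sum>k\<le>N. (18 * of_nat k + 10) * cube_term k)"
proof (induction N)
  case (Suc N)
  let ?d = "2 * of_nat N + 1 :: rat" and ?a = "cube_term N" and ?b = "cube_term (Suc N)"
  have "?d ^ 2 * (8 * ?d * ?a) = 8 * (?d ^ 3 * ?a)" by (simp only: power3_eq_cube power2_eq_square mult_ac)
  then have "?d ^ 2 * (8 * ?d * ?a) = - 8 * (of_nat N + 1) ^ 3 * ?b" unfolding cube_term_Suc by simp
  then have a: "8 * ?d * ?a = - 8 * (of_nat N + 1) ^ 3 * ?b / ?d ^ 2" by (simp add: field_simps)
  have "8 * ?d * ?a + ?b / ?d ^ 2 = 8 * (2 * of_nat N + 3) * ?b - 3 * (?b / ?d)
      - (18 * (of_nat N + 1) + 10) * ?b"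
    unfolding a by (simp add: divide_simps) (simp add: power3_eq_cube power2_eq_square algebra_simps)
  then show ?case using Suc by (simp add: algebra_simps)
qed (simp add: cube_term_def)

text \<open>Telescoping with \<open>(4k + 1) * square_term k\<close>. The weight
  \<open>8k + 2\<close> is twice the weight \<open>4k + 1\<close> of \<open>leg_aux\<close>.\<close>

lemma sum_square_term_div_sq:
  "(\<Sum>k\<le>N. square_term k / (2 * of_nat k - 1) ^ 2)
    = (\<Sum>k\<le>N. (8 * of_nat k + 2) * square_term k) - (4 * of_nat N + 1) * square_term N"
proof (induction N)
  case (Suc N)
  let ?d = "2 * of_nat N + 1 :: rat" and ?a = "square_term N" and ?b = "square_term (Suc N)"
  have a: "?a = - 4 * (of_nat N + 1) ^ 2 * ?b / ?d ^ 2"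
    using square_term_Suc[of N] by (simp add: field_simps)
  have "?b / ?d ^ 2 - (4 * of_nat N + 1) * ?a = (8 * (of_nat N + 1) + 2) * ?b - (4 * (of_nat N + 1) + 1) * ?b"
    unfolding a by (simp add: divide_simps) (simp add: power2_eq_square algebra_simps)
  then show ?case using Suc by (simp add: algebra_simps)
qed (simp add: square_term_def)

section \<open>Reduction modulo \<open>p\<^sup>2\<close> to Legendre polynomials\<close>

context odd_prime
begin

lemma not_dvd_less: "0 < k \<Longrightarrow> k < p \<Longrightarrow> \<not> p dvd k"
  by (auto dest: dvd_imp_le)

lemma pint_inverse_neg_power [intro]:
  "inverse ((-16) ^ k) \<in> pint p" "inverse ((-8) ^ k) \<in> pint p" "inverse (2 ^ k) \<in> pint p" "inverse (16 ^ k) \<in> pint p"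
proof -
  have 1: "inverse (-16) = - ((1/2) ^ 4 :: rat)" and 2: "inverse (-8) = - ((1/2) ^ 3 :: rat)"
    and 3: "inverse 16 = ((1/2) ^ 4 :: rat)"
    by (simp_all add: power_numeral_reduce)
  show "inverse ((-16) ^ k) \<in> pint p"
    by (rule pint_inverse_power) (unfold 1, intro pint_uminus pint_power pint_half)
  show "inverse ((-8) ^ k) \<in> pint p"
    by (rule pint_inverse_power) (unfold 2, intro pint_uminus pint_power pint_half)
  show "inverse (16 ^ k) \<in> pint p"
    by (rule pint_inverse_power) (unfold 3, intro pint_power pint_half)
  show "inverse (2 ^ k) \<in> pint p"
    by (rule pint_inverse_power) (rule pint_inverse_2)
qed

lemma p_rat: "(of_nat p :: rat) = 2 * of_nat n + 1"
  by (subst p_eq) simp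

text \<open>Both sides obey first-order recurrences in \<open>k\<close> with the same left factor.
  The right factors are \<open>- (2k + 1)^2 / 4\<close> and \<open>(p^2 - (2k + 1)^2) / 4\<close>,
  which agree modulo \<open>p^2\<close>, and the left factor is a unit because
  \<open>2k + 2 < p\<close>.\<close>

lemma binomial_cong:
  "k \<le> n \<Longrightarrow> of_nat ((2 * k) choose k) / (-16) ^ k \<approx> of_nat ((n + k) choose (2 * k))"
proof (induction k)
  case (Suc k)
  define x where "x = (\<lambda>k. (of_nat ((2 * k) choose k) :: rat) / (-16) ^ k)"
  define y where "y = (\<lambda>k. (of_nat ((n + k) choose (2 * k)) :: rat))"
  let ?d = "2 * of_nat k + 1 :: rat"
  have IH: "x k \<approx> y k" using Suc by (simp add: x_def y_def)
  have "?d * (2 * of_nat k + 2) * x (Suc k) = 2 * ?d * ((of_nat k + 1) * of_nat ((2 * Suc k) choose Suc k)) / (-16) ^ Suc k"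
    unfolding x_def by (simp add: algebra_simps add_divide_distrib)
  also have "\<dots> = - (?d ^ 2) / 4 * x k"
    unfolding central_binomial_Suc x_def by (simp add: power2_eq_square field_simps)
  finally have x: "?d * (2 * of_nat k + 2) * x (Suc k) = - (?d ^ 2) / 4 * x k" .
  have "?d * (2 * of_nat k + 2) * y (Suc k)
      = (of_nat n * (of_nat n + 1) - of_nat k * (of_nat k + 1)) * y k"
    unfolding y_def by (rule binomial_double_Suc)
  also have "\<dots> = - (?d ^ 2) / 4 * y k + of_nat p ^ 2 * (y k / 4)"
    by (simp add: p_rat power2_eq_square field_simps)
  finally have y: "?d * (2 * of_nat k + 2) * y (Suc k) = - (?d ^ 2) / 4 * y k + of_nat p ^ 2 * (y k / 4)" .
  have q: "c \<in> pint p \<Longrightarrow> c / 4 \<in> pint p" for c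
    using pint_mult[OF _ pint_power[OF pint_half, of 2], of c] by (simp add: power2_eq_square)
  have "- (?d ^ 2) / 4 * x k + 0 \<approx> - (?d ^ 2) / 4 * y k + of_nat p ^ 2 * (y k / 4)"
    by (intro qcong_add qcong_cmult IH qcong_sym[OF p2_mult_cong2] q
        pint_uminus pint_power pint_add pint_mult pint_numeral pint_of_nat) (auto simp: y_def)
  then have *: "?d * (2 * of_nat k + 2) * x (Suc k) \<approx> ?d * (2 * of_nat k + 2) * y (Suc k)"
    unfolding x y by simp
  have "\<not> p dvd 2 * k + 1" "\<not> p dvd 2 * k + 2" by (rule not_dvd_less; use Suc.prems p_eq in linarith)+
  then have "inverse (of_nat (2 * k + 1)) \<in> pint p" "inverse (of_nat (2 * k + 2)) \<in> pint p" by blast+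
  then have "inverse ?d \<in> pint p" "inverse (2 * of_nat k + 2) \<in> pint p" by (simp_all add: algebra_simps)
  then have "inverse (?d * (2 * of_nat k + 2)) \<in> pint p" by blast
  moreover have "?d * (2 * of_nat k + 2) \<noteq> 0"
    using of_nat_0_le_iff[of k, where ?'a = rat] by (simp add: add_nonneg_eq_0_iff)
  ultimately have "x (Suc k) \<approx> y (Suc k)" using qcong_cancel[OF *] by blast
  then show ?case by (simp add: x_def y_def)
qed simp

text \<open>In this range \<open>p\<close> divides \<open>(2k)!\<close> but not
  \<open>k!\<close>.\<close>

lemma central_binomial_cong_0:
  assumes "n < k" "k < p" shows "(of_nat ((2 * k) choose k) :: rat) \<sim> 0"
proof -
  have "p dvd fact (2 * k)" using assms p_eq prime by (simp add: prime_dvd_fact_iff)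
  moreover have "\<not> p dvd fact k" using assms prime by (simp add: prime_dvd_fact_iff)
  moreover have "fact k * fact k * ((2 * k) choose k) = (fact (2 * k) :: nat)"
    using binomial_fact_lemma[of k "2 * k"] by simp
  ultimately have "p dvd (2 * k) choose k" using prime by (metis prime_dvd_mult_iff)
  then obtain c where "(2 * k) choose k = p * c" by blast
  then show ?thesis using p_mult_cong1[of "of_nat c"] by simp
qed

text \<open>Beyond \<open>n\<close> the left side contains the square of a multiple of
  \<open>p\<close>, in agreement with the vanishing of \<open>leg_coeff\<close>.\<close>

lemma square_term_cong: "k < p \<Longrightarrow> square_term k \<approx> leg_coeff n k"
proof (cases "k \<le> n")
  case True
  have "of_nat ((2 * k) choose k) * (of_nat ((2 * k) choose k) / (-16) ^ k)
      \<approx> of_nat ((2 * k) choose k) * of_nat ((n + k) choose (2 * k))"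
    by (intro qcong_cmult binomial_cong True) auto
  then show ?thesis by (simp add: square_term_def leg_coeff_def power2_eq_square mult.commute)
next
  case False
  assume "k < p"
  with False have c: "(of_nat ((2 * k) choose k) :: rat) \<sim> 0" by (intro central_binomial_cong_0) auto
  have "inverse ((-16) ^ k) * (of_nat ((2 * k) choose k) * of_nat ((2 * k) choose k)) \<approx> inverse ((-16) ^ k) * 0"
    by (intro qcong_cmult cong1_zero_mult c pint_inverse_neg_power)
  then show ?thesis using False by (simp add: square_term_def power2_eq_square divide_inverse mult.commute)
qed

text \<open>Since \<open>-16 = -8 * 2\<close>, the base \<open>-8\<close> leaves the power
  \<open>2^k\<close>, that is, the argument \<open>t = 2\<close> of \<open>clausen\<close>.\<close>

lemma cube_term_cong: "k < p \<Longrightarrow> cube_term k \<approx> sq_coeff n k * 2 ^ k"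
proof -
  assume k: "k < p"
  have "(of_nat ((2 * k) choose k) * 2 ^ k) * square_term k \<approx> (of_nat ((2 * k) choose k) * 2 ^ k) * leg_coeff n k"
    by (intro qcong_cmult square_term_cong k) auto
  moreover have "(of_nat ((2 * k) choose k) * 2 ^ k) * square_term k = cube_term k"
  proof -
    have "(-16 :: rat) ^ k = (-8) ^ k * 2 ^ k" by (simp flip: power_mult_distrib)
    then show ?thesis by (simp add: square_term_def cube_term_def power2_eq_square power3_eq_cube)
  qed
  ultimately show ?thesis by (simp add: sq_coeff_leg mult_ac)
qed

text \<open>\<open>leg_val\<close> is \<open>P\<^sub>n(3)\<close>, and \<open>leg_aux\<close> is \<open>P\<^sub>n(3) + 8 P\<^sub>n'(3)\<close>: this combination vanishes modulo \<open>p\<close> when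
  \<open>n\<close> is even, just as \<open>leg_val\<close> does when \<open>n\<close> is odd.\<close>

definition leg_val :: rat where
  "leg_val = (\<Sum>k\<le>n. leg_coeff n k)"

definition leg_aux :: rat where
  "leg_aux = (\<Sum>k\<le>n. (4 * of_nat k + 1) * leg_coeff n k)"

lemma pint_leg [intro, simp]: "leg_coeff n k \<in> pint p" "leg_val \<in> pint p" "leg_aux \<in> pint p"
proof -
  show *: "leg_coeff n k \<in> pint p" for k by (simp add: leg_coeff_def pint_mult)
  show "leg_val \<in> pint p" "leg_aux \<in> pint p" unfolding leg_val_def leg_aux_def
    by (intro pint_sum pint_mult pint_add * pint_numeral pint_of_nat)+
qed

lemma sum_cong_leg:
  assumes "\<And>k. c k \<in> pint p" "\<And>k. k < p \<Longrightarrow> f k \<approx> g k" "\<And>k. k > n \<Longrightarrow> g k = 0"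
  shows "(\<Sum>k\<le>p - 1. c k * f k) \<approx> (\<Sum>k\<le>n. c k * g k)"
proof -
  have "(\<Sum>k\<le>p - 1. c k * f k) \<approx> (\<Sum>k\<le>p - 1. c k * g k)"
    by (intro qcong_sum qcong_cmult assms) (use p_ge_3 in auto)
  also have "(\<Sum>k\<le>p - 1. c k * g k) = (\<Sum>k\<le>n. c k * g k)"
    by (rule sum.mono_neutral_right) (use p_eq assms(3) in auto)
  finally show ?thesis .
qed

lemma cube_sums_cong:
  shows "(\<Sum>k\<le>p - 1. cube_term k / (2 * of_nat k - 1)) \<approx> - 2 * leg_aux ^ 2 - 2 * (leg_val * leg_aux) - leg_val ^ 2"
    and "(\<Sum>k\<le>p - 1. cube_term k / (2 * of_nat k - 1) ^ 2) \<approx> 6 * leg_aux ^ 2 - leg_val ^ 2"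
proof -
  define R where "R = 2 * (\<Sum>k\<le>n. of_nat k * leg_coeff n k)"
  define A where "A = (\<lambda>i. \<Sum>k\<le>n. of_nat k ^ i * (sq_coeff n k * 2 ^ k))"
  let ?u = leg_val
  have w: "leg_aux = ?u + 2 * R"
    by (simp add: leg_aux_def leg_val_def R_def sum.distrib sum_distrib_left algebra_simps)
  \<comment> \<open>The eigenvalue is \<open>-1/4\<close> modulo \<open>p^2\<close>, which removes
    \<open>n\<close> from the final quadratic forms.\<close>
  have N: "(of_nat n * (of_nat n + 1) :: rat) = (of_nat p ^ 2 - 1) / 4"
    by (simp add: p_rat power2_eq_square field_simps)
  have cl: "A 0 = ?u ^ 2" "3 * A 1 = 2 * ?u * R" "9 * A 2 = 2 * R ^ 2 - 4 * A 1 + 4 * ((of_nat p ^ 2 - 1) / 4) * A 0"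
    using clausen[of n] by (simp_all only: A_def R_def leg_val_def N)
  \<comment> \<open>This disposes of the boundary terms of the telescoping sums, as
    \<open>p - 1 > n\<close>.\<close>
  have last: "c \<in> pint p \<Longrightarrow> c * cube_term (p - 1) \<approx> 0" for c
  proof -
    assume c: "c \<in> pint p"
    have "cube_term (p - 1) \<approx> sq_coeff n (p - 1) * 2 ^ (p - 1)" by (rule cube_term_cong) (use p_ge_3 in simp)
    moreover have "sq_coeff n (p - 1) = 0" using p_eq n_pos by simp
    ultimately have "cube_term (p - 1) \<approx> 0" by simp
    from qcong_cmult[OF this c] show ?thesis by simp
  qed
  have R: "R \<in> pint p" unfolding R_def by (intro pint_mult pint_sum) auto
  have sums: "(\<Sum>k\<le>p - 1. c k * cube_term k) \<approx> (\<Sum>k\<le>n. c k * (sq_coeff n k * 2 ^ k))"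
    if "\<And>k. c k \<in> pint p" for c
    by (rule sum_cong_leg) (use that cube_term_cong in auto)
  let ?S1 = "\<Sum>k\<le>p - 1. cube_term k / (2 * of_nat k - 1)"
  have s1: "(\<Sum>k\<le>n. (36 * of_nat k ^ 2 + 34 * of_nat k + 9) * (sq_coeff n k * 2 ^ k)) = 36 * A 2 + 34 * A 1 + 9 * A 0"
    by (simp add: A_def sum.distrib sum_distrib_left algebra_simps)
  have s2: "(\<Sum>k\<le>n. (18 * of_nat k + 10) * (sq_coeff n k * 2 ^ k)) = 18 * A 1 + 10 * A 0"
    by (simp add: A_def sum.distrib sum_distrib_left algebra_simps)
  have "?S1 \<approx> 0 - (36 * A 2 + 34 * A 1 + 9 * A 0)"
    unfolding sum_cube_term_div s1[symmetric] by (intro qcong_diff last sums pint_add pint_mult pint_power pint_numeral pint_of_nat)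
  also have "0 - (36 * A 2 + 34 * A 1 + 9 * A 0) = - 2 * leg_aux ^ 2 - 2 * (?u * leg_aux) - ?u ^ 2 - of_nat p ^ 2 * (4 * ?u ^ 2)"
  proof -
    \<comment> \<open>Grouping into multiples of \<open>9 * A 2\<close> and \<open>3 * A 1\<close>
      avoids division by \<open>3\<close>, so that \<open>p = 3\<close> needs no separate
      treatment.\<close>
    have "36 * A 2 + 34 * A 1 + 9 * A 0 = 4 * (9 * A 2) + 34 * A 1 + 9 * A 0" by simp
    also have "\<dots> = 8 * R ^ 2 + 6 * (3 * A 1) + (4 * of_nat p ^ 2 + 5) * A 0"
      unfolding cl(3) by (simp add: field_simps)
    also have "\<dots> = 8 * R ^ 2 + 12 * ?u * R + (4 * of_nat p ^ 2 + 5) * ?u ^ 2" unfolding cl(1,2) by simp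
    finally show ?thesis unfolding w by (simp add: power2_eq_square algebra_simps)
  qed
  also have "\<dots> \<approx> - 2 * leg_aux ^ 2 - 2 * (?u * leg_aux) - ?u ^ 2 - 0"
    by (intro qcong_diff p2_mult_cong2 qcong_refl) auto
  finally show S1: "?S1 \<approx> - 2 * leg_aux ^ 2 - 2 * (?u * leg_aux) - ?u ^ 2" by simp
  have "(\<Sum>k\<le>p - 1. cube_term k / (2 * of_nat k - 1) ^ 2)
      \<approx> 0 - 3 * (- 2 * leg_aux ^ 2 - 2 * (?u * leg_aux) - ?u ^ 2) - (18 * A 1 + 10 * A 0)"
    unfolding sum_cube_term_div_sq s2[symmetric] by (intro qcong_diff qcong_cmult last sums S1 pint_add pint_mult pint_power pint_numeral pint_of_nat)
  also have "0 - 3 * (- 2 * leg_aux ^ 2 - 2 * (?u * leg_aux) - ?u ^ 2) - (18 * A 1 + 10 * A 0)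
      = 0 - 3 * (- 2 * leg_aux ^ 2 - 2 * (?u * leg_aux) - ?u ^ 2) - (6 * (3 * A 1) + 10 * A 0)" by simp
  also have "\<dots> = 6 * leg_aux ^ 2 - ?u ^ 2"
    unfolding cl(1,2) unfolding w by (simp add: power2_eq_square algebra_simps)
  finally show "(\<Sum>k\<le>p - 1. cube_term k / (2 * of_nat k - 1) ^ 2) \<approx> 6 * leg_aux ^ 2 - ?u ^ 2" .
qed

end

section \<open>Kummer's summation modulo \<open>p\<^sup>2\<close>\<close>

definition kummer_term :: "rat \<Rightarrow> nat \<Rightarrow> rat" where
  "kummer_term a k = (-1) ^ k * (pochhammer a k / fact k) ^ 2"

definition kummer_sum :: "nat \<Rightarrow> rat \<Rightarrow> rat" where
  "kummer_sum N a = (\<Sum>k<N. kummer_term a k)"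

lemma kummer_term_Suc: "(of_nat k + 1) ^ 2 * kummer_term a (Suc k) = - ((a + of_nat k) ^ 2) * kummer_term a k"
proof -
  have "(of_nat k + 1 :: rat) \<noteq> 0" using of_nat_0_le_iff[of k, where ?'a = rat] by (simp add: add_nonneg_eq_0_iff)
  then show ?thesis
    by (simp add: kummer_term_def pochhammer_Suc divide_simps power_mult_distrib)
qed

lemma pochhammer_add_2: "a * (a + 1) * pochhammer (a + 2) k = pochhammer a k * (a + of_nat k) * (a + of_nat k + 1)"
  for a :: rat
  by (induction k) (simp_all add: pochhammer_Suc algebra_simps)

lemma kummer_term_add_2:
  "a ^ 2 * (a + 1) ^ 2 * kummer_term (a + 2) k = (a + of_nat k) ^ 2 * (a + of_nat k + 1) ^ 2 * kummer_term a k"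
proof -
  have "a ^ 2 * (a + 1) ^ 2 * kummer_term (a + 2) k = (-1) ^ k * ((a * (a + 1) * pochhammer (a + 2) k) / fact k) ^ 2"
    by (simp add: kummer_term_def power_mult_distrib power_divide)
  also have "\<dots> = (a + of_nat k) ^ 2 * (a + of_nat k + 1) ^ 2 * kummer_term a k"
    unfolding pochhammer_add_2 by (simp add: kummer_term_def power_mult_distrib power_divide)
  finally show ?thesis .
qed

text \<open>The right-hand side is the Wilf--Zeilberger certificate of Kummer's theorem.\<close>

lemma kummer_sum_add_2:
  assumes "a + 1 \<noteq> 0"
  shows "a ^ 2 * (a + 1) * (4 * (a + 1) * kummer_sum N (a + 2) + a * kummer_sum N a)
    = - (of_nat N ^ 2 * (2 * of_nat N ^ 2 + (6 * a + 2) * of_nat N + 5 * a ^ 2 + 3 * a) * kummer_term a N)"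
proof (induction N)
  case (Suc N)
  let ?t = "kummer_term a N" and ?N = "of_nat N :: rat"
  have "a ^ 2 * (a + 1) * (4 * (a + 1) * kummer_sum (Suc N) (a + 2) + a * kummer_sum (Suc N) a)
      = - (?N ^ 2 * (2 * ?N ^ 2 + (6 * a + 2) * ?N + 5 * a ^ 2 + 3 * a) * ?t)
        + (4 * (a ^ 2 * (a + 1) ^ 2 * kummer_term (a + 2) N) + a ^ 3 * (a + 1) * ?t)"
    using Suc by (simp add: kummer_sum_def algebra_simps power2_eq_square power3_eq_cube)
  also have "\<dots> = (2 * (?N + 1) ^ 2 + (6 * a + 2) * (?N + 1) + 5 * a ^ 2 + 3 * a) * ((a + ?N) ^ 2 * ?t)"
    unfolding kummer_term_add_2 by (simp add: algebra_simps power2_eq_square power3_eq_cube)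
  also have "(a + ?N) ^ 2 * ?t = - ((?N + 1) ^ 2 * kummer_term a (Suc N))"
    unfolding kummer_term_Suc by simp
  finally show ?case by (simp add: algebra_simps)
qed (simp add: kummer_sum_def)

text \<open>The quotient \<open>(1/2)_k / k!\<close> is \<open>binom(2k, k) / 4^k\<close>.\<close>

lemma kummer_term_half: "kummer_term (1/2) k = square_term k"
proof -
  have "pochhammer (1/2) k / fact k = (of_nat ((2 * k) choose k) / 4 ^ k :: rat)"
  proof (induction k)
    case (Suc k)
    have nz: "(of_nat k + 1 :: rat) \<noteq> 0" using of_nat_0_le_iff[of k, where ?'a = rat] by (simp add: add_nonneg_eq_0_iff)
    have "pochhammer (1/2) (Suc k) / fact (Suc k) = (pochhammer (1/2) k / fact k) * (1/2 + of_nat k) / (of_nat k + 1 :: rat)"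
      by (simp add: pochhammer_Suc add.commute)
    also have "\<dots> = (2 * (2 * of_nat k + 1) * of_nat ((2 * k) choose k)) / (4 * 4 ^ k) / (of_nat k + 1)"
    proof -
      have "1/2 + of_nat k = (2 * of_nat k + 1) / (2 :: rat)" by (simp add: field_simps)
      moreover have "x / f * (d / 2) / e = (2 * d * x) / (4 * f) / e" for x f d e :: rat by (simp add: mult_ac)
      ultimately show ?thesis unfolding Suc by (simp only:)
    qed
    also have "\<dots> = of_nat ((2 * Suc k) choose Suc k) / 4 ^ Suc k"
      unfolding central_binomial_Suc[symmetric] using nz by (simp del: binomial_Suc_Suc)
    finally show ?case .
  qed simp
  moreover have "(-1) ^ k / (4 ^ k) ^ 2 = (1 / (-16) ^ k :: rat)"
  proof -
    have "(-16 :: rat) ^ k * (-1) ^ k = 16 ^ k" by (simp flip: power_mult_distrib)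
    moreover have "(4 ^ k) ^ 2 = (16 :: rat) ^ k" by (simp add: power2_eq_square flip: power_mult_distrib)
    ultimately show ?thesis by (simp add: field_simps)
  qed
  ultimately show ?thesis
    by (simp add: kummer_term_def square_term_def power_divide) (metis mult.commute mult_1 times_divide_eq_right)
qed

text \<open>Passing from \<open>1/2\<close> to \<open>-1/2\<close> multiplies the Pochhammer symbol
  by \<open>- 1 / (2k - 1)\<close>; this is the source of the sum in
  \<open>sum_square_term_div_sq\<close>.\<close>

lemma kummer_term_minus_half: "kummer_term (-1/2) k = square_term k / (2 * of_nat k - 1) ^ 2"
proof -
  have "pochhammer (-1/2 :: rat) k * (2 * of_nat k - 1) = - pochhammer (1/2) k"
  proof (induction k)
    case (Suc k)
    have "pochhammer (-1/2 :: rat) (Suc k) * (2 * of_nat (Suc k) - 1)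
        = (pochhammer (-1/2) k * (2 * of_nat k - 1)) * (1/2 + of_nat k)"
      by (simp add: pochhammer_Suc algebra_simps)
    then show ?case unfolding Suc by (simp add: pochhammer_Suc)
  qed simp
  moreover have "2 * of_nat k - 1 \<noteq> (0 :: rat)"
  proof
    assume "2 * of_nat k - 1 = (0 :: rat)"
    then have "of_nat (2 * k) = (of_nat 1 :: rat)" by simp
    then have "2 * k = 1" by (metis of_nat_eq_iff)
    then show False by presburger
  qed
  ultimately have "pochhammer (-1/2 :: rat) k = - pochhammer (1/2) k / (2 * of_nat k - 1)"
    by (simp add: field_simps)
  then show ?thesis
    by (simp only: kummer_term_half[symmetric] kummer_term_def) (simp add: power_divide power_mult_distrib mult.commute)
qed

context odd_prime
begin

abbreviation "K \<equiv> kummer_sum p"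

lemma pint_fact [intro]: "k < p \<Longrightarrow> inverse (fact k) \<in> pint p"
  using pint_inverse_nat[of "fact k"] prime by (simp add: prime_dvd_fact_iff)

lemma pint_pochhammer [intro]: "a \<in> pint p \<Longrightarrow> pochhammer a k \<in> pint p"
  by (induction k) (auto simp: pochhammer_Suc)

text \<open>The first is termwise. The second uses the contiguity relation for
  \<open>square_term\<close>, whose boundary term vanishes modulo \<open>p^2\<close>.\<close>

lemma kummer_sum_leg: "K (1/2) \<approx> leg_val" "K (-1/2) \<approx> 2 * leg_aux"
proof -
  have lt: "{..<p} = {..p - 1}" using p_ge_3 by auto
  have "(\<Sum>k\<le>p - 1. 1 * square_term k) \<approx> (\<Sum>k\<le>n. 1 * leg_coeff n k)"
    by (rule sum_cong_leg) (auto intro: square_term_cong)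
  then show "K (1/2) \<approx> leg_val" by (simp add: kummer_sum_def kummer_term_half lt leg_val_def)
  have 1: "(\<Sum>k\<le>p - 1. (8 * of_nat k + 2) * square_term k) \<approx> (\<Sum>k\<le>n. (8 * of_nat k + 2) * leg_coeff n k)"
    by (rule sum_cong_leg) (auto intro: square_term_cong)
  have "square_term (p - 1) \<approx> leg_coeff n (p - 1)" by (rule square_term_cong) (use p_ge_3 in simp)
  moreover have "leg_coeff n (p - 1) = 0" using p_eq n_pos by simp
  ultimately have 2: "(4 * of_nat (p - 1) + 1) * square_term (p - 1) \<approx> (4 * of_nat (p - 1) + 1) * 0"
    by (intro qcong_cmult pint_add pint_mult pint_numeral pint_of_nat) simp
  have "(\<Sum>k\<le>n. (8 * of_nat k + 2) * leg_coeff n k) - (4 * of_nat (p - 1) + 1) * 0 = 2 * leg_aux"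
    by (simp add: leg_aux_def sum_distrib_left algebra_simps)
  with qcong_diff[OF 1 2] show "K (-1/2) \<approx> 2 * leg_aux"
    by (simp only: kummer_sum_def kummer_term_minus_half lt sum_square_term_div_sq)
qed

text \<open>For \<open>k < p\<close> the factorials are units, so each term is a polynomial in
  \<open>a\<close> with \<open>p\<close>-integral coefficients. Its expansion at \<open>a\<close>
  stops after the linear term modulo \<open>p^2\<close>, and the linear terms of the two shifts
  cancel.\<close>

lemma kummer_sum_symm_diff:
  assumes a: "a \<in> pint p" and c: "c \<in> pint p"
  shows "K a \<approx> (K (a + of_nat p * c) + K (a - of_nat p * c)) / 2"
    and "K (a + of_nat p * c) \<sim> K a"
proof -
  define P where "P = (of_nat p :: rat)"
  have P: "P \<in> pint p" by (simp add: P_def)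
  \<comment> \<open>One \<open>D\<close> serves both signs: it is \<open>c\<close> times the
    derivative of the Pochhammer symbol.\<close>
  have ex: "\<exists>D\<in>pint p. pochhammer (a + P * c) k \<approx> pochhammer a k + P * D
      \<and> pochhammer (a - P * c) k \<approx> pochhammer a k - P * D" for k
  proof (induction k)
    case 0
    show ?case by (rule bexI[of _ 0]) auto
  next
    case (Suc k)
    then obtain D where D: "D \<in> pint p" "pochhammer (a + P * c) k \<approx> pochhammer a k + P * D"
      "pochhammer (a - P * c) k \<approx> pochhammer a k - P * D" by blast
    define b where "b = a + of_nat k"
    define q where "q = pochhammer a k"
    have pi: "b \<in> pint p" "q \<in> pint p" using a by (auto simp: b_def q_def)
    let ?D = "q * c + b * D"
    have "pochhammer (a + P * c) k * (b + P * c) \<approx> (q + P * D) * (b + P * c)"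
      using D pi c P unfolding q_def[symmetric] by (intro qcong_mult) auto
    also have "(q + P * D) * (b + P * c) = q * b + P * ?D + P ^ 2 * (D * c)"
      by (simp add: algebra_simps power2_eq_square)
    also have "\<dots> \<approx> q * b + P * ?D + 0"
      unfolding P_def using D c by (intro qcong_add p2_mult_cong2) auto
    finally have 1: "pochhammer (a + P * c) (Suc k) \<approx> pochhammer a (Suc k) + P * ?D"
      by (simp add: pochhammer_Suc b_def q_def algebra_simps)
    have "pochhammer (a - P * c) k * (b - P * c) \<approx> (q - P * D) * (b - P * c)"
      using D pi c P unfolding q_def[symmetric] by (intro qcong_mult) auto
    also have "(q - P * D) * (b - P * c) = q * b - P * ?D + P ^ 2 * (D * c)"
      by (simp add: algebra_simps power2_eq_square)
    also have "\<dots> \<approx> q * b - P * ?D + 0"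
      unfolding P_def using D c by (intro qcong_add p2_mult_cong2) auto
    finally have 2: "pochhammer (a - P * c) (Suc k) \<approx> pochhammer a (Suc k) - P * ?D"
      by (simp add: pochhammer_Suc b_def q_def algebra_simps)
    show ?case using 1 2 D c pi by (intro bexI[of _ ?D]) auto
  qed
  have ex': "\<exists>D\<in>pint p. kummer_term (a + P * c) k \<approx> kummer_term a k + P * D
      \<and> kummer_term (a - P * c) k \<approx> kummer_term a k - P * D" if k: "k < p" for k
  proof -
    obtain D where D: "D \<in> pint p" "pochhammer (a + P * c) k \<approx> pochhammer a k + P * D"
      "pochhammer (a - P * c) k \<approx> pochhammer a k - P * D" using ex by blast
    define e where "e = ((-1) ^ k * (inverse (fact k)) ^ 2 :: rat)"
    define q where "q = pochhammer a k"
    have m1: "(-1) ^ k \<in> pint p" using pint_uminus[of 1] by auto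
    have pi: "e \<in> pint p" "q \<in> pint p" using a k m1 by (auto simp: e_def q_def)
    have kt: "kummer_term b k = e * (pochhammer b k) ^ 2" for b
      by (simp add: kummer_term_def e_def divide_inverse power_mult_distrib power_inverse)
    have "kummer_term (a + P * c) k \<approx> e * (q + P * D) ^ 2" unfolding kt q_def
      using D pi P by (intro qcong_cmult qcong_power) (auto simp: q_def)
    also have "e * (q + P * D) ^ 2 = kummer_term a k + P * (2 * e * q * D) + P ^ 2 * (e * D ^ 2)"
      by (simp add: kt q_def power2_eq_square algebra_simps)
    also have "\<dots> \<approx> kummer_term a k + P * (2 * e * q * D) + 0"
      unfolding P_def using D pi by (intro qcong_add p2_mult_cong2) auto
    finally have 1: "kummer_term (a + P * c) k \<approx> kummer_term a k + P * (2 * e * q * D)" by simp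
    have "kummer_term (a - P * c) k \<approx> e * (q - P * D) ^ 2" unfolding kt q_def
      using D pi P by (intro qcong_cmult qcong_power) (auto simp: q_def)
    also have "e * (q - P * D) ^ 2 = kummer_term a k - P * (2 * e * q * D) + P ^ 2 * (e * D ^ 2)"
      by (simp add: kt q_def power2_eq_square algebra_simps)
    also have "\<dots> \<approx> kummer_term a k - P * (2 * e * q * D) + 0"
      unfolding P_def using D pi by (intro qcong_add p2_mult_cong2) auto
    finally have 2: "kummer_term (a - P * c) k \<approx> kummer_term a k - P * (2 * e * q * D)" by simp
    show ?thesis using 1 2 D pi by (intro bexI[of _ "2 * e * q * D"]) auto
  qed
  then obtain D where D: "\<And>k. k < p \<Longrightarrow> D k \<in> pint p"
    "\<And>k. k < p \<Longrightarrow> kummer_term (a + P * c) k \<approx> kummer_term a k + P * D k"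
    "\<And>k. k < p \<Longrightarrow> kummer_term (a - P * c) k \<approx> kummer_term a k - P * D k" by metis
  define E where "E = (\<Sum>k<p. D k)"
  have E: "E \<in> pint p" using D by (auto simp: E_def)
  have "K (a + P * c) \<approx> (\<Sum>k<p. kummer_term a k + P * D k)" unfolding kummer_sum_def
    by (intro qcong_sum D) simp
  then have 1: "K (a + P * c) \<approx> K a + P * E"
    by (simp add: kummer_sum_def E_def sum.distrib sum_distrib_left)
  have "K (a - P * c) \<approx> (\<Sum>k<p. kummer_term a k - P * D k)" unfolding kummer_sum_def
    by (intro qcong_sum D) simp
  then have 2: "K (a - P * c) \<approx> K a - P * E"
    by (simp add: kummer_sum_def E_def sum_subtractf sum_distrib_left)
  have "1/2 * (K (a + P * c) + K (a - P * c)) \<approx> 1/2 * ((K a + P * E) + (K a - P * E))"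
    by (intro qcong_cmult qcong_add 1 2 pint_half)
  then show "K a \<approx> (K (a + of_nat p * c) + K (a - of_nat p * c)) / 2"
    unfolding P_def using qcong_sym by auto
  have "K a + P * E \<sim> K a + 0" unfolding P_def by (intro qcong_add p_mult_cong1 E qcong_refl)
  then show "K (a + of_nat p * c) \<sim> K a"
    using cong2_imp_cong1[OF 1] unfolding P_def by (metis add_0_right qcong_trans)
qed

text \<open>Shifting \<open>1/2\<close> by \<open>p/2\<close> and \<open>- p/2\<close> gives
  \<open>n + 1\<close> and \<open>- n\<close>; shifting \<open>-1/2\<close> gives \<open>n\<close>
  and \<open>- n - 1\<close>.\<close>

lemma kummer_sum_halves:
  "K (1/2) \<approx> (K (of_int (int n + 1)) + K (of_int (- int n))) / 2"
  "K (-1/2) \<approx> (K (of_int (int n)) + K (of_int (- int n - 1))) / 2"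
  "K (of_int (- int n)) \<sim> K (1/2)"
  "K (of_int (- int n - 1)) \<sim> K (-1/2)"
proof -
  have h: "1/2 + of_nat p * (1/2) = (of_int (int n + 1) :: rat)" "1/2 - of_nat p * (1/2) = (of_int (- int n) :: rat)"
     "-1/2 + of_nat p * (1/2) = (of_int (int n) :: rat)" "-1/2 - of_nat p * (1/2) = (of_int (- int n - 1) :: rat)"
    by (simp_all add: p_rat field_simps)
  have m: "-1/2 \<in> pint p" using pint_uminus[OF pint_half] by simp
  show "K (1/2) \<approx> (K (of_int (int n + 1)) + K (of_int (- int n))) / 2"
    using kummer_sum_symm_diff(1)[OF pint_half pint_half] unfolding h .
  show "K (-1/2) \<approx> (K (of_int (int n)) + K (of_int (- int n - 1))) / 2"
    using kummer_sum_symm_diff(1)[OF m pint_half] unfolding h .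
  show "K (of_int (- int n)) \<sim> K (1/2)"
    using kummer_sum_symm_diff(2)[OF pint_half m] unfolding h(2)[symmetric] by simp
  show "K (of_int (- int n - 1)) \<sim> K (-1/2)"
    using kummer_sum_symm_diff(2)[OF m m] unfolding h(4)[symmetric] by simp
qed

text \<open>Among \<open>p\<close> consecutive integers one is a multiple of
  \<open>p\<close>.\<close>

lemma pochhammer_p: "pochhammer (of_int a) p \<sim> 0"
proof -
  have "\<exists>i<p. int p dvd a + int i"
  proof (intro exI conjI)
    have "(a + (- a) mod int p) mod int p = 0" by (simp add: mod_add_right_eq)
    then show "int p dvd a + int (nat ((- a) mod int p))" using p_ge_3 by auto
    show "nat ((- a) mod int p) < p" using p_ge_3 by (simp add: nat_less_iff)
  qed
  then obtain i where i: "i < p" "int p dvd a + int i" by blast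
  have "int p dvd pochhammer a p"
    unfolding pochhammer_prod using i by (metis atLeastLessThan_iff dvd_prodI dvd_trans finite_atLeastLessThan le0)
  then obtain c where "pochhammer a p = int p * c" by blast
  moreover have "pochhammer (of_int a :: rat) p = of_int (pochhammer a p)"
    by (simp add: pochhammer_prod)
  ultimately show ?thesis using p_mult_cong1[of "of_int c"] by simp
qed

text \<open>This is \<open>kummer_sum_add_2\<close> with \<open>N = p\<close>, divided by the unit
  \<open>a^2 * (a + 1)\<close>; the certificate vanishes modulo \<open>p^2\<close>.\<close>

lemma kummer_sum_step:
  assumes "\<not> int p dvd a" "\<not> int p dvd a + 1"
  shows "4 * of_int (a + 1) * K (of_int (a + 2)) \<approx> - of_int a * K (of_int a)"
proof -
  let ?a = "of_int a :: rat"
  define s where "s = 2 * of_nat p ^ 2 + (6 * ?a + 2) * of_nat p + 5 * ?a ^ 2 + 3 * ?a"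
  have s: "s \<in> pint p" unfolding s_def
    by (intro pint_add pint_mult pint_power pint_numeral pint_of_nat pint_of_int)
  have nz: "?a \<noteq> 0" "?a + 1 \<noteq> 0"
  proof -
    have "a \<noteq> 0" "a + 1 \<noteq> 0" using assms by auto
    then show "?a \<noteq> 0" "?a + 1 \<noteq> 0" by (metis of_int_0_eq_iff of_int_1 of_int_add)+
  qed
  define r where "r = ?a ^ 2 * (?a + 1)"
  have r: "r \<noteq> 0" "inverse r \<in> pint p"
  proof -
    show "r \<noteq> 0" using nz by (simp add: r_def)
    have "inverse ?a \<in> pint p" "inverse (of_int (a + 1)) \<in> pint p" using assms by blast+
    then show "inverse r \<in> pint p" unfolding r_def by (intro pint_inverse_mult pint_inverse_power) auto
  qed
  obtain q where q: "p = Suc q" using p_ge_3 by (cases p) auto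
  define e where "e = (-1) ^ p * inverse (fact (p - 1) :: rat) ^ 2"
  have e: "e \<in> pint p" unfolding e_def
    by (intro pint_mult pint_power pint_uminus pint_fact) (use p_ge_3 in auto)
  \<comment> \<open>The factor \<open>p^2\<close> of the certificate cancels the one in
    \<open>(p!)^2\<close>, leaving the square of a multiple of \<open>p\<close>.\<close>
  have "of_nat p ^ 2 * kummer_term ?a p = e * (pochhammer ?a p * pochhammer ?a p)"
  proof -
    have "fact p = (of_nat p * fact (p - 1) :: rat)" using q by simp
    then show ?thesis unfolding kummer_term_def e_def
      using p_ge_3 by (simp add: power2_eq_square field_simps)
  qed
  then have "r * (4 * (?a + 1) * K (?a + 2) + ?a * K ?a) = - s * e * (pochhammer ?a p * pochhammer ?a p)"
    using kummer_sum_add_2[OF nz(2), of p, folded r_def s_def] by (simp add: mult_ac)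
  also have "\<dots> \<approx> - s * e * 0" using s e by (intro qcong_cmult cong1_zero_mult pochhammer_p) auto
  finally have "4 * (?a + 1) * K (?a + 2) + ?a * K ?a \<approx> 0" using qcong_cancel[OF _ r(2,1)] by simp
  from qcong_diff[OF this qcong_refl[of "?a * K ?a"]] show ?thesis by simp
qed

end

section \<open>Truncated Kummer sums at integers\<close>

lemma sum_alternating: "(\<Sum>k<2 * N + 1. (-1) ^ k) = (1 :: rat)"
  by (induction N) auto

lemma sum_alternating_squares: "(\<Sum>k<2 * N + 1. (-1) ^ k * (of_nat k + 1) ^ 2) = ((2 * of_nat N + 1) * (of_nat N + 1) :: rat)"
  by (induction N) (auto simp: power2_eq_square algebra_simps)

lemma kummer_sum_0: "N > 0 \<Longrightarrow> kummer_sum N 0 = 1"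
proof -
  assume "N > 0"
  then have "kummer_sum N 0 = (\<Sum>k\<in>{0}. kummer_term 0 k)" unfolding kummer_sum_def
    by (intro sum.mono_neutral_right) (auto simp: kummer_term_def pochhammer_0_left)
  then show ?thesis by (simp add: kummer_term_def)
qed

lemma kummer_sum_minus_1: "N > 1 \<Longrightarrow> kummer_sum N (-1) = 0"
proof -
  assume N: "N > 1"
  have "pochhammer (-1 :: rat) k = 0" if "k > 1" for k
    using that pochhammer_of_nat_eq_0_lemma[of 1 k, where ?'a = rat] by simp
  then have "kummer_sum N (-1) = (\<Sum>k\<in>{0, 1}. kummer_term (-1) k)" unfolding kummer_sum_def
    using N by (intro sum.mono_neutral_right) (auto simp: kummer_term_def)
  then show ?thesis by (simp add: kummer_term_def)
qed

lemma kummer_sum_1: "kummer_sum (2 * N + 1) 1 = 1"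
  using sum_alternating[of N] by (simp add: kummer_sum_def kummer_term_def flip: pochhammer_fact)

text \<open>For \<open>2 * N + 1 = p\<close> this value is a multiple of \<open>p\<close>, a factor
  inherited by all positive even arguments below \<open>p\<close>.\<close>

lemma kummer_sum_2: "kummer_sum (2 * N + 1) 2 = (2 * of_nat N + 1) * (of_nat N + 1)"
proof -
  have "kummer_term 2 k = (-1) ^ k * (of_nat k + 1) ^ 2" for k
  proof -
    have "pochhammer 2 k = (fact (Suc k) :: rat)"
      using pochhammer_rec[of "1 :: rat" k] by (simp add: pochhammer_fact)
    then show ?thesis by (simp add: kummer_term_def add.commute)
  qed
  then show ?thesis using sum_alternating_squares[of N] by (simp add: kummer_sum_def)
qed

abbreviation (input) cbinom :: "nat \<Rightarrow> rat" where "cbinom j \<equiv> of_nat ((2 * j) choose j)"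

context odd_prime
begin

lemma pint_inverse_cbinom: "2 * j < p \<Longrightarrow> inverse (cbinom j) \<in> pint p"
proof -
  assume "2 * j < p"
  then have "\<not> p dvd fact (2 * j)" using prime by (simp add: prime_dvd_fact_iff)
  moreover have "(2 * j) choose j dvd fact (2 * j)"
    using binomial_fact_lemma[of j "2 * j"] by (metis dvd_triv_right mult_2 le_add1)
  ultimately show ?thesis using dvd_trans by blast
qed

lemma not_int_dvd: "\<not> p dvd k \<Longrightarrow> a = int k \<or> a = - int k \<Longrightarrow> \<not> int p dvd a"
  by auto

lemma pint_m1 [intro, simp]: "(-1) ^ k \<in> pint p"
  using pint_power[OF pint_uminus[of 1], of k] by simp

text \<open>Descending from the value \<open>1\<close> at \<open>0\<close>, each step multiplies by
  \<open>- 2 * (2j + 1) / (j + 1)\<close>, minus the ratio of consecutive central binomials.\<close>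

lemma kummer_sum_neg_even: "2 * j < p \<Longrightarrow> K (of_int (- (2 * int j))) \<approx> (-1) ^ j * cbinom j"
proof (induction j)
  case 0
  then show ?case using kummer_sum_0[of p] by simp
next
  case (Suc j)
  let ?a = "- (2 * int (Suc j))"
  have nd: "\<not> p dvd 2 * j + 1" "\<not> p dvd 2 * j + 2" by (rule not_dvd_less; use Suc.prems in simp)+
  have IH: "K (of_int (- (2 * int j))) \<approx> (-1) ^ j * cbinom j" using Suc by simp
  have st: "4 * of_int (?a + 1) * K (of_int (?a + 2)) \<approx> - of_int ?a * K (of_int ?a)"
    by (intro kummer_sum_step) (rule not_int_dvd[OF nd(2)], simp, rule not_int_dvd[OF nd(1)], simp)
  have inv: "inverse (2 * of_nat j + 2) \<in> pint p" using pint_inverse_nat[OF nd(2)] by (simp add: add.commute)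
  have nz: "2 * of_nat j + 2 \<noteq> (0 :: rat)" using of_nat_0_le_iff[of j, where ?'a = rat] by (simp add: add_nonneg_eq_0_iff)
  have "(2 * of_nat j + 2) * K (of_int ?a) = - of_int ?a * K (of_int ?a)" by simp
  also have "- of_int ?a * K (of_int ?a) \<approx> 4 * of_int (?a + 1) * K (of_int (?a + 2))" by (rule qcong_sym[OF st])
  also have "4 * of_int (?a + 1) * K (of_int (?a + 2)) = (- (4 * (2 * of_nat j + 1))) * K (of_int (- (2 * int j)))"
  proof -
    have "?a + 2 = - (2 * int j)" by simp
    then show ?thesis by (simp only:) (simp add: algebra_simps)
  qed
  also have "(- (4 * (2 * of_nat j + 1))) * K (of_int (- (2 * int j))) \<approx> (- (4 * (2 * of_nat j + 1))) * ((-1) ^ j * cbinom j)"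
    by (intro qcong_cmult IH pint_uminus pint_mult pint_add pint_numeral pint_of_nat)
  also have "(- (4 * (2 * of_nat j + 1))) * ((-1) ^ j * cbinom j) = 2 * (-1) ^ Suc j * (2 * (2 * of_nat j + 1) * cbinom j)"
    by (simp add: algebra_simps)
  also have "\<dots> = (2 * of_nat j + 2) * ((-1) ^ Suc j * cbinom (Suc j))"
    unfolding central_binomial_Suc[symmetric] by (simp only: algebra_simps)
  finally show ?case using qcong_cancel[OF _ inv nz] by blast
qed

text \<open>Ascending from the value \<open>1\<close> at \<open>1\<close>, each step multiplies by
  \<open>-1/16\<close> times the ratio of consecutive central binomials.\<close>

lemma kummer_sum_odd: "2 * j + 1 < p \<Longrightarrow> K (of_int (2 * int j + 1)) \<approx> (-1) ^ j * cbinom j / 16 ^ j"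
proof (induction j)
  case 0
  then show ?case using kummer_sum_1[of n, folded p_eq] by simp
next
  case (Suc j)
  let ?a = "2 * int j + 1"
  have nd: "\<not> p dvd 2 * j + 1" "\<not> p dvd 2 * j + 2" by (rule not_dvd_less; use Suc.prems in simp)+
  have IH: "K (of_int ?a) \<approx> (-1) ^ j * cbinom j / 16 ^ j" using Suc by simp
  have st: "4 * of_int (?a + 1) * K (of_int (?a + 2)) \<approx> - of_int ?a * K (of_int ?a)"
    by (intro kummer_sum_step) (rule not_int_dvd[OF nd(1)], simp, rule not_int_dvd[OF nd(2)], simp)
  have "inverse (of_nat (2 * j + 2)) * (1/2) ^ 2 \<in> pint p"
    by (intro pint_mult pint_inverse_nat nd pint_power pint_half)
  then have inv: "inverse (4 * of_int (?a + 1)) \<in> pint p"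
    by (simp add: power2_eq_square field_simps)
  have nz: "4 * of_int (?a + 1) \<noteq> (0 :: rat)"
    using of_nat_0_le_iff[of j, where ?'a = rat] by (simp add: add_nonneg_eq_0_iff)
  note st
  also have "- of_int ?a * K (of_int ?a) \<approx> - of_int ?a * ((-1) ^ j * cbinom j / 16 ^ j)"
    by (intro qcong_cmult IH pint_uminus pint_of_int)
  also have "- of_int ?a * ((-1) ^ j * cbinom j / 16 ^ j) = (-1) ^ Suc j * (2 * (2 * of_nat j + 1) * cbinom j) * 8 / 16 ^ Suc j"
    by (simp add: field_simps)
  also have "\<dots> = 4 * of_int (?a + 1) * ((-1) ^ Suc j * cbinom (Suc j) / 16 ^ Suc j)"
    unfolding central_binomial_Suc[symmetric] by (simp del: binomial_Suc_Suc add: field_simps)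
  finally have "K (of_int (?a + 2)) \<approx> (-1) ^ Suc j * cbinom (Suc j) / 16 ^ Suc j"
    using qcong_cancel[OF _ inv nz] by blast
  moreover have "?a + 2 = 2 * int (Suc j) + 1" by simp
  ultimately show ?case by (simp only:)
qed

text \<open>The value at \<open>-1\<close> is \<open>0\<close>, and every step divides by a
  unit.\<close>

lemma kummer_sum_neg_odd: "2 * j + 1 < p \<Longrightarrow> K (of_int (- (2 * int j + 1))) \<approx> 0"
proof (induction j)
  case 0
  then show ?case using kummer_sum_minus_1[of p] by simp
next
  case (Suc j)
  let ?a = "- (2 * int j + 3)"
  have nd: "\<not> p dvd 2 * j + 3" "\<not> p dvd 2 * j + 2" by (rule not_dvd_less; use Suc.prems in simp)+
  have IH: "K (of_int (- (2 * int j + 1))) \<approx> 0" using Suc by simp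
  have st: "4 * of_int (?a + 1) * K (of_int (?a + 2)) \<approx> - of_int ?a * K (of_int ?a)"
    by (intro kummer_sum_step) (rule not_int_dvd[OF nd(1)], simp, rule not_int_dvd[OF nd(2)], simp)
  have e: "?a + 2 = - (2 * int j + 1)" by simp
  have "- of_int ?a * K (of_int ?a) \<approx> 4 * of_int (?a + 1) * K (of_int (?a + 2))" by (rule qcong_sym[OF st])
  also have "4 * of_int (?a + 1) * K (of_int (?a + 2)) \<approx> 4 * of_int (?a + 1) * 0"
    unfolding e by (intro qcong_cmult IH pint_mult pint_numeral pint_of_int)
  also have "4 * of_int (?a + 1) * 0 = - of_int ?a * (0 :: rat)" by simp
  finally have *: "- of_int ?a * K (of_int ?a) \<approx> - of_int ?a * 0" .
  have "inverse (- of_int ?a) \<in> pint p" using pint_inverse_nat[OF nd(1)] by (simp add: add.commute)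
  moreover have "- of_int ?a \<noteq> (0 :: rat)"
    using of_nat_0_le_iff[of j, where ?'a = rat] by (simp add: add_nonneg_eq_0_iff)
  ultimately have "K (of_int ?a) \<approx> 0" using qcong_cancel[OF *] by blast
  moreover have "?a = - (2 * int (Suc j) + 1)" by simp
  ultimately show ?case by (simp only:)
qed

text \<open>The start is \<open>K 2 = p * (n + 1)\<close>, which is \<open>p / 2\<close> modulo
  \<open>p^2\<close>. In this direction the central binomials appear inverted.\<close>

lemma kummer_sum_even:
  "2 * Suc j < p \<Longrightarrow> K (of_int (2 * int (Suc j))) \<approx> of_nat p * ((-1) ^ j / ((of_nat j + 1) * cbinom (Suc j)))"
proof (induction j)
  case 0
  have "K 2 = of_nat p * (1 / 2) + of_nat p ^ 2 * (1 / 2)"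
    using kummer_sum_2[of n, folded p_eq] by (simp add: p_rat power2_eq_square field_simps)
  also have "\<dots> \<approx> of_nat p * (1 / 2) + 0" by (intro qcong_add qcong_refl p2_mult_cong2 pint_half)
  finally show ?case by simp
next
  case (Suc j)
  let ?a = "2 * int (Suc j)"
  have nd: "\<not> p dvd 2 * j + 2" "\<not> p dvd 2 * j + 3" by (rule not_dvd_less; use Suc.prems in simp)+
  have IH: "K (of_int ?a) \<approx> of_nat p * ((-1) ^ j / ((of_nat j + 1) * cbinom (Suc j)))" using Suc by simp
  have st: "4 * of_int (?a + 1) * K (of_int (?a + 2)) \<approx> - of_int ?a * K (of_int ?a)"
    by (intro kummer_sum_step) (rule not_int_dvd[OF nd(1)], simp, rule not_int_dvd[OF nd(2)], simp)
  have "inverse (of_nat (2 * j + 3)) * (1/2) ^ 2 \<in> pint p"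
    by (intro pint_mult pint_inverse_nat nd pint_power pint_half)
  then have inv: "inverse (4 * of_int (?a + 1)) \<in> pint p"
    by (simp add: power2_eq_square field_simps)
  have nz: "4 * of_int (?a + 1) \<noteq> (0 :: rat)" and nz': "of_nat j + 1 \<noteq> (0 :: rat)" "2 * of_nat j + 3 \<noteq> (0 :: rat)"
    using of_nat_0_le_iff[of j, where ?'a = rat] by (simp_all add: add_nonneg_eq_0_iff)
  note st
  also have "- of_int ?a * K (of_int ?a) \<approx> - of_int ?a * (of_nat p * ((-1) ^ j / ((of_nat j + 1) * cbinom (Suc j))))"
    by (intro qcong_cmult IH pint_uminus pint_of_int)
  also have "- of_int ?a * (of_nat p * ((-1) ^ j / ((of_nat j + 1) * cbinom (Suc j))))
      = 2 * of_nat p * (-1) ^ Suc j / cbinom (Suc j)"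
    using nz' by (simp del: binomial_Suc_Suc add: divide_simps) (simp add: algebra_simps)
  also have "\<dots> = 4 * of_int (?a + 1) * (of_nat p * ((-1) ^ Suc j / (2 * (2 * of_nat (Suc j) + 1) * cbinom (Suc j))))"
    using nz' by (simp del: binomial_Suc_Suc add: divide_simps)
  also have "\<dots> = 4 * of_int (?a + 1) * (of_nat p * ((-1) ^ Suc j / ((of_nat (Suc j) + 1) * cbinom (Suc (Suc j)))))"
    unfolding central_binomial_Suc ..
  finally have "K (of_int (?a + 2)) \<approx> of_nat p * ((-1) ^ Suc j / ((of_nat (Suc j) + 1) * cbinom (Suc (Suc j))))"
    using qcong_cancel[OF _ inv nz] by blast
  moreover have "?a + 2 = 2 * int (Suc (Suc j))" by simp
  ultimately show ?case by (simp only:)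
qed

section \<open>The Legendre values in the two residue classes modulo 4\<close>

text \<open>Here \<open>n = 2 * m\<close>, so \<open>n + 1\<close> and \<open>- n\<close> lead to
  units, while \<open>K n\<close> is a multiple of \<open>p\<close> and \<open>K (- n - 1)\<close>
  vanishes. Hence \<open>leg_aux\<close> is \<open>p\<close> times a unit, and its product with
  \<open>leg_val\<close> needs \<open>leg_val\<close> only modulo \<open>p\<close>.\<close>

lemma leg_1_mod_4:
  assumes p: "p = 4 * m + 1"
  shows "leg_val \<approx> (-1) ^ m * cbinom m * (1 + 1 / 2 ^ (p - 1)) / 2"
    and "leg_val \<sim> (-1) ^ m * cbinom m"
    and "leg_val * leg_aux \<approx> of_nat p"
    and "leg_aux ^ 2 \<approx> 0"
proof -
  have n: "n = 2 * m" using p p_eq by simp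
  have m: "m > 0" using p p_ge_3 by simp
  obtain j where j: "m = Suc j" using m by (cases m) auto
  \<comment> \<open>Through this power the Fermat quotient of \<open>2\<close> enters.\<close>
  have "(16 :: rat) ^ m = 2 ^ (4 * m)" by (simp add: power_mult)
  then have two: "(16 :: rat) ^ m = 2 ^ (p - 1)" using p by simp
  have lt: "2 * m + 1 < p" "2 * m < p" using m p by simp_all
  have e1: "int n + 1 = 2 * int m + 1" and e2: "- int n = - (2 * int m)"
    and e3: "- int n - 1 = - (2 * int m + 1)" and e4: "int n = 2 * int m"
    and e5: "of_nat m = (of_nat j + 1 :: rat)" by (simp_all add: n j)
  have k1: "K (of_int (int n + 1)) \<approx> (-1) ^ m * cbinom m / 16 ^ m"
    using kummer_sum_odd[of m] lt e1 by (simp only:)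
  have k2: "K (of_int (- int n)) \<approx> (-1) ^ m * cbinom m"
    using kummer_sum_neg_even[of m] lt e2 by (simp only:)
  have k3: "K (of_int (- int n - 1)) \<approx> 0"
    using kummer_sum_neg_odd[of m] lt e3 by (simp only:)
  have k4: "K (of_int (int n)) \<approx> of_nat p * ((-1) ^ j / (of_nat m * cbinom m))"
    using kummer_sum_even[of j, folded j] lt e4 e5 by (simp only:)
  have "1/2 * (K (of_int (int n + 1)) + K (of_int (- int n))) \<approx> 1/2 * ((-1) ^ m * cbinom m / 16 ^ m + (-1) ^ m * cbinom m)"
    by (intro qcong_cmult qcong_add k1 k2 pint_half)
  then have "K (1/2) \<approx> 1/2 * ((-1) ^ m * cbinom m / 16 ^ m + (-1) ^ m * cbinom m)"
    by (intro qcong_trans[OF kummer_sum_halves(1)]) simp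
  also have "1/2 * ((-1) ^ m * cbinom m / 16 ^ m + (-1) ^ m * cbinom m) = (-1) ^ m * cbinom m * (1 + 1 / 2 ^ (p - 1)) / 2"
    by (simp add: algebra_simps two)
  finally show "leg_val \<approx> (-1) ^ m * cbinom m * (1 + 1 / 2 ^ (p - 1)) / 2"
    by (rule qcong_trans[OF qcong_sym[OF kummer_sum_leg(1)]])
  have "leg_val \<sim> K (1/2)" by (rule cong2_imp_cong1[OF qcong_sym[OF kummer_sum_leg(1)]])
  also have "K (1/2) \<sim> K (of_int (- int n))" by (rule qcong_sym[OF kummer_sum_halves(3)])
  also have "K (of_int (- int n)) \<sim> (-1) ^ m * cbinom m" by (rule cong2_imp_cong1[OF k2])
  finally show u: "leg_val \<sim> (-1) ^ m * cbinom m" .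
  \<comment> \<open>One factor \<open>2\<close> comes from the mean of two values, the other from
    \<open>K (-1/2)\<close> being \<open>2 * leg_aux\<close>.\<close>
  define v where "v = (-1) ^ j / (4 * (of_nat m * cbinom m)) "
  have nd: "\<not> p dvd m" by (rule not_dvd_less) (use m p in auto)
  have "inverse 4 = ((1/2) ^ 2 :: rat)" by (simp add: power2_eq_square)
  then have i4: "inverse 4 \<in> pint p" using pint_power[OF pint_half, of 2] by (simp only:)
  have im: "inverse (4 * (of_nat m * cbinom m)) \<in> pint p"
    by (intro pint_inverse_mult i4 pint_inverse_nat nd pint_inverse_cbinom) (use p m in simp)
  have v: "v \<in> pint p" unfolding v_def by (intro pint_divide im pint_m1)
  have "1/2 * ((1/2) * (K (of_int (int n)) + K (of_int (- int n - 1)))) \<approx> 1/2 * (1/2 * (of_nat p * ((-1) ^ j / (of_nat m * cbinom m)) + 0))"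
    by (intro qcong_cmult qcong_add k3 k4 pint_half)
  moreover have "1/2 * (1/2 * (of_nat p * ((-1) ^ j / (of_nat m * cbinom m)) + 0)) = of_nat p * v"
    by (simp add: v_def)
  moreover have "1/2 * (2 * leg_aux) \<approx> 1/2 * ((1/2) * (K (of_int (int n)) + K (of_int (- int n - 1))))"
    using qcong_cmult[OF qcong_trans[OF qcong_sym[OF kummer_sum_leg(2)] kummer_sum_halves(2)] pint_half] by simp
  ultimately have w: "leg_aux \<approx> of_nat p * v" using qcong_trans[of "1/2 * (2 * leg_aux)"] by simp
  have "leg_val * leg_aux \<approx> leg_val * (of_nat p * v)" by (intro qcong_cmult w) auto
  also have "leg_val * (of_nat p * v) = of_nat p * (v * leg_val)" by simp
  also have "of_nat p * (v * leg_val) \<approx> of_nat p * (v * ((-1) ^ m * cbinom m))"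
    by (intro cong1_mult_p qcong_cmult u v)
  also have "v * ((-1) ^ m * cbinom m) = - 1 / (4 * of_nat m)"
  proof -
    have "(-1) ^ j * (-1) ^ m = (-1 :: rat)" using j by (simp flip: power_add)
    then show ?thesis unfolding v_def using m by (simp add: field_simps del: binomial_Suc_Suc)
  qed
  also have "of_nat p * (- 1 / (4 * of_nat m)) \<approx> of_nat p * 1"
  proof (rule cong1_mult_p)
    \<comment> \<open>As \<open>4 * m = p - 1\<close>, the left side is
      \<open>1 / (1 - p)\<close>.\<close>
    have "- 1 / (4 * of_nat m) = of_nat p * (- inverse (4 * of_nat m)) + (1 :: rat)"
      using m by (simp add: p field_simps)
    also have "of_nat p * (- inverse (4 * of_nat m)) + (1 :: rat) \<sim> 0 + 1"
      by (intro qcong_add p_mult_cong1 qcong_refl pint_uminus pint_inverse_mult i4 pint_inverse_nat nd)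
    finally show "- 1 / (4 * of_nat m) \<sim> (1 :: rat)" by simp
  qed
  finally show "leg_val * leg_aux \<approx> of_nat p" by simp
  have "leg_aux \<sim> of_nat p * v" by (rule cong2_imp_cong1[OF w])
  also have "of_nat p * v \<sim> 0" by (rule p_mult_cong1[OF v])
  finally show "leg_aux ^ 2 \<approx> 0" using cong1_zero_mult by (simp add: power2_eq_square)
qed

text \<open>For odd \<open>n\<close> the roles are exchanged: \<open>leg_val\<close> is
  \<open>p\<close> times a unit, and \<open>leg_aux\<close> comes from the two arguments
  \<open>n\<close> and \<open>- n - 1\<close> with unit values.\<close>

lemma leg_3_mod_4:
  assumes p: "p = 4 * j + 3"
  shows "leg_val ^ 2 \<approx> 0"
    and "leg_val * leg_aux \<approx> - of_nat p"
    and "leg_aux ^ 2 \<approx> of_int (R1 p)"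
proof -
  define m where "m = Suc j"
  have n: "n = 2 * j + 1" using p p_eq by simp
  define B where "B = cbinom m"
  define C where "C = cbinom j"
  have lt: "2 * j + 1 < p" "2 * m < p" using p by (simp_all add: m_def)
  have e1: "int n + 1 = 2 * int m" and e2: "- int n = - (2 * int j + 1)"
    and e3: "- int n - 1 = - (2 * int m)" and e4: "int n = 2 * int j + 1"
    and e5: "of_nat m = (of_nat j + 1 :: rat)" by (simp_all add: n m_def)
  have k1: "K (of_int (int n + 1)) \<approx> of_nat p * ((-1) ^ j / (of_nat m * B))"
    using kummer_sum_even[of j, folded m_def] lt e1 e5 by (simp only: B_def)
  have k2: "K (of_int (- int n)) \<approx> 0"
    using kummer_sum_neg_odd[of j] lt e2 by (simp only:)
  have k3: "K (of_int (- int n - 1)) \<approx> (-1) ^ m * B"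
    using kummer_sum_neg_even[of m] lt e3 by (simp only: B_def)
  have k4: "K (of_int (int n)) \<approx> (-1) ^ j * C / 16 ^ j"
    using kummer_sum_odd[of j] lt e4 by (simp only: C_def)
  have "inverse 4 = ((1/2) ^ 2 :: rat)" by (simp add: power2_eq_square)
  then have i4: "inverse 4 \<in> pint p" using pint_power[OF pint_half, of 2] by (simp only:)
  have nd: "\<not> p dvd m" by (rule not_dvd_less) (auto simp: m_def p)
  have B: "B \<noteq> 0" "inverse B \<in> pint p" unfolding B_def by (simp, intro pint_inverse_cbinom, simp add: m_def p)
  have BC: "of_nat m * B = 2 * (2 * of_nat j + 1) * C"
    using central_binomial_Suc[of j] by (simp only: m_def B_def C_def of_nat_Suc add.commute)
  have nz: "of_nat m \<noteq> (0 :: rat)" by (simp add: m_def)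
  define v where "v = (-1) ^ j / (2 * (of_nat m * B))"
  have v: "v \<in> pint p" unfolding v_def
    by (intro pint_divide pint_m1 pint_inverse_mult pint_inverse_2 pint_inverse_nat nd B)
  have "1/2 * (K (of_int (int n + 1)) + K (of_int (- int n))) \<approx> 1/2 * (of_nat p * ((-1) ^ j / (of_nat m * B)) + 0)"
    by (intro qcong_cmult qcong_add k1 k2 pint_half)
  moreover have "1/2 * (of_nat p * ((-1) ^ j / (of_nat m * B)) + 0) = of_nat p * v" by (simp add: v_def)
  ultimately have "K (1/2) \<approx> of_nat p * v"
    by (intro qcong_trans[OF kummer_sum_halves(1)]) simp
  then have u: "leg_val \<approx> of_nat p * v" by (rule qcong_trans[OF qcong_sym[OF kummer_sum_leg(1)]])
  have "leg_val \<sim> of_nat p * v" by (rule cong2_imp_cong1[OF u])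
  also have "of_nat p * v \<sim> 0" by (rule p_mult_cong1[OF v])
  finally show "leg_val ^ 2 \<approx> 0" using cong1_zero_mult by (simp add: power2_eq_square)
  have "1/2 * (2 * leg_aux) \<sim> 1/2 * ((-1) ^ m * B)"
  proof (intro qcong_cmult pint_half)
    have "2 * leg_aux \<sim> K (-1/2)" by (rule cong2_imp_cong1[OF qcong_sym[OF kummer_sum_leg(2)]])
    also have "K (-1/2) \<sim> K (of_int (- int n - 1))" by (rule qcong_sym[OF kummer_sum_halves(4)])
    also have "K (of_int (- int n - 1)) \<sim> (-1) ^ m * B" by (rule cong2_imp_cong1[OF k3])
    finally show "2 * leg_aux \<sim> (-1) ^ m * B" .
  qed
  then have w1: "leg_aux \<sim> (-1) ^ m * B / 2" by simp
  have "leg_aux * leg_val \<approx> leg_aux * (of_nat p * v)" by (intro qcong_cmult u) auto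
  also have "leg_aux * (of_nat p * v) = of_nat p * (v * leg_aux)" by simp
  also have "of_nat p * (v * leg_aux) \<approx> of_nat p * (v * ((-1) ^ m * B / 2))"
    by (intro cong1_mult_p qcong_cmult w1 v)
  also have "v * ((-1) ^ m * B / 2) = - 1 / (4 * of_nat m)"
  proof -
    have "(-1) ^ j * (-1) ^ m = (-1 :: rat)" by (simp add: m_def flip: power_add)
    then show ?thesis unfolding v_def using B nz by (simp add: field_simps)
  qed
  also have "of_nat p * (- 1 / (4 * of_nat m)) \<approx> of_nat p * (- 1)"
  proof (rule cong1_mult_p)
    \<comment> \<open>Now \<open>4 * m\<close> is \<open>p + 1\<close> instead of
      \<open>p - 1\<close>, whence the opposite sign.\<close>
    have "4 * of_nat m = (of_nat p + 1 :: rat)" by (simp add: p m_def)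
    then have "- 1 / (4 * of_nat m) = of_nat p * inverse (4 * of_nat m) + (- 1 :: rat)"
      by (simp add: field_simps)
    also have "of_nat p * inverse (4 * of_nat m) + (- 1 :: rat) \<sim> 0 + (- 1)"
      by (intro qcong_add p_mult_cong1 qcong_refl pint_inverse_mult i4 pint_inverse_nat nd)
    finally show "- 1 / (4 * of_nat m) \<sim> (- 1 :: rat)" by simp
  qed
  finally show "leg_val * leg_aux \<approx> - of_nat p" by (simp add: mult.commute)

  \<comment> \<open>So far \<open>leg_aux\<close> is known modulo \<open>p\<close>; its square
    requires the value modulo \<open>p^2\<close>, where the Fermat quotient \<open>q\<close> of
    \<open>2\<close> appears.\<close>
  define P where "P = (of_nat p :: rat)"
  have "\<not> p dvd 2" using p_ge_3 by (auto dest: dvd_imp_le)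
  then have "[2 ^ (p - 1) = 1] (mod p)" using fermat_theorem[OF prime] by blast
  then have "[2 ^ (p - 1) = 1] (mod int p)" by (metis cong_int_iff of_nat_1 of_nat_numeral of_nat_power)
  then obtain q' :: int where q': "2 ^ (p - 1) - 1 = int p * q'" by (auto simp: cong_iff_dvd_diff)
  define q where "q = (of_int q' :: rat)"
  define Q where "Q = (2 :: rat) ^ (p - 1)"
  have "(of_int (2 ^ (p - 1) - 1) :: rat) = of_int (int p * q')" using q' by simp
  then have Q: "Q = 1 + P * q" by (simp add: Q_def P_def q_def)
  have Q16: "16 ^ j = Q / 4"
  proof -
    have "Q = 2 ^ (4 * j + 2)" by (simp add: Q_def p)
    also have "\<dots> = 4 * 16 ^ j" by (simp add: power_add power_mult)
    finally show ?thesis by simp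
  qed
  have pi: "P \<in> pint p" "q \<in> pint p" "B \<in> pint p" by (simp_all add: P_def q_def B_def)
  \<comment> \<open>With \<open>C\<close> expressed by \<open>B\<close>, the mean of the two values
    of \<open>K\<close> is \<open>(-1)^m * B * E / 2\<close>; the minus sign stems from
    \<open>m = j + 1\<close>.\<close>
  define E where "E = 1 - (P + 1) / ((P - 1) * Q)"
  have P1: "P - 1 \<noteq> 0" using p_ge_3 by (simp add: P_def)
  have Q0: "Q \<noteq> 0" by (simp add: Q_def)
  have C: "C = (P + 1) / (4 * (P - 1)) * B"
  proof -
    have h: "2 * (2 * of_nat j + 1) = P - 1" "of_nat m = (P + 1) / 4" by (simp_all add: P_def p m_def)
    have "(P + 1) / 4 * B = (P - 1) * C" using BC unfolding h .
    then show ?thesis using P1 by (simp add: field_simps)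
  qed
  have "K (-1/2) \<approx> 1/2 * ((-1) ^ j * C / 16 ^ j + (-1) ^ m * B)"
  proof -
    have "1/2 * (K (of_int (int n)) + K (of_int (- int n - 1))) \<approx> 1/2 * ((-1) ^ j * C / 16 ^ j + (-1) ^ m * B)"
      by (intro qcong_cmult qcong_add k3 k4 pint_half)
    then show ?thesis by (intro qcong_trans[OF kummer_sum_halves(2)]) simp
  qed
  moreover have "1/2 * ((-1) ^ j * C / 16 ^ j + (-1) ^ m * B) = (-1) ^ m * B * (1/2) * E"
    unfolding E_def Q16 C m_def using P1 Q0 by (simp add: field_simps)
  ultimately have "K (-1/2) \<approx> (-1) ^ m * B * (1/2) * E" by (simp only:)
  then have "2 * leg_aux \<approx> (-1) ^ m * B * (1/2) * E" by (rule qcong_trans[OF qcong_sym[OF kummer_sum_leg(2)]])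
  also have "(-1) ^ m * B * (1/2) * E \<approx> (-1) ^ m * B * (1/2) * (2 + 2 * P - P * q)"
  proof (intro qcong_cmult pint_mult pint_m1 pint_half pi)
    \<comment> \<open>Clearing this unit denominator turns the first-order expansion of
      \<open>E\<close> into an identity with an explicit \<open>P^2\<close> error.\<close>
    define D where "D = (P - 1) * Q"
    have "D * E = D * (2 + 2 * P - P * q) - P ^ 2 * (2 + 2 * P * q - P * q ^ 2 - 2 * q + q ^ 2)"
    proof -
      have "D * E = (P - 1) * Q - (P + 1)" using P1 Q0 by (simp add: D_def E_def field_simps)
      then show ?thesis by (simp add: D_def Q power2_eq_square algebra_simps)
    qed
    also have "\<dots> \<approx> D * (2 + 2 * P - P * q) - 0"
      unfolding P_def using pi
      by (intro qcong_diff qcong_refl p2_mult_cong2 pint_diff pint_add pint_mult pint_power pint_numeral pint_of_nat)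
    finally have "D * E \<approx> D * (2 + 2 * P - P * q)" by simp
    moreover have "inverse D \<in> pint p"
    proof -
      have "\<not> p dvd p - 1" by (rule not_dvd_less) (use p_ge_3 in auto)
      then have "inverse (P - 1) \<in> pint p" using pint_inverse_nat[of "p - 1"] p_ge_3 by (simp add: P_def of_nat_diff)
      then show ?thesis unfolding D_def Q_def by (intro pint_inverse_mult pint_inverse_neg_power)
    qed
    moreover have "D \<noteq> 0" using P1 Q0 by (simp add: D_def)
    ultimately show "E \<approx> 2 + 2 * P - P * q" using qcong_cancel by blast
  qed
  finally have "1/2 * (2 * leg_aux) \<approx> 1/2 * ((-1) ^ m * B * (1/2) * (2 + 2 * P - P * q))"
    by (intro qcong_cmult pint_half)
  then have w: "leg_aux \<approx> (-1) ^ m * (B / 4) * (2 + 2 * P - P * q)" by simp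
  have B4: "B / 4 \<in> pint p" using pi i4 by (intro pint_divide)
  have "leg_aux ^ 2 \<approx> ((-1) ^ m * (B / 4) * (2 + 2 * P - P * q)) ^ 2"
    by (intro qcong_power w pint_mult pint_m1 B4 pint_diff pint_add pi pint_numeral)
  \<comment> \<open>The square of \<open>1 + P - P * q / 2\<close> is
    \<open>1 + 2 * P - P * q\<close> up to \<open>P^2\<close>, and this equals
    \<open>2 * P + 2 - Q\<close>, the first factor of \<open>R1\<close>.\<close>
  also have "((-1) ^ m * (B / 4) * (2 + 2 * P - P * q)) ^ 2
      = (2 * P + 2 - Q) * (B / 2) ^ 2 + P ^ 2 * ((B / 4) ^ 2 * (2 - q) ^ 2)"
  proof -
    have "((-1) ^ m) ^ 2 = (1 :: rat)" by (simp flip: power_mult)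
    then have "((-1) ^ m * (B / 4) * (2 + 2 * P - P * q)) ^ 2 = (B / 4) ^ 2 * (2 + 2 * P - P * q) ^ 2"
      by (simp only: power_mult_distrib mult_1_left)
    then show ?thesis by (simp add: Q power2_eq_square field_simps)
  qed
  also have "\<dots> \<approx> (2 * P + 2 - Q) * (B / 2) ^ 2 + 0"
    unfolding P_def by (intro qcong_add qcong_refl p2_mult_cong2 pint_mult pint_power B4 pint_diff pi pint_numeral)
  also have "(2 * P + 2 - Q) * (B / 2) ^ 2 + 0 = of_int (R1 p)"
  proof -
    \<comment> \<open>Thus \<open>B / 2\<close> is the binomial coefficient in
      \<open>R1\<close>.\<close>
    have "B = 2 * of_nat ((2 * j + 1) choose j)"
    proof -
      have "(2 * m) choose m = ((2 * j + 1) choose j) + ((2 * j + 1) choose Suc j)"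
        by (simp add: m_def)
      also have "(2 * j + 1) choose Suc j = (2 * j + 1) choose j"
        using binomial_symmetric[of j "2 * j + 1"] by simp
      finally show ?thesis by (simp add: B_def)
    qed
    moreover have "(p - 1) div 2 = 2 * j + 1" "p div 4 = j" by (simp_all add: p)
    ultimately show ?thesis by (simp add: R1_def P_def Q_def)
  qed
  finally show "leg_aux ^ 2 \<approx> of_int (R1 p)" .
qed

end

section \<open>Jacobsthal sums\<close>

context odd_prime
begin

section \<open>The quadratic character and its correlation sums\<close>

definition chi :: "int \<Rightarrow> int" where "chi a = Legendre a (int p)"

abbreviation residues_p :: "int set" where "residues_p \<equiv> {0..<int p}"

lemma chi_values: "chi a \<in> {-1, 0, 1}"
  by (simp add: chi_def Legendre_def)

lemma chi_eq_0_iff: "chi a = 0 \<longleftrightarrow> int p dvd a"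
  by (simp add: chi_def Legendre_def cong_0_iff)

lemma chi_cong: "[a = b] (mod int p) \<Longrightarrow> chi a = chi b"
proof -
  assume ab: "[a = b] (mod int p)"
  then have "[a = 0] (mod int p) \<longleftrightarrow> [b = 0] (mod int p)" "QuadRes p a \<longleftrightarrow> QuadRes p b"
    unfolding QuadRes_def by (meson cong_sym cong_trans)+
  then show ?thesis by (simp add: chi_def Legendre_def)
qed

lemma euler: "[chi a = a ^ n] (mod int p)"
  using euler_criterion[OF prime, of a] p_ge_3 by (simp add: chi_def n_def)

text \<open>Two such values differ by at most \<open>2 < p\<close>. This upgrades congruences from
  Euler's criterion to equalities.\<close>

lemma small_cong_eq: "x \<in> {-1, 0, 1} \<Longrightarrow> y \<in> {-1, 0, 1} \<Longrightarrow> [x = y] (mod int p) \<Longrightarrow> x = y"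
proof -
  assume "x \<in> {-1, 0, 1}" "y \<in> {-1, 0, 1}" "[x = y] (mod int p)"
  then have "int p dvd x - y" "\<bar>x - y\<bar> \<le> 2" by (auto simp: cong_iff_dvd_diff)
  then show "x = y" using zdvd_imp_le[of "int p" "\<bar>x - y\<bar>"] p_ge_3 by (cases "x = y") auto
qed

lemma chi_mult: "chi (a * b) = chi a * chi b"
proof (rule small_cong_eq)
  show "chi (a * b) \<in> {-1, 0, 1}" by (rule chi_values)
  show "chi a * chi b \<in> {-1, 0, 1}" using chi_values[of a] chi_values[of b] by auto
  have "[chi (a * b) = a ^ n * b ^ n] (mod int p)" using euler[of "a * b"] by (simp add: power_mult_distrib)
  also have "[a ^ n * b ^ n = chi a * chi b] (mod int p)" by (intro cong_mult cong_sym[OF euler])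
  finally show "[chi (a * b) = chi a * chi b] (mod int p)" .
qed

lemma chi_square: "\<not> int p dvd a \<Longrightarrow> chi a * chi a = 1"
  using chi_values[of a] chi_eq_0_iff[of a] by auto

text \<open>An affine map with invertible slope permutes the residues.\<close>

lemma sum_periodic:
  assumes per: "\<And>a b. [a = b] (mod int p) \<Longrightarrow> f a = (f b :: int)" and r: "\<not> int p dvd r"
  shows "(\<Sum>a\<in>residues_p. f (r * a + s)) = (\<Sum>a\<in>residues_p. f a)"
proof -
  let ?h = "\<lambda>a. (r * a + s) mod int p"
  have p0: "int p > 0" using p_ge_3 by simp
  have inj: "inj_on ?h residues_p"
  proof (rule inj_onI)
    fix a b assume ab: "a \<in> residues_p" "b \<in> residues_p" "?h a = ?h b"
    then have "int p dvd r * (a - b)" by (simp add: mod_eq_dvd_iff algebra_simps)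
    then have "int p dvd a - b" using r prime by (simp add: prime_dvd_mult_iff)
    then show "a = b" using ab by (metis atLeastLessThan_iff mod_eq_dvd_iff mod_pos_pos_trivial)
  qed
  have "?h ` residues_p \<subseteq> residues_p" using p0 by auto
  then have "?h ` residues_p = residues_p" using inj by (intro endo_inj_surj) auto
  then have "bij_betw ?h residues_p residues_p" using inj by (simp add: bij_betw_def)
  then have "(\<Sum>a\<in>residues_p. f (?h a)) = (\<Sum>a\<in>residues_p. f a)" by (rule sum.reindex_bij_betw)
  moreover have "f (?h a) = f (r * a + s)" for a by (rule per) (simp add: cong_def)
  ultimately show ?thesis by simp
qed

lemma primitive_root_exists: "\<exists>g :: int. \<forall>k. [g ^ k = 1] (mod int p) \<longleftrightarrow> p - 1 dvd k"
proof -
  obtain g where g: "\<And>k. k > 0 \<Longrightarrow> residue_primroot (p ^ k) g"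
    using residue_primroot_odd_prime_power_exists[OF prime odd] by blast
  have "residue_primroot p g" using g[of 1] by simp
  then have "ord p g = p - 1" using prime by (simp add: residue_primroot_def totient_prime)
  then have "[g ^ k = 1] (mod p) \<longleftrightarrow> p - 1 dvd k" for k using ord_divides[of g k p] by simp
  then have "[int g ^ k = 1] (mod int p) \<longleftrightarrow> p - 1 dvd k" for k
    by (metis cong_int_iff of_nat_1 of_nat_power)
  then show ?thesis by blast
qed

text \<open>A primitive root serves: its \<open>n\<close>-th power is not \<open>1\<close>, since
  \<open>n < p - 1\<close>.\<close>

lemma nonresidue_exists: "\<exists>g. chi g = -1"
proof -
  obtain g :: int where g: "\<And>k. [g ^ k = 1] (mod int p) \<longleftrightarrow> p - 1 dvd k" using primitive_root_exists by blast
  have "\<not> p - 1 dvd n" using p_eq n_pos by (auto dest: dvd_imp_le)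
  then have 1: "chi g \<noteq> 1" using g[of n] euler[of g] cong_sym by metis
  have "chi g \<noteq> 0"
  proof
    assume "chi g = 0"
    then have "int p dvd g" by (simp add: chi_eq_0_iff)
    moreover have "g dvd g ^ (p - 1)" using p_ge_3 by (intro dvd_power) simp
    ultimately have "int p dvd g ^ (p - 1)" by (rule dvd_trans)
    moreover have "[g ^ (p - 1) = 1] (mod int p)" using g[of "p - 1"] by (simp only: dvd_refl)
    ultimately have "int p dvd 1" using cong_dvd_iff[of "g ^ (p - 1)" 1 "int p"] by blast
    then show False using p_ge_3 by simp
  qed
  with 1 show ?thesis using chi_values[of g] by blast
qed

lemma sum_chi: "(\<Sum>a\<in>residues_p. chi a) = 0"
proof -
  obtain g where g: "chi g = -1" using nonresidue_exists by blast
  then have "\<not> int p dvd g" using chi_eq_0_iff[of g] by simp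
  then have "(\<Sum>a\<in>residues_p. chi (g * a + 0)) = (\<Sum>a\<in>residues_p. chi a)" using chi_cong by (intro sum_periodic) auto
  then show ?thesis by (simp add: chi_mult g sum_negf)
qed

lemma card_nonzero_residues: "(\<Sum>a\<in>residues_p. if int p dvd a then 0 else 1) = int p - 1"
proof -
  have "residues_p = insert 0 {1..<int p}" using p_ge_3 by auto
  moreover have "(\<Sum>a\<in>{1..<int p}. if int p dvd a then 0 else 1) = (\<Sum>a\<in>{1..<int p}. 1 :: int)"
    by (intro sum.cong) (auto dest: zdvd_imp_le)
  ultimately show ?thesis using p_ge_3 by simp
qed

lemma dvd_residue: "a \<in> residues_p \<Longrightarrow> int p dvd a \<longleftrightarrow> a = 0"
  by (auto dest: zdvd_imp_le)

text \<open>Scaling \<open>c\<close> by \<open>d\<close> shows that all \<open>d\<close> prime to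
  \<open>p\<close> give the same value. It follows from the value \<open>p - 1\<close> at
  \<open>d = 0\<close>, because the total over \<open>d\<close> is zero.\<close>

lemma chi_correlation:
  "(\<Sum>c\<in>residues_p. chi c * chi (c + d)) = (if int p dvd d then int p - 1 else -1)"
proof -
  define f where "f d = (\<Sum>c\<in>residues_p. chi c * chi (c + d))" for d
  have per: "f a = f b" if "[a = b] (mod int p)" for a b
    unfolding f_def by (intro sum.cong refl arg_cong2[where f = "(*)"] chi_cong cong_add cong_refl that)
  have f0: "f 0 = int p - 1"
  proof -
    have "f 0 = (\<Sum>a\<in>residues_p. if int p dvd a then 0 else 1)"
      unfolding f_def by (intro sum.cong) (auto simp: chi_square chi_eq_0_iff)
    then show ?thesis by (simp add: card_nonzero_residues)
  qed
  have f1: "f d = f 1" if "\<not> int p dvd d" for d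
  proof -
    have "f d = (\<Sum>c\<in>residues_p. chi (d * c + 0) * chi (d * c + 0 + d))"
      unfolding f_def using that
      by (intro sum_periodic[where f = "\<lambda>c. chi c * chi (c + d)", symmetric])
        (auto intro!: arg_cong2[where f = "(*)"] chi_cong cong_add)
    also have "\<dots> = (\<Sum>c\<in>residues_p. (chi d * chi d) * (chi c * chi (c + 1)))"
    proof (intro sum.cong refl)
      fix c
      have "d * c + 0 + d = d * (c + 1)" by (simp add: algebra_simps)
      then show "chi (d * c + 0) * chi (d * c + 0 + d) = (chi d * chi d) * (chi c * chi (c + 1))"
        by (simp only: chi_mult add_0_right mult_ac)
    qed
    finally show ?thesis using that by (simp add: chi_square f_def)
  qed
  have "(\<Sum>d\<in>residues_p. f d) = (\<Sum>c\<in>residues_p. chi c * (\<Sum>d\<in>residues_p. chi (1 * d + c)))"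
    unfolding f_def by (subst sum.swap) (simp add: sum_distrib_left add.commute)
  also have "\<dots> = (\<Sum>c\<in>residues_p. chi c * (\<Sum>d\<in>residues_p. chi d))"
    using p_ge_3 chi_cong by (intro sum.cong refl arg_cong2[where f = "(*)"] sum_periodic) auto
  also have "\<dots> = 0" by (simp add: sum_chi)
  finally have "(\<Sum>d\<in>residues_p. f d) = 0" .
  moreover have "residues_p = insert 0 {1..<int p}" using p_ge_3 by auto
  moreover have "(\<Sum>d\<in>{1..<int p}. f d) = (\<Sum>d\<in>{1..<int p}. f 1)"
    by (intro sum.cong refl f1) (auto dest: zdvd_imp_le)
  ultimately have "(int p - 1) + (int p - 1) * f 1 = 0" using p_ge_3 by (simp add: f0)
  then have "(int p - 1) * (1 + f 1) = 0" by (simp add: algebra_simps)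
  then have "f 1 = -1" using p_ge_3 by simp
  then show ?thesis using f1[of d] per[of d 0] f0 by (auto simp: f_def cong_0_iff)
qed

section \<open>Jacobsthal sums and the representation of \<open>p\<close> by two squares\<close>

definition jacobsthal :: "int \<Rightarrow> int" where
  "jacobsthal c = (\<Sum>a\<in>residues_p. chi a * chi (a ^ 2 - c))"

lemma jacobsthal_cong: "[a = b] (mod int p) \<Longrightarrow> jacobsthal a = jacobsthal b"
  unfolding jacobsthal_def
  by (intro sum.cong refl arg_cong2[where f = "(*)"] chi_cong cong_diff) auto

text \<open>Replacing \<open>a\<close> by \<open>r * a\<close> brings out the sign
  \<open>chi r\<close>, which squaring removes. So the square depends only on the class of
  \<open>c\<close> modulo squares.\<close>

lemma jacobsthal_scale:
  assumes "\<not> int p dvd r" shows "jacobsthal (c * r ^ 2) ^ 2 = jacobsthal c ^ 2"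
proof -
  have "jacobsthal (c * r ^ 2) = (\<Sum>a\<in>residues_p. chi (r * a + 0) * chi ((r * a + 0) ^ 2 - c * r ^ 2))"
    unfolding jacobsthal_def using assms
    by (intro sum_periodic[where f = "\<lambda>a. chi a * chi (a ^ 2 - c * r ^ 2)", symmetric])
      (auto intro!: arg_cong2[where f = "(*)"] chi_cong cong_diff cong_pow)
  also have "\<dots> = (\<Sum>a\<in>residues_p. chi r * (chi a * chi (a ^ 2 - c)))"
  proof (intro sum.cong refl)
    fix a
    have "(r * a + 0) ^ 2 - c * r ^ 2 = r * r * (a ^ 2 - c)" by (simp add: power2_eq_square algebra_simps)
    then show "chi (r * a + 0) * chi ((r * a + 0) ^ 2 - c * r ^ 2) = chi r * (chi a * chi (a ^ 2 - c))"
      using chi_square[OF assms] by (simp add: chi_mult)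
  qed
  also have "\<dots> = chi r * jacobsthal c" by (simp add: jacobsthal_def sum_distrib_left)
  finally show ?thesis using chi_square[OF assms] by (simp add: power_mult_distrib power2_eq_square)
qed

lemma residue_square_root: "chi c = 1 \<Longrightarrow> \<exists>r. [c = r ^ 2] (mod int p) \<and> \<not> int p dvd r"
proof -
  assume c: "chi c = 1"
  then have "QuadRes p c" by (auto simp: chi_def Legendre_def split: if_splits)
  then obtain r where r: "[c = r ^ 2] (mod int p)" unfolding QuadRes_def using cong_sym by blast
  moreover have "\<not> int p dvd r"
  proof
    assume "int p dvd r"
    then have "int p dvd c" using r by (simp add: cong_dvd_iff power2_eq_square)
    then show False using c chi_eq_0_iff[of c] by simp
  qed
  ultimately show ?thesis by blast
qed

text \<open>The second moment over all \<open>c\<close> is computed twice: by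
  \<open>chi_correlation\<close> it is \<open>2 * p * (p - 1)\<close>, and by scaling half of the
  nonzero \<open>c\<close> contribute \<open>jacobsthal 1 ^ 2\<close>, the other half
  \<open>jacobsthal g ^ 2\<close>.\<close>

lemma jacobsthal_sum_squares:
  assumes even: "even n" and g: "chi g = -1"
  shows "jacobsthal 1 ^ 2 + jacobsthal g ^ 2 = 4 * int p"
proof -
  have chi_m1: "chi (-1) = 1"
    using euler[of "-1"] even chi_values[of "-1"] by (intro small_cong_eq) (auto simp: even_power)
  have chi_minus: "chi (- a) = chi a" for a using chi_mult[of "-1" a] chi_m1 by simp
  have sum1: "(\<Sum>c\<in>residues_p. jacobsthal c ^ 2) = 2 * int p * (int p - 1)"
  proof -
    have "(\<Sum>c\<in>residues_p. jacobsthal c ^ 2)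
        = (\<Sum>c\<in>residues_p. \<Sum>a\<in>residues_p. \<Sum>b\<in>residues_p. chi a * chi b * (chi (a ^ 2 - c) * chi (b ^ 2 - c)))"
      by (simp add: jacobsthal_def power2_eq_square sum_product mult_ac)
    also have "\<dots> = (\<Sum>a\<in>residues_p. \<Sum>b\<in>residues_p. \<Sum>c\<in>residues_p. chi a * chi b * (chi (a ^ 2 - c) * chi (b ^ 2 - c)))"
      by (subst sum.swap) (intro sum.cong refl sum.swap)
    also have "\<dots> = (\<Sum>a\<in>residues_p. \<Sum>b\<in>residues_p. chi a * chi b * (if int p dvd b ^ 2 - a ^ 2 then int p - 1 else -1))"
    proof (intro sum.cong refl)
      fix a b
      have "(\<Sum>c\<in>residues_p. chi (a ^ 2 - c) * chi (b ^ 2 - c))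
          = (\<Sum>c\<in>residues_p. chi (-1 * c + a ^ 2) * chi ((-1 * c + a ^ 2) + (b ^ 2 - a ^ 2)))"
        by (simp add: algebra_simps)
      also have "\<dots> = (\<Sum>c\<in>residues_p. chi c * chi (c + (b ^ 2 - a ^ 2)))"
        using p_ge_3 by (intro sum_periodic[where f = "\<lambda>c. chi c * chi (c + (b ^ 2 - a ^ 2))"])
          (auto intro!: arg_cong2[where f = "(*)"] chi_cong cong_add)
      finally show "(\<Sum>c\<in>residues_p. chi a * chi b * (chi (a ^ 2 - c) * chi (b ^ 2 - c)))
          = chi a * chi b * (if int p dvd b ^ 2 - a ^ 2 then int p - 1 else -1)"
        by (simp only: chi_correlation flip: sum_distrib_left)
    qed
    \<comment> \<open>The constant part \<open>-1\<close> of the correlation is split off; it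
      vanishes since \<open>chi\<close> sums to zero, and only pairs with equal squares
      remain.\<close>
    also have "\<dots> = (\<Sum>a\<in>residues_p. int p * (\<Sum>b\<in>residues_p. if int p dvd b ^ 2 - a ^ 2 then chi a * chi b else 0)
        - chi a * (\<Sum>b\<in>residues_p. chi b))"
      unfolding sum_distrib_left sum_subtractf[symmetric]
      by (intro sum.cong refl) (simp add: algebra_simps)
    also have "\<dots> = int p * (\<Sum>a\<in>residues_p. \<Sum>b\<in>residues_p. if int p dvd b ^ 2 - a ^ 2 then chi a * chi b else 0)"
      by (simp add: sum_chi sum_distrib_left)
    also have "(\<Sum>a\<in>residues_p. \<Sum>b\<in>residues_p. if int p dvd b ^ 2 - a ^ 2 then chi a * chi b else 0)
        = (\<Sum>a\<in>residues_p. 2 * (if int p dvd a then 0 else 1))"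
    proof (intro sum.cong refl)
      fix a assume a: "a \<in> residues_p"
      show "(\<Sum>b\<in>residues_p. if int p dvd b ^ 2 - a ^ 2 then chi a * chi b else 0) = 2 * (if int p dvd a then 0 else 1)"
      proof (cases "int p dvd a")
        case True
        then show ?thesis using chi_eq_0_iff[of a] by (simp add: sum.neutral)
      next
        case False
        have a0: "a > 0" "a < int p" using a False by (auto simp: order_le_less)
        have set: "{b \<in> residues_p. int p dvd b ^ 2 - a ^ 2} = {a, int p - a}"
        proof (intro equalityI subsetI)
          fix b assume "b \<in> {b \<in> residues_p. int p dvd b ^ 2 - a ^ 2}"
          then have b: "0 \<le> b" "b < int p" "int p dvd (b - a) * (b + a)" by (auto simp: power2_eq_square algebra_simps)
          then have "int p dvd b - a \<or> int p dvd b + a" using prime by (simp add: prime_dvd_mult_iff)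
          then show "b \<in> {a, int p - a}"
          proof
            assume "int p dvd b - a"
            then have "b = a" using b a0 by (metis less_eq_int_code(1) mod_eq_dvd_iff mod_pos_pos_trivial order_less_imp_le)
            then show ?thesis by simp
          next
            assume "int p dvd b + a"
            then obtain k where k: "b + a = int p * k" by blast
            have "0 < int p * k" "int p * k < int p * 2" using b a0 k by linarith+
            then have "0 < k" "k < 2" using p_ge_3 by (auto simp: zero_less_mult_iff)
            then have "k = 1" by simp
            then show ?thesis using k by simp
          qed
        next
          fix b assume "b \<in> {a, int p - a}"
          then have "b = a \<or> b \<in> {int p - a}" by blast
          then show "b \<in> {b \<in> residues_p. int p dvd b ^ 2 - a ^ 2}"
          proof
            assume "b = a"
            then show ?thesis using a0 by simp
          next
            assume "b \<in> {int p - a}"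
            then have b: "b = int p - a" by simp
            have "b ^ 2 - a ^ 2 = int p * (int p - 2 * a)" unfolding b by (simp add: power2_eq_square algebra_simps)
            then have "int p dvd b ^ 2 - a ^ 2" by (metis dvd_triv_left)
            then show ?thesis using a0 b by simp
          qed
        qed
        have ne: "a \<noteq> int p - a"
        proof
          assume "a = int p - a"
          then have "int p = 2 * a" by simp
          then have "even (int p)" by simp
          then show False using odd by simp
        qed
        have "chi (int p - a) = chi a" using chi_cong[of "int p - a" "- a"] chi_minus[of a] by (simp add: cong_iff_dvd_diff)
        moreover have "(\<Sum>b\<in>residues_p. if int p dvd b ^ 2 - a ^ 2 then chi a * chi b else 0)
            = (\<Sum>b\<in>{a, int p - a}. chi a * chi b)"
          unfolding set[symmetric] by (rule sum.inter_filter[symmetric]) simp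
        ultimately show ?thesis using ne False chi_square[OF False] by simp
      qed
    qed
    also have "\<dots> = 2 * (int p - 1)" by (simp add: card_nonzero_residues flip: sum_distrib_left)
    finally show ?thesis by simp
  qed
  have g0: "\<not> int p dvd g" using g chi_eq_0_iff[of g] by simp
  \<comment> \<open>The weights \<open>1 + chi c\<close> and \<open>1 - chi c\<close> merge residues
    and nonresidues into one formula, so summing needs no count of either class.\<close>
  have sq: "2 * jacobsthal c ^ 2 = (1 + chi c) * jacobsthal 1 ^ 2 + (1 - chi c) * jacobsthal g ^ 2"
    if "\<not> int p dvd c" for c
  proof (cases "chi c = 1")
    case True
    then obtain r where r: "[c = r ^ 2] (mod int p)" "\<not> int p dvd r" using residue_square_root by blast
    have "jacobsthal c ^ 2 = jacobsthal 1 ^ 2"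
      using jacobsthal_scale[OF r(2), of 1] jacobsthal_cong[OF r(1)] by simp
    then show ?thesis using True by simp
  next
    case False
    then have c: "chi c = -1" using that chi_values[of c] chi_eq_0_iff[of c] by auto
    then have "chi (c * g) = 1" by (simp add: chi_mult g)
    then obtain r where r: "[c * g = r ^ 2] (mod int p)" "\<not> int p dvd r" using residue_square_root by blast
    have "[c * g * g = r ^ 2 * g] (mod int p)" using r(1) by (intro cong_mult) auto
    then have "jacobsthal (c * g ^ 2) = jacobsthal (g * r ^ 2)"
      by (intro jacobsthal_cong) (simp add: power2_eq_square mult_ac)
    then have "jacobsthal c ^ 2 = jacobsthal g ^ 2"
      using jacobsthal_scale[OF r(2), of g] jacobsthal_scale[OF g0, of c] by simp
    then show ?thesis using c by simp
  qed
  have z: "jacobsthal 0 = 0"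
  proof -
    have "jacobsthal 0 = (\<Sum>a\<in>residues_p. chi a)"
      unfolding jacobsthal_def
    proof (intro sum.cong refl)
      fix a show "chi a * chi (a ^ 2 - 0) = chi a"
        using chi_values[of a] by (auto simp: power2_eq_square chi_mult)
    qed
    then show ?thesis by (simp add: sum_chi)
  qed
  have res: "residues_p = insert 0 {1..<int p}" using p_ge_3 by auto
  have sc: "(\<Sum>c\<in>{1..<int p}. chi c) = 0" using sum_chi chi_eq_0_iff[of 0] unfolding res by simp
  have "2 * (\<Sum>c\<in>residues_p. jacobsthal c ^ 2) = (\<Sum>c\<in>{1..<int p}. 2 * jacobsthal c ^ 2)"
    unfolding res using z by (simp add: sum_distrib_left)
  also have "\<dots> = (\<Sum>c\<in>{1..<int p}. (1 + chi c) * jacobsthal 1 ^ 2 + (1 - chi c) * jacobsthal g ^ 2)"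
    by (intro sum.cong refl sq) (auto dest: zdvd_imp_le)
  also have "\<dots> = (\<Sum>c\<in>{1..<int p}. (jacobsthal 1 ^ 2 + jacobsthal g ^ 2) + chi c * (jacobsthal 1 ^ 2 - jacobsthal g ^ 2))"
    by (intro sum.cong refl) (simp add: algebra_simps)
  also have "\<dots> = (int p - 1) * (jacobsthal 1 ^ 2 + jacobsthal g ^ 2)"
    using p_ge_3 by (simp add: sum.distrib sc flip: sum_distrib_right)
  finally have "(int p - 1) * (jacobsthal 1 ^ 2 + jacobsthal g ^ 2) = (int p - 1) * (4 * int p)"
    unfolding sum1 by auto
  then show ?thesis using p_ge_3 by auto
qed

text \<open>For even \<open>n\<close> the number \<open>-1\<close> is a square, so the summand is
  invariant under the reflection of \<open>a\<close> to \<open>p - a\<close>.\<close>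

lemma jacobsthal_half:
  assumes even: "even n"
  shows "jacobsthal c = 2 * (\<Sum>a\<in>{1..int n}. chi a * chi (a ^ 2 - c))"
proof -
  let ?f = "\<lambda>a. chi a * chi (a ^ 2 - c)"
  have chi_m1: "chi (-1) = 1"
    using euler[of "-1"] even chi_values[of "-1"] by (intro small_cong_eq) (auto simp: even_power)
  have f: "?f (int p - a) = ?f a" for a
  proof -
    have "chi (int p - a) = chi (- a)" by (rule chi_cong) (simp add: cong_iff_dvd_diff)
    moreover have "chi ((int p - a) ^ 2 - c) = chi (a ^ 2 - c)"
      by (rule chi_cong) (simp add: cong_iff_dvd_diff power2_eq_square algebra_simps)
    ultimately show ?thesis using chi_mult[of "-1" a] chi_m1 by simp
  qed
  have "residues_p = insert 0 ({1..int n} \<union> {int n + 1..2 * int n})" using p_eq by auto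
  then have "jacobsthal c = ?f 0 + (\<Sum>a\<in>{1..int n} \<union> {int n + 1..2 * int n}. ?f a)"
    by (simp add: jacobsthal_def)
  also have "?f 0 = 0" using chi_eq_0_iff[of 0] by simp
  also have "(\<Sum>a\<in>{1..int n} \<union> {int n + 1..2 * int n}. ?f a) = (\<Sum>a\<in>{1..int n}. ?f a) + (\<Sum>a\<in>{int n + 1..2 * int n}. ?f a)"
    by (rule sum.union_disjoint) auto
  also have "(\<Sum>a\<in>{int n + 1..2 * int n}. ?f a) = (\<Sum>a\<in>{1..int n}. ?f (int p - a))"
    by (rule sum.reindex_bij_witness[of _ "\<lambda>a. int p - a" "\<lambda>a. int p - a"]) (use p_eq in auto)
  finally show ?thesis unfolding f by simp
qed

text \<open>Halving the Jacobsthal sums gives \<open>p = A^2 + B^2\<close> with \<open>A\<close>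
  odd. Uniqueness of the representation of a prime by two squares then identifies \<open>A^2\<close>
  with \<open>x^2\<close>.\<close>

lemma jacobsthal_1_sq:
  assumes even: "even n" and xy: "int p = x ^ 2 + 4 * y ^ 2"
  shows "jacobsthal 1 ^ 2 = 4 * x ^ 2"
proof -
  obtain g where g: "chi g = -1" using nonresidue_exists by blast
  define A where "A = (\<Sum>a\<in>{1..int n}. chi a * chi (a ^ 2 - 1))"
  define B where "B = (\<Sum>a\<in>{1..int n}. chi a * chi (a ^ 2 - g))"
  have AB: "jacobsthal 1 = 2 * A" "jacobsthal g = 2 * B" using even by (simp_all add: A_def B_def jacobsthal_half)
  then have p: "A ^ 2 + B ^ 2 = int p" using jacobsthal_sum_squares[OF even g] by simp
  \<comment> \<open>The term at \<open>a = 1\<close> is zero, and the other \<open>n - 1\<close>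
    terms are signs, an odd number of them.\<close>
  have oddA: "odd A"
  proof -
    have "{1..int n} = insert 1 {2..int n}" using n_pos by auto
    moreover have "chi (1 ^ 2 - 1) = 0" by (simp add: chi_eq_0_iff)
    ultimately have A: "A = (\<Sum>a\<in>{2..int n}. chi a * chi (a ^ 2 - 1))" unfolding A_def by simp
    have o: "odd (chi a * chi (a ^ 2 - 1))" if a: "a \<in> {2..int n}" for a
    proof -
      have "\<not> int p dvd a" "\<not> int p dvd a - 1" "\<not> int p dvd a + 1"
        using a p_eq by (auto dest!: zdvd_imp_le)
      then have "\<not> int p dvd a" "\<not> int p dvd (a - 1) * (a + 1)" using prime by (auto simp: prime_dvd_mult_iff)
      moreover have "(a - 1) * (a + 1) = a ^ 2 - 1" by (simp add: power2_eq_square algebra_simps)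
      ultimately have "chi a \<noteq> 0" "chi (a ^ 2 - 1) \<noteq> 0" by (simp_all add: chi_eq_0_iff)
      then show ?thesis using chi_values[of a] chi_values[of "a ^ 2 - 1"] by auto
    qed
    have "even (\<Sum>a\<in>{2..int n}. chi a * chi (a ^ 2 - 1)) = even (card {a \<in> {2..int n}. odd (chi a * chi (a ^ 2 - 1))})"
      by (rule even_sum_iff) simp
    also have "{a \<in> {2..int n}. odd (chi a * chi (a ^ 2 - 1))} = {2..int n}" using o by auto
    also have "card {2..int n} = n - 1" by simp
    finally show ?thesis unfolding A using even n_pos by simp
  qed
  have oddx: "odd x"
  proof
    assume "even x"
    then have "even (x ^ 2 + 4 * y ^ 2)" by simp
    then show False using odd unfolding xy[symmetric] by simp
  qed
  have "int p * (x ^ 2 - A ^ 2) = (x * B - 2 * y * A) * (x * B + 2 * y * A)"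
  proof -
    have "(x * B - 2 * y * A) * (x * B + 2 * y * A) = x ^ 2 * B ^ 2 - (4 * y ^ 2) * A ^ 2"
      by (simp add: power2_eq_square algebra_simps)
    also have "B ^ 2 = int p - A ^ 2" using p by simp
    also have "4 * y ^ 2 = int p - x ^ 2" using xy by simp
    finally show ?thesis by (simp add: algebra_simps)
  qed
  then have "int p dvd (x * B - 2 * y * A) * (x * B + 2 * y * A)" by (metis dvd_triv_left)
  then have "int p dvd x * B - 2 * y * A \<or> int p dvd x * B + 2 * y * A" using prime by (simp add: prime_dvd_mult_iff)
  \<comment> \<open>The sign of \<open>y\<close> is chosen to select the divisible factor.\<close>
  then obtain z where z: "z = y \<or> z = - y" "int p dvd x * B - 2 * z * A" by (metis add.inverse_inverse diff_minus_eq_add mult_minus_left mult_minus_right)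
  then have xz: "int p = x ^ 2 + 4 * z ^ 2" using xy by auto
  have "odd (x * A + 2 * z * B)" using oddx oddA by simp
  then have "x * A + 2 * z * B \<noteq> 0" by (metis even_zero)
  then have nz: "(x * A + 2 * z * B) ^ 2 > 0" by simp
  have sum: "(x * A + 2 * z * B) ^ 2 + (x * B - 2 * z * A) ^ 2 = int p ^ 2"
  proof -
    have "(x * A + 2 * z * B) ^ 2 + (x * B - 2 * z * A) ^ 2 = (x ^ 2 + 4 * z ^ 2) * (A ^ 2 + B ^ 2)"
      by (simp add: power2_eq_square algebra_simps)
    then show ?thesis using xz p by (simp add: power2_eq_square)
  qed
  \<comment> \<open>The two squares add up to \<open>p^2\<close>, and the first is positive because
    its base is odd; a nonzero multiple of \<open>p\<close> would leave no room for it.\<close>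
  have "x * B - 2 * z * A = 0"
  proof (rule ccontr)
    assume "x * B - 2 * z * A \<noteq> 0"
    then have "int p \<le> \<bar>x * B - 2 * z * A\<bar>" using dvd_imp_le_int[OF _ z(2)] by simp
    from power_mono[OF this, of 2] have "int p ^ 2 \<le> (x * B - 2 * z * A) ^ 2" by simp
    then show False using sum nz by simp
  qed
  then have "(x * B) ^ 2 = (2 * z * A) ^ 2" by simp
  then have "x ^ 2 * B ^ 2 = (4 * z ^ 2) * A ^ 2" by (simp add: power_mult_distrib)
  moreover have "B ^ 2 = int p - A ^ 2" "4 * z ^ 2 = int p - x ^ 2" using p xz by simp_all
  ultimately have "int p * x ^ 2 = int p * A ^ 2" by (simp add: algebra_simps)
  then show ?thesis using AB p_ge_3 by (simp add: power_mult_distrib)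
qed

end

section \<open>The Jacobsthal sum modulo \<open>p\<^sup>2\<close>\<close>

context odd_prime
begin

text \<open>The cofactor of \<open>a - b\<close> in \<open>a^p - b^p\<close> is congruent to
  \<open>p * b^(p - 1)\<close>, a second multiple of \<open>p\<close>. So \<open>a^p\<close> is a
  representative modulo \<open>p^2\<close> depending only on \<open>a\<close> modulo
  \<open>p\<close>.\<close>

lemma pow_p_cong:
  assumes ab: "[a = b] (mod int p)" shows "[a ^ p = b ^ p] (mod int p ^ 2)"
proof -
  have "int p dvd (\<Sum>i<p. b ^ (p - Suc i) * a ^ i)"
  proof -
    have "[(\<Sum>i<p. b ^ (p - Suc i) * a ^ i) = (\<Sum>i<p. b ^ (p - 1))] (mod int p)"
    proof (rule cong_sum)
      fix i assume "i \<in> {..<p}"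
      then have "b ^ (p - Suc i) * b ^ i = b ^ (p - 1)" by (simp flip: power_add)
      moreover have "[b ^ (p - Suc i) * a ^ i = b ^ (p - Suc i) * b ^ i] (mod int p)"
        by (intro cong_mult cong_refl cong_pow ab)
      ultimately show "[b ^ (p - Suc i) * a ^ i = b ^ (p - 1)] (mod int p)" by simp
    qed
    then show ?thesis by (simp add: cong_dvd_iff)
  qed
  moreover have "int p dvd a - b" using ab by (simp add: cong_iff_dvd_diff)
  ultimately have "int p * int p dvd (a - b) * (\<Sum>i<p. b ^ (p - Suc i) * a ^ i)" by (simp add: mult_dvd_mono)
  then show ?thesis by (simp add: cong_iff_dvd_diff power_diff_sumr2 power2_eq_square)
qed

text \<open>A Newton step for \<open>e\<^sup>2 = 1\<close> at \<open>e = b\<^sup>n\<close>: the error is \<open>(e - \<chi>(b))\<^sup>2 (e + 2 \<chi>(b))\<close>.\<close>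

lemma chi_lift:
  assumes "n \<ge> 2" shows "[2 * chi b = 3 * b ^ n - b ^ (3 * n)] (mod int p ^ 2)"
proof (cases "int p dvd b")
  case True
  have "int p ^ 2 dvd b ^ n"
    using dvd_trans[OF dvd_power_same[OF True] le_imp_power_dvd[OF assms]] .
  moreover have "b ^ (3 * n) = b ^ n * b ^ (2 * n)" by (simp flip: power_add)
  ultimately have "int p ^ 2 dvd 3 * b ^ n - b ^ (3 * n)" by (simp add: dvd_diff)
  then have "[3 * b ^ n - b ^ (3 * n) = 0] (mod int p ^ 2)" by (simp only: cong_0_iff)
  then show ?thesis using True chi_eq_0_iff[of b] cong_sym by simp
next
  case False
  define e where "e = b ^ n"
  define x where "x = chi b"
  have x: "x * x = 1" using chi_square[OF False] by (simp add: x_def)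
  have "int p dvd e - x" using cong_sym[OF euler[of b]] by (simp add: cong_iff_dvd_diff e_def x_def)
  then have "int p ^ 2 dvd (e - x) ^ 2 * (e + 2 * x)" by (simp add: dvd_power_same)
  moreover have "(e - x) ^ 2 * (e + 2 * x) = 2 * x * (x * x) - (3 * e * (x * x) - e ^ 3)"
    by (simp add: power2_eq_square power3_eq_cube algebra_simps)
  moreover have "e ^ 3 = b ^ (3 * n)" by (simp add: e_def mult.commute flip: power_mult)
  ultimately show ?thesis unfolding x by (simp add: cong_iff_dvd_diff e_def x_def)
qed

lemma fermat_int: "\<not> int p dvd a \<Longrightarrow> [a ^ (p - 1) = 1] (mod int p)"
proof -
  assume a: "\<not> int p dvd a"
  have "[a ^ n * a ^ n = chi a * chi a] (mod int p)" by (intro cong_mult cong_sym[OF euler])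
  moreover have "p - 1 = n + n" using p_eq by simp
  ultimately show ?thesis using chi_square[OF a] by (simp add: power_add)
qed

text \<open>If \<open>p - 1\<close> divides \<open>k\<close>, every term with \<open>a\<close> prime
  to \<open>p\<close> is \<open>1\<close>. Otherwise multiplication by a primitive root
  \<open>g\<close> reproduces the sum times \<open>g^(p * k)\<close>, which is not \<open>1\<close>
  modulo \<open>p\<close>.\<close>

lemma power_sum_cong:
  assumes k: "k > 0"
  shows "[(\<Sum>a\<in>residues_p. (a ^ p) ^ k) = (if p - 1 dvd k then int p - 1 else 0)] (mod int p ^ 2)"
proof (cases "p - 1 dvd k")
  case True
  then obtain d where d: "k = (p - 1) * d" by blast
  have "[(\<Sum>a\<in>residues_p. (a ^ p) ^ k) = (\<Sum>a\<in>residues_p. if int p dvd a then 0 else 1)] (mod int p ^ 2)"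
  proof (rule cong_sum)
    fix a assume a: "a \<in> residues_p"
    show "[(a ^ p) ^ k = (if int p dvd a then 0 else 1)] (mod int p ^ 2)"
    proof (cases "int p dvd a")
      case True
      then have "a = 0" using a dvd_residue by blast
      then show ?thesis using k p_ge_3 by (simp add: zero_power)
    next
      case False
      have "[(a ^ (p - 1)) ^ p = 1 ^ p] (mod int p ^ 2)" by (intro pow_p_cong fermat_int False)
      then have "[((a ^ (p - 1)) ^ p) ^ d = (1 ^ p) ^ d] (mod int p ^ 2)" by (rule cong_pow)
      moreover have "((a ^ (p - 1)) ^ p) ^ d = (a ^ p) ^ k" by (simp add: d mult_ac flip: power_mult)
      ultimately show ?thesis using False by simp
    qed
  qed
  then show ?thesis using True by (simp only: card_nonzero_residues if_True)
next
  case False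
  obtain g :: int where g: "\<And>k. [g ^ k = 1] (mod int p) \<longleftrightarrow> p - 1 dvd k" using primitive_root_exists by blast
  define S where "S = (\<Sum>a\<in>residues_p. (a ^ p) ^ k)"
  \<comment> \<open>Reduction modulo \<open>p^2\<close> makes the summand periodic as an exact
    function, as \<open>sum_periodic\<close> demands.\<close>
  define f where "f a = ((a ^ p) ^ k) mod (int p ^ 2)" for a :: int
  have per: "f a = f b" if "[a = b] (mod int p)" for a b
    using cong_pow[OF pow_p_cong[OF that], of k] by (simp add: f_def cong_def)
  have g0: "\<not> int p dvd g"
  proof
    assume "int p dvd g"
    moreover have "g dvd g ^ (p - 1)" using p_ge_3 by (intro dvd_power) simp
    ultimately have "int p dvd g ^ (p - 1)" by (rule dvd_trans)
    moreover have "[g ^ (p - 1) = 1] (mod int p)" using g[of "p - 1"] by (simp only: dvd_refl)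
    ultimately have "int p dvd 1" using cong_dvd_iff[of "g ^ (p - 1)" 1 "int p"] by blast
    then show False using p_ge_3 by simp
  qed
  have fS: "[(\<Sum>a\<in>residues_p. f a) = S] (mod int p ^ 2)" unfolding S_def f_def by (rule cong_sum) (simp add: cong_def)
  have "[(\<Sum>a\<in>residues_p. f (g * a + 0)) = (\<Sum>a\<in>residues_p. g ^ (p * k) * (a ^ p) ^ k)] (mod int p ^ 2)"
    unfolding f_def by (rule cong_sum) (simp add: cong_def power_mult_distrib power_mult)
  also have "(\<Sum>a\<in>residues_p. g ^ (p * k) * (a ^ p) ^ k) = g ^ (p * k) * S" by (simp add: S_def sum_distrib_left)
  finally have "[(\<Sum>a\<in>residues_p. f a) = g ^ (p * k) * S] (mod int p ^ 2)"
    using sum_periodic[where f = f and r = g and s = 0, OF per g0] by simp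
  from cong_trans[OF cong_sym[OF this] fS] have "[g ^ (p * k) * S = S] (mod int p ^ 2)" .
  then have dvd: "int p ^ 2 dvd (g ^ (p * k) - 1) * S" by (simp add: cong_iff_dvd_diff algebra_simps)
  have "coprime (p - 1) p"
    using p_ge_3 coprime_Suc_right_nat[of "p - 1"] by simp
  then have "\<not> p - 1 dvd p * k" using False by (simp add: coprime_dvd_mult_right_iff)
  then have "\<not> int p dvd g ^ (p * k) - 1" using g[of "p * k"] by (simp add: cong_iff_dvd_diff)
  then have "coprime (int p ^ 2) (g ^ (p * k) - 1)" using prime by (simp add: prime_imp_coprime)
  then have "int p ^ 2 dvd S" using dvd by (simp add: coprime_dvd_mult_right_iff)
  then show ?thesis using False by (simp add: S_def cong_0_iff)
qed

text \<open>The binomial theorem gives monomials of exponent \<open>N + 2 * j\<close>; only those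
  divisible by \<open>p - 1\<close> survive the summation.\<close>

lemma power_sum_expand:
  assumes N: "N > 0"
  shows "[(\<Sum>a\<in>residues_p. (a ^ p * ((a ^ p) ^ 2 - 1)) ^ N)
    = (int p - 1) * (\<Sum>j\<in>{j. j \<le> N \<and> p - 1 dvd N + 2 * j}. (-1) ^ (N - j) * int (N choose j))] (mod int p ^ 2)"
proof -
  have if_mult: "c * (if b then d else 0) = (if b then d * c else 0)" for b and c d :: int by simp
  have "(\<Sum>a\<in>residues_p. (a ^ p * ((a ^ p) ^ 2 - 1)) ^ N)
      = (\<Sum>a\<in>residues_p. \<Sum>j\<le>N. ((-1) ^ (N - j) * int (N choose j)) * (a ^ p) ^ (N + 2 * j))"
  proof (intro sum.cong refl)
    fix a :: int
    define z where "z = a ^ p"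
    have "(z * (z ^ 2 - 1)) ^ N = z ^ N * (z ^ 2 + (-1)) ^ N" by (simp add: power_mult_distrib)
    also have "(z ^ 2 + (-1)) ^ N = (\<Sum>j\<le>N. of_nat (N choose j) * (z ^ 2) ^ j * (-1) ^ (N - j))" by (rule binomial_ring)
    finally show "(a ^ p * ((a ^ p) ^ 2 - 1)) ^ N = (\<Sum>j\<le>N. ((-1) ^ (N - j) * int (N choose j)) * (a ^ p) ^ (N + 2 * j))"
      unfolding z_def[symmetric] by (simp add: sum_distrib_left power_add mult_ac flip: power_mult)
  qed
  also have "\<dots> = (\<Sum>j\<le>N. ((-1) ^ (N - j) * int (N choose j)) * (\<Sum>a\<in>residues_p. (a ^ p) ^ (N + 2 * j)))"
    by (subst sum.swap) (simp add: sum_distrib_left)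
  finally have 1: "(\<Sum>a\<in>residues_p. (a ^ p * ((a ^ p) ^ 2 - 1)) ^ N) = \<dots>" .
  have 2: "[(\<Sum>j\<le>N. ((-1) ^ (N - j) * int (N choose j)) * (\<Sum>a\<in>residues_p. (a ^ p) ^ (N + 2 * j)))
      = (\<Sum>j\<le>N. ((-1) ^ (N - j) * int (N choose j)) * (if p - 1 dvd N + 2 * j then int p - 1 else 0))] (mod int p ^ 2)"
    by (rule cong_sum, rule cong_mult[OF cong_refl power_sum_cong]) (use N in simp)
  have "(\<Sum>j\<le>N. ((-1) ^ (N - j) * int (N choose j)) * (if p - 1 dvd N + 2 * j then int p - 1 else 0))
      = (\<Sum>j\<le>N. if p - 1 dvd N + 2 * j then (int p - 1) * ((-1) ^ (N - j) * int (N choose j)) else 0)"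
    by (simp only: if_mult)
  also have "\<dots> = (\<Sum>j\<in>{j \<in> {..N}. p - 1 dvd N + 2 * j}. (int p - 1) * ((-1) ^ (N - j) * int (N choose j)))"
    by (rule sum.inter_filter[symmetric]) simp
  also have "\<dots> = (int p - 1) * (\<Sum>j\<in>{j. j \<le> N \<and> p - 1 dvd N + 2 * j}. (-1) ^ (N - j) * int (N choose j))"
    by (simp add: sum_distrib_left)
  finally show ?thesis using 2 unfolding 1 by (simp only:)
qed

text \<open>\<open>chi_lift\<close> replaces the character by the powers \<open>n = 2 * m\<close>
  and \<open>3 * n = 6 * m\<close>, whose sums leave one and three binomial coefficients; two of the
  three coincide by symmetry.\<close>

lemma jacobsthal_binomial:
  assumes p: "p = 4 * m + 1"
  shows "[2 * jacobsthal 1 = (int p - 1) * (-1) ^ m *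
    (3 * int ((2 * m) choose m) - int ((6 * m) choose (3 * m)) - 2 * int ((6 * m) choose m))] (mod int p ^ 2)"
proof -
  have n: "n = 2 * m" using p p_eq by simp
  have m: "m > 0" using p p_ge_3 by simp
  \<comment> \<open>Replacing \<open>a\<close> by \<open>a^p\<close> does not change the character,
    but makes the power sums computable modulo \<open>p^2\<close>.\<close>
  define b where "b a = a ^ p * ((a ^ p) ^ 2 - 1)" for a :: int
  have ap: "[a ^ p = a] (mod int p)" for a
  proof (cases "int p dvd a")
    case True
    moreover have "a dvd a ^ p" using p_ge_3 by (intro dvd_power) simp
    ultimately have "[a ^ p = 0] (mod int p)" "[a = 0] (mod int p)"
      using dvd_trans by (auto simp only: cong_0_iff)
    then show ?thesis using cong_trans[OF _ cong_sym] by blast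
  next
    case False
    have "[a ^ (p - 1) * a = 1 * a] (mod int p)" by (intro cong_mult fermat_int False cong_refl)
    moreover have "a ^ p = a ^ (p - 1) * a" using p_ge_3 by (cases p) simp_all
    ultimately show ?thesis by simp
  qed
  have "jacobsthal 1 = (\<Sum>a\<in>residues_p. chi (b a))"
    unfolding jacobsthal_def
  proof (intro sum.cong refl)
    fix a
    have "chi a * chi (a ^ 2 - 1) = chi (a * (a ^ 2 - 1))" by (simp add: chi_mult)
    also have "\<dots> = chi (b a)" unfolding b_def
      by (intro chi_cong cong_mult cong_diff cong_pow cong_refl cong_sym[OF ap])
    finally show "chi a * chi (a ^ 2 - 1) = chi (b a)" .
  qed
  then have "2 * jacobsthal 1 = (\<Sum>a\<in>residues_p. 2 * chi (b a))" by (simp add: sum_distrib_left)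
  also have "[\<dots> = (\<Sum>a\<in>residues_p. 3 * b a ^ n - b a ^ (3 * n))] (mod int p ^ 2)"
    by (intro cong_sum chi_lift) (use n m in simp)
  also have "(\<Sum>a\<in>residues_p. 3 * b a ^ n - b a ^ (3 * n))
      = 3 * (\<Sum>a\<in>residues_p. b a ^ (2 * m)) - (\<Sum>a\<in>residues_p. b a ^ (6 * m))"
    by (simp add: n sum_subtractf sum_distrib_left)
  also have "[\<dots> = 3 * ((int p - 1) * (\<Sum>j\<in>{j. j \<le> 2 * m \<and> p - 1 dvd 2 * m + 2 * j}. (-1) ^ (2 * m - j) * int ((2 * m) choose j)))
      - (int p - 1) * (\<Sum>j\<in>{j. j \<le> 6 * m \<and> p - 1 dvd 6 * m + 2 * j}. (-1) ^ (6 * m - j) * int ((6 * m) choose j))] (mod int p ^ 2)"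
    unfolding b_def by (intro cong_diff cong_mult[OF cong_refl] power_sum_expand) (use m in simp_all)
  also have "{j. j \<le> 2 * m \<and> p - 1 dvd 2 * m + 2 * j} = {m}"
  proof (intro equalityI subsetI)
    fix j assume "j \<in> {j. j \<le> 2 * m \<and> p - 1 dvd 2 * m + 2 * j}"
    then obtain c where j: "j \<le> 2 * m" and c: "2 * m + 2 * j = 4 * m * c" by (auto simp: p)
    have "0 < c" using c m by (cases c) auto
    moreover have "c < 2"
    proof (rule ccontr)
      assume "\<not> c < 2"
      then have "4 * m * 2 \<le> 4 * m * c" by (intro mult_le_mono) auto
      then show False using c j m by linarith
    qed
    ultimately have "c = 1" by simp
    then show "j \<in> {m}" using c by simp
  qed (auto simp: p)
  also have "{j. j \<le> 6 * m \<and> p - 1 dvd 6 * m + 2 * j} = {m, 3 * m, 5 * m}"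
  proof (intro equalityI subsetI)
    fix j assume "j \<in> {j. j \<le> 6 * m \<and> p - 1 dvd 6 * m + 2 * j}"
    then obtain c where j: "j \<le> 6 * m" and c: "6 * m + 2 * j = 4 * m * c" by (auto simp: p)
    have "c < 5"
    proof (rule ccontr)
      assume "\<not> c < 5"
      then have "4 * m * 5 \<le> 4 * m * c" by (intro mult_le_mono) auto
      then show False using c j m by linarith
    qed
    moreover have "c > 1"
    proof (rule ccontr)
      assume "\<not> c > 1"
      then have "4 * m * c \<le> 4 * m * 1" by (intro mult_le_mono) auto
      then show False using c m by linarith
    qed
    ultimately have "c = 2 \<or> c = 3 \<or> c = 4" by auto
    then show "j \<in> {m, 3 * m, 5 * m}" using c by auto
  next
    fix j assume "j \<in> {m, 3 * m, 5 * m}"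
    then have "6 * m + 2 * j = 4 * m * 2 \<or> 6 * m + 2 * j = 4 * m * 3 \<or> 6 * m + 2 * j = 4 * m * 4" by auto
    then have "4 * m dvd 6 * m + 2 * j" by (metis dvd_triv_left)
    then show "j \<in> {j. j \<le> 6 * m \<and> p - 1 dvd 6 * m + 2 * j}" using \<open>j \<in> {m, 3 * m, 5 * m}\<close> by (auto simp: p)
  qed
  also have "(\<Sum>j\<in>{m, 3 * m, 5 * m}. (-1) ^ (6 * m - j) * int ((6 * m) choose j))
      = (-1) ^ m * (int ((6 * m) choose (3 * m)) + 2 * int ((6 * m) choose m))"
  proof -
    have "(-1) ^ (5 * m) = ((-1) ^ m :: int)" "(-1) ^ (3 * m) = ((-1) ^ m :: int)" by (simp_all add: power_mult)
    moreover have "(6 * m) choose (5 * m) = (6 * m) choose m" using binomial_symmetric[of m "6 * m"] by simp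
    ultimately show ?thesis using m by (simp add: algebra_simps)
  qed
  finally show ?thesis by (simp add: algebra_simps)
qed

end

section \<open>The binomial coefficients of the Jacobsthal sum and the Fermat quotient\<close>

text \<open>The usual identity has the range \<open>m + 1\<close> to \<open>2 * m\<close>; moving it
  down by one changes the sum by \<open>1 / m - 1 / (2 * m)\<close>, the extra term.\<close>

lemma sum_inverse_eq_alternating:
  "m > 0 \<Longrightarrow> (\<Sum>i = m..<2 * m. 1 / of_nat i) = (\<Sum>k<2 * m. (-1) ^ k / (of_nat k + 1)) + 1 / (2 * of_nat m :: rat)"
proof (induction m rule: nat_induct_non_zero)
  case (Suc m)
  have "(\<Sum>i = m..<2 * m. 1 / of_nat i :: rat) = 1 / of_nat m + (\<Sum>i = Suc m..<2 * m. 1 / of_nat i)"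
    by (rule sum.atLeast_Suc_lessThan) (use Suc in simp)
  moreover have "(\<Sum>i = Suc m..<2 * Suc m. 1 / of_nat i :: rat)
      = (\<Sum>i = Suc m..<2 * m. 1 / of_nat i) + 1 / of_nat (2 * m) + 1 / of_nat (2 * m + 1)"
    using Suc by simp
  ultimately show ?case using Suc by (simp add: add.commute)
qed (simp add: lessThan_nat_numeral numeral_2_eq_2)

context odd_prime
begin

lemma binomial_p_minus_1_cong: "k < p \<Longrightarrow> of_nat ((p - 1) choose k) \<sim> (-1) ^ k"
proof (induction k)
  case (Suc k)
  have "Suc k * ((p - 1) choose Suc k) = (p - 1 - k) * ((p - 1) choose k)"
    using binomial_absorption[of k "p - 1"] binomial_absorb_comp[of "p - 1" k] by simp
  from arg_cong[OF this, of "of_nat :: nat \<Rightarrow> rat"]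
  have "(of_nat k + 1) * of_nat ((p - 1) choose Suc k)
      = of_nat p * of_nat ((p - 1) choose k) + (- (of_nat k + 1)) * (of_nat ((p - 1) choose k) :: rat)"
    unfolding of_nat_mult using Suc.prems by (simp add: of_nat_diff algebra_simps)
  also have "\<dots> \<sim> 0 + (- (of_nat k + 1)) * (-1) ^ k"
    by (intro qcong_add p_mult_cong1 qcong_cmult pint_uminus pint_add pint_of_nat pint_numeral Suc.IH)
      (use Suc.prems in simp)
  also have "0 + (- (of_nat k + 1)) * (-1) ^ k = (of_nat k + 1) * (-1 :: rat) ^ Suc k" by (simp add: algebra_simps)
  finally have *: "(of_nat k + 1) * of_nat ((p - 1) choose Suc k) \<sim> (of_nat k + 1) * (-1) ^ Suc k" .
  have "\<not> p dvd k + 1" by (rule not_dvd_less) (use Suc.prems in simp_all)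
  then have "inverse (of_nat k + 1) \<in> pint p" using pint_inverse_nat[of "k + 1"] by (simp add: add.commute)
  then show ?case by (rule qcong_cancel[OF *]) (use two_k_plus_1_nonzero in \<open>simp add: add_nonneg_eq_0_iff\<close>)
qed simp

lemma binomial_p_plus_cong: "k < p \<Longrightarrow> of_nat ((p + k) choose k) \<sim> 1"
proof (induction k)
  case (Suc k)
  have "Suc k * ((p + Suc k) choose Suc k) = Suc (p + k) * ((p + k) choose k)"
    using Suc_times_binomial_eq[of "p + k" k] by simp
  from arg_cong[OF this, of "of_nat :: nat \<Rightarrow> rat"]
  have "(of_nat k + 1) * of_nat ((p + Suc k) choose Suc k)
      = of_nat p * of_nat ((p + k) choose k) + (of_nat k + 1) * (of_nat ((p + k) choose k) :: rat)"
    unfolding of_nat_mult by (simp add: algebra_simps)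
  also have "\<dots> \<sim> 0 + (of_nat k + 1) * 1"
    by (intro qcong_add p_mult_cong1 qcong_cmult pint_uminus pint_add pint_of_nat pint_numeral Suc.IH)
      (use Suc.prems in simp)
  finally have *: "(of_nat k + 1) * of_nat ((p + Suc k) choose Suc k) \<sim> (of_nat k + 1) * 1" by simp
  have "\<not> p dvd k + 1" by (rule not_dvd_less) (use Suc.prems in simp_all)
  then have "inverse (of_nat k + 1) \<in> pint p" using pint_inverse_nat[of "k + 1"] by (simp add: add.commute)
  then show ?case by (rule qcong_cancel[OF *]) (use two_k_plus_1_nonzero in \<open>simp add: add_nonneg_eq_0_iff\<close>)
qed simp

text \<open>First-order expansion in \<open>p\<close> of the product of the \<open>p + i\<close>;
  the bound \<open>a + k \<le> p\<close> keeps every \<open>i\<close> a unit.\<close>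

lemma pochhammer_shift_cong:
  assumes a: "a > 0"
  shows "a + k \<le> p \<Longrightarrow> pochhammer (of_nat p + of_nat a) k
    \<approx> pochhammer (of_nat a) k * (1 + of_nat p * (\<Sum>i = a..<a + k. 1 / of_nat i))"
proof (induction k)
  case (Suc k)
  define P where "P = (of_nat p :: rat)"
  define s where "s = (\<Sum>i = a..<a + k. 1 / of_nat i :: rat)"
  define c where "c = (of_nat (a + k) :: rat)"
  define h where "h = pochhammer (of_nat a :: rat) k"
  have c: "c \<noteq> 0" using a by (simp add: c_def)
  have s: "s \<in> pint p" unfolding s_def
    by (intro pint_sum pint_divide pint_numeral pint_inverse_nat not_dvd_less) (use a Suc.prems in auto)
  have h: "h \<in> pint p" by (auto simp: h_def)
  have "(P + c) * pochhammer (of_nat p + of_nat a) k \<approx> (P + c) * (h * (1 + P * s))"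
    unfolding P_def h_def s_def c_def using Suc by (intro qcong_cmult) auto
  also have "(P + c) * (h * (1 + P * s)) = h * c * (1 + P * (s + 1 / c)) + P ^ 2 * (h * s)"
    using c by (simp add: field_simps power2_eq_square)
  also have "\<dots> \<approx> h * c * (1 + P * (s + 1 / c)) + 0"
    unfolding P_def by (intro qcong_add qcong_refl p2_mult_cong2 pint_mult h s)
  finally show ?case
    by (simp add: pochhammer_Suc P_def c_def h_def s_def algebra_simps)
qed simp

definition fermat_quot :: rat where "fermat_quot = (2 ^ (p - 1) - 1) / of_nat p"

lemma two_power: "2 ^ (p - 1) = 1 + of_nat p * fermat_quot"
  by (simp add: fermat_quot_def)

lemma pint_fermat_quot [simp]: "fermat_quot \<in> pint p"
proof -
  have "\<not> int p dvd 2" using p_ge_3 by (auto dest: zdvd_imp_le)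
  then obtain d where "2 ^ (p - 1) - 1 = int p * d" using fermat_int by (auto simp: cong_iff_dvd_diff)
  then have "(of_int (2 ^ (p - 1) - 1) :: rat) = of_int (int p * d)" by simp
  then have "fermat_quot = of_int d" using p_ge_3 by (simp add: fermat_quot_def)
  then show ?thesis by simp
qed

text \<open>In the row sum of \<open>2^p\<close> the entry at \<open>k + 1\<close> is
  \<open>p / (k + 1)\<close> times \<open>binom(p - 1, k)\<close>, which is \<open>(-1)^k\<close>
  modulo \<open>p\<close>. This gives twice the quotient as a sum of length \<open>p - 1\<close>,
  whose two halves agree modulo \<open>p\<close>.\<close>

lemma fermat_quot_cong: "fermat_quot \<sim> (\<Sum>k<n. (-1) ^ k / (of_nat k + 1))"
proof -
  define f where "f k = ((-1) ^ k / (of_nat k + 1) :: rat)" for k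
  have inv: "inverse (of_nat k + 1) \<in> pint p" if "k < 2 * n" for k
  proof -
    have "\<not> p dvd k + 1" by (rule not_dvd_less) (use that p_eq in simp_all)
    then show ?thesis using pint_inverse_nat[of "k + 1"] by (simp add: add.commute)
  qed
  have nz: "of_nat k + 1 \<noteq> (0 :: rat)" for k
    using of_nat_0_le_iff[of k, where ?'a = rat] by (simp add: add_nonneg_eq_0_iff)
  have "2 * fermat_quot = (\<Sum>k<2 * n. inverse (of_nat k + 1) * of_nat ((p - 1) choose k))"
  proof -
    have ch: "of_nat (p choose Suc k) = of_nat p * (inverse (of_nat k + 1) * (of_nat ((p - 1) choose k) :: rat))" for k
    proof -
      have "Suc k * (p choose Suc k) = p * ((p - 1) choose k)" by (rule binomial_absorption)
      from arg_cong[OF this, of "of_nat :: nat \<Rightarrow> rat"]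
      have "(of_nat k + 1) * of_nat (p choose Suc k) = of_nat p * (of_nat ((p - 1) choose k) :: rat)"
        unfolding of_nat_mult by (simp add: add.commute)
      then show ?thesis using nz[of k] by (simp add: field_simps)
    qed
    have "(2 :: rat) ^ p = of_nat (\<Sum>k\<le>p. p choose k)" unfolding choose_row_sum by simp
    also have "{..p} = insert 0 (insert p (Suc ` {..<2 * n}))"
    proof -
      have "Suc ` {..<2 * n} = {1..2 * n}" by (auto simp: image_iff) (metis Suc_le_D Suc_le_lessD lessThan_iff less_Suc_eq_le)
      then show ?thesis using p_eq by auto
    qed
    also have "(\<Sum>k\<in>insert 0 (insert p (Suc ` {..<2 * n})). p choose k) = 2 + (\<Sum>k<2 * n. p choose Suc k)"
    proof -
      have "p \<notin> Suc ` {..<2 * n}" "0 \<notin> insert p (Suc ` {..<2 * n})" using p_eq by auto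
      then show ?thesis by (simp add: sum.reindex)
    qed
    finally have "(2 :: rat) ^ p = 2 + (\<Sum>k<2 * n. of_nat (p choose Suc k))" by simp
    also have "(2 :: rat) ^ p = 2 * 2 ^ (p - 1)" using p_ge_3 by (cases p) simp_all
    finally have "2 * (of_nat p * fermat_quot) = of_nat p * (\<Sum>k<2 * n. inverse (of_nat k + 1) * of_nat ((p - 1) choose k))"
      unfolding two_power ch sum_distrib_left[symmetric] by simp
    then show ?thesis using p_ge_3 by simp
  qed
  also have "\<dots> \<sim> (\<Sum>k<2 * n. inverse (of_nat k + 1) * (-1) ^ k)"
    by (intro qcong_sum qcong_cmult binomial_p_minus_1_cong inv) (use p_eq in auto)
  also have "(\<Sum>k<2 * n. inverse (of_nat k + 1) * (-1) ^ k) = (\<Sum>k<2 * n. f k)"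
    by (simp add: f_def divide_inverse mult.commute)
  also have "(\<Sum>k<2 * n. f k) = (\<Sum>k<n. f k) + (\<Sum>k\<in>{n..<2 * n}. f k)"
  proof -
    have "{..<2 * n} = {..<n} \<union> {n..<2 * n}" by auto
    then show ?thesis by (simp add: sum.union_disjoint ivl_disj_int)
  qed
  \<comment> \<open>The reflection changes the sign of the numerator and, modulo \<open>p\<close>,
    that of the denominator \<open>p - (k + 1)\<close>.\<close>
  also have "(\<Sum>k\<in>{n..<2 * n}. f k) = (\<Sum>k<n. f (2 * n - 1 - k))"
    by (rule sum.reindex_bij_witness[of _ "\<lambda>k. 2 * n - 1 - k" "\<lambda>k. 2 * n - 1 - k"]) auto
  also have "(\<Sum>k<n. f k) + (\<Sum>k<n. f (2 * n - 1 - k)) \<sim> (\<Sum>k<n. f k) + (\<Sum>k<n. f k)"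
  proof (intro qcong_add qcong_refl qcong_sum)
    fix k assume "k \<in> {..<n}"
    then have k: "k < n" by simp
    have "(-1) ^ (2 * n - 1 - k) = - ((-1) ^ k :: rat)"
    proof -
      have "(-1) ^ (2 * n - 1 - k) * (-1) ^ (k + 1) = ((-1) ^ (2 * n) :: rat)" using k by (simp flip: power_add)
      then have "(-1) ^ (2 * n - 1 - k) * (-1) ^ k = (-1 :: rat)" by simp
      then have h: "((-1) ^ (2 * n - 1 - k) * (-1) ^ k) * (-1) ^ k = - ((-1) ^ k :: rat)" by simp
      have "(-1) ^ k * (-1) ^ k = (1 :: rat)" by (simp flip: power_mult_distrib)
      then show ?thesis using h by (simp only: mult.assoc mult_1_right)
    qed
    moreover have e: "of_nat (2 * n - 1 - k) + 1 = of_nat p - (of_nat k + 1 :: rat)"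
      using k by (simp add: of_nat_diff p_rat)
    ultimately have fe: "f (2 * n - 1 - k) = - ((-1) ^ k) / (of_nat p - (of_nat k + 1))" by (simp only: f_def)
    have ne: "of_nat p - (of_nat k + 1) \<noteq> (0 :: rat)" using nz[of "2 * n - 1 - k"] unfolding e .
    have gen: "- x / (P - d) = P * (- x * inverse d * inverse (P - d)) + x / d" if "d \<noteq> 0" "P - d \<noteq> 0" for x P d :: rat
      using that by (simp add: field_simps)
    have "f (2 * n - 1 - k) = of_nat p * (- ((-1) ^ k) * inverse (of_nat k + 1) * inverse (of_nat (2 * n - 1 - k) + 1)) + f k"
      unfolding fe e f_def[of k] by (rule gen[OF nz ne])
    also have "\<dots> \<sim> 0 + f k"
      by (intro qcong_add p_mult_cong1 qcong_refl pint_mult pint_uminus pint_m1 inv) (use k in auto)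
    finally show "f (2 * n - 1 - k) \<sim> f k" by simp
  qed
  also have "(\<Sum>k<n. f k) + (\<Sum>k<n. f k) = 2 * (\<Sum>k<n. f k)" by simp
  finally have "2 * fermat_quot \<sim> 2 * (\<Sum>k<n. f k)" .
  then show ?thesis unfolding f_def[symmetric] by (rule qcong_cancel[OF _ pint_inverse_2]) simp
qed

text \<open>Expanding the three binomial coefficients gives \<open>T = s * C3 / 2 - leg_val\<close>,
  where \<open>C3\<close> is a multiple of \<open>p\<close>. In the square, the cross term is
  \<open>2 * p\<close> modulo \<open>p^2\<close>.\<close>

lemma leg_val_sq:
  assumes p: "p = 4 * m + 1" and xy: "int p = x ^ 2 + 4 * y ^ 2"
  shows "leg_val ^ 2 \<approx> 4 * of_int (x ^ 2) - 2 * of_nat p"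
proof -
  define P where "P = (of_nat p :: rat)"
  define q where "q = fermat_quot"
  define B where "B = cbinom m"
  define C1 where "C1 = (of_nat ((6 * m) choose m) :: rat)"
  define C3 where "C3 = (of_nat ((6 * m) choose (3 * m)) :: rat)"
  define s where "s = ((-1) ^ m :: rat)"
  define T where "T = (of_int (jacobsthal 1) :: rat)"
  have n: "n = 2 * m" using p p_eq by simp
  have m: "m > 0" using p p_ge_3 by simp
  have Pm: "P = 4 * of_nat m + 1" by (simp add: P_def p)
  have ss: "s * s = 1" by (simp add: s_def flip: power_mult_distrib)
  have pi: "P \<in> pint p" "q \<in> pint p" "B \<in> pint p" "s \<in> pint p" "C3 \<in> pint p" "T \<in> pint p" "C1 \<in> pint p"
    by (simp_all add: P_def q_def B_def s_def C3_def T_def C1_def)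
  have nd: "\<not> p dvd m" "\<not> p dvd 2 * m" by (rule not_dvd_less; use m p in simp)+
  have B: "B \<noteq> 0" "inverse B \<in> pint p" unfolding B_def by (simp, intro pint_inverse_cbinom, simp add: p)
  have B2: "B / 2 \<in> pint p" by (intro pint_divide pi pint_inverse_2)
  have mm: "of_nat m \<noteq> (0 :: rat)" using m by simp

  \<comment> \<open>The numerator of \<open>C1\<close> is the product of \<open>5 * m + 1\<close> to
    \<open>6 * m\<close>, that is, of \<open>p + i\<close> for
    \<open>m \<le> i < 2 * m\<close>.\<close>
  have "C1 \<approx> B / 2 * (1 + P * (\<Sum>i = m..<2 * m. 1 / of_nat i))"
  proof -
    have f0: "inverse (fact m) \<in> pint p" by (rule pint_fact) (use p in simp)
    have "C1 = inverse (fact m) * pochhammer (of_nat p + of_nat m) m"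
      unfolding C1_def binomial_gbinomial gbinomial_pochhammer' by (simp add: p divide_inverse algebra_simps)
    also have "\<dots> \<approx> inverse (fact m) * (pochhammer (of_nat m) m * (1 + of_nat p * (\<Sum>i = m..<m + m. 1 / of_nat i)))"
      by (intro qcong_cmult f0 pochhammer_shift_cong m) (simp add: p)
    also have "pochhammer (of_nat m) m = fact m * (B / 2)"
    proof -
      have "B = pochhammer (of_nat m + 1) m / fact m"
        unfolding B_def binomial_gbinomial gbinomial_pochhammer' by simp
      then have "of_nat m * (fact m * B) = pochhammer (of_nat m) (Suc m)"
        by (simp add: pochhammer_rec)
      also have "\<dots> = pochhammer (of_nat m) m * (2 * of_nat m)" by (simp add: pochhammer_Suc)
      finally show ?thesis using mm by simp
    qed
    also have "inverse (fact m) * (fact m * (B / 2) * (1 + of_nat p * (\<Sum>i = m..<m + m. 1 / of_nat i)))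
        = B / 2 * (1 + of_nat p * (\<Sum>i = m..<m + m. 1 / of_nat i))"
      by (simp flip: mult.assoc)
    finally show ?thesis by (simp only: P_def mult_2)
  qed
  also have "B / 2 * (1 + P * (\<Sum>i = m..<2 * m. 1 / of_nat i)) \<approx> B / 2 * (1 + P * (q - 2))"
    unfolding P_def
  proof (intro qcong_cmult[OF _ B2] qcong_add qcong_refl cong1_mult_p)
    have "(\<Sum>i = m..<2 * m. 1 / of_nat i) = (\<Sum>k<n. (-1) ^ k / (of_nat k + 1)) + 1 / (2 * of_nat m :: rat)"
      using sum_inverse_eq_alternating[OF m] by (simp add: n)
    \<comment> \<open>As \<open>2 * m = (p - 1) / 2\<close>, its inverse is \<open>-2\<close> modulo
      \<open>p\<close>.\<close>
    also have "1 / (2 * of_nat m) = P * (1 / of_nat (2 * m)) + (- 2 :: rat)" using mm by (simp add: Pm field_simps)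
    also have "(\<Sum>k<n. (-1) ^ k / (of_nat k + 1)) + (P * (1 / of_nat (2 * m)) + (- 2 :: rat)) \<sim> q + (0 + (- 2))"
      unfolding P_def q_def
      by (intro qcong_add qcong_sym[OF fermat_quot_cong] p_mult_cong1 qcong_refl pint_divide pint_numeral pint_inverse_nat nd)
    finally show "(\<Sum>i = m..<2 * m. 1 / of_nat i) \<sim> q - 2" by simp
  qed
  finally have C1: "C1 \<approx> B / 2 * (1 + P * (q - 2))" .

  define D where "D = (of_nat ((4 * m) choose (2 * m)) :: rat)"
  define E where "E = (of_nat ((4 * m) choose m) :: rat)"
  define G where "G = (of_nat ((6 * m) choose (2 * m - 1)) :: rat)"
  \<comment> \<open>Regrouping the factorials of \<open>B * C3\<close> exposes the factor
    \<open>p\<close> through \<open>(4 * m + 1)! = p * (4 * m)!\<close>; every binomial left in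
    \<open>X\<close> is \<open>1\<close> or \<open>-1\<close> modulo \<open>p\<close>.\<close>
  define X where "X = E * E * G / (D * of_nat (2 * m))"
  have nD: "\<not> p dvd (4 * m) choose (2 * m)"
  proof
    assume "p dvd (4 * m) choose (2 * m)"
    moreover have "(4 * m) choose (2 * m) dvd fact (4 * m)"
      by (rule dvdI[of _ _ "fact (2 * m) * fact (4 * m - 2 * m)"])
        (use binomial_fact_lemma[of "2 * m" "4 * m"] in \<open>simp add: mult_ac\<close>)
    ultimately have "p dvd fact (4 * m)" by (rule dvd_trans)
    then show False using prime p by (simp add: prime_dvd_fact_iff)
  qed
  have iD: "inverse (D * of_nat (2 * m)) \<in> pint p" unfolding D_def
    by (intro pint_inverse_mult pint_inverse_nat nD nd)
  have D0: "D \<noteq> 0" by (simp add: D_def)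
  have X: "X \<in> pint p" unfolding X_def by (intro pint_divide iD pint_mult) (simp_all add: E_def G_def)
  have BC: "B * C3 = P * X"
  proof -
    obtain j where j: "m = Suc j" using m by (cases m) auto
    have fP: "fact (4 * m + 1) = P * (fact (4 * m) :: rat)" by (simp add: Pm add.commute)
    have f2: "fact (2 * m) = 2 * of_nat m * (fact (2 * m - 1) :: rat)" by (simp add: j)
    have eB: "B = fact (2 * m) / (fact m * fact m)" unfolding B_def by (subst binomial_fact) simp_all
    have eC: "C3 = fact (6 * m) / (fact (3 * m) * fact (3 * m))" unfolding C3_def by (subst binomial_fact) simp_all
    have eE: "E = fact (4 * m) / (fact m * fact (3 * m))" unfolding E_def by (subst binomial_fact) simp_all
    have eD: "D = fact (4 * m) / (fact (2 * m) * fact (2 * m))" unfolding D_def by (subst binomial_fact) simp_all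
    have eG: "G = fact (6 * m) / (fact (2 * m - 1) * fact (4 * m + 1))"
    proof -
      have "6 * m - (2 * m - 1) = 4 * m + 1" using m by simp
      then show ?thesis unfolding G_def by (subst binomial_fact) simp_all
    qed
    have "P \<noteq> 0" using p_ge_3 by (simp add: P_def)
    then show ?thesis unfolding X_def eB eC eE eD eG fP f2 using mm by (simp add: divide_simps)
  qed
  have X2: "X \<sim> - 2"
  proof (rule qcong_cancel[OF _ iD])
    show "D * of_nat (2 * m) \<noteq> 0" using D0 mm by simp
    have E: "E \<sim> s" using binomial_p_minus_1_cong[of m] by (simp add: E_def s_def p)
    have D: "D \<sim> 1" using binomial_p_minus_1_cong[of "2 * m"] by (simp add: D_def p)
    have G: "G \<sim> 1"
    proof -
      have "p + (2 * m - 1) = 6 * m" using p m by simp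
      then show ?thesis using binomial_p_plus_cong[of "2 * m - 1"] p m by (simp add: G_def)
    qed
    have "D * of_nat (2 * m) * X = E * E * G" unfolding X_def using D0 mm by simp
    also have "E * E * G \<sim> s * s * 1" by (intro qcong_mult E G pint_mult pi pint_numeral)
    also have "s * s * 1 = 1 * of_nat (2 * m) * (- 2) + P * 1" unfolding ss by (simp add: Pm)
    also have "\<dots> \<sim> 1 * of_nat (2 * m) * (- 2) + 0" unfolding P_def by (intro qcong_add qcong_refl p_mult_cong1 pint_numeral)
    also have "1 * of_nat (2 * m) * (- 2) + 0 = 1 * of_nat (2 * m) * (- 2 :: rat)" by simp
    also have "1 * of_nat (2 * m) * (- 2) \<sim> D * of_nat (2 * m) * (- 2)"
      by (intro qcong_mult qcong_refl qcong_sym[OF D] pint_mult pint_uminus pint_numeral pint_of_nat) (auto simp: D_def)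
    finally show "D * of_nat (2 * m) * X \<sim> D * of_nat (2 * m) * - 2" .
  qed
  have C3: "C3 = P * (X / B)" using BC B by (simp add: field_simps)
  have XB: "X / B \<in> pint p" by (intro pint_divide X B)

  have u: "leg_val \<approx> s * (B / 2) * (2 - P * q)"
  proof -
    have "1 + 1 / (1 + P * q) = 2 - P * q + P ^ 2 * (q ^ 2 * inverse (2 ^ (p - 1)))"
    proof -
      have "1 + P * q \<noteq> 0" unfolding P_def q_def two_power[symmetric] by simp
      moreover have "2 ^ (p - 1) = 1 + P * q" unfolding P_def q_def by (rule two_power)
      ultimately show ?thesis by (simp add: field_simps power2_eq_square)
    qed
    also have "\<dots> \<approx> 2 - P * q + 0"
      unfolding P_def by (intro qcong_add qcong_refl p2_mult_cong2 pint_mult pint_power pi pint_inverse_neg_power)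
    finally have "s * (B / 2) * (1 + 1 / (1 + P * q)) \<approx> s * (B / 2) * (2 - P * q)"
      using B2 pi by (intro qcong_cmult) auto
    moreover have "leg_val \<approx> s * (B / 2) * (1 + 1 / (1 + P * q))"
      using leg_1_mod_4(1)[OF p] unfolding two_power by (simp add: s_def B_def P_def q_def)
    ultimately show ?thesis using qcong_trans by blast
  qed
  have u1: "leg_val \<sim> s * B" using leg_1_mod_4(2)[OF p] by (simp add: s_def B_def)

  have "2 * T \<approx> (P - 1) * s * (3 * B - C3 - 2 * C1)"
    using qcong_of_int[OF jacobsthal_binomial[OF p]] by (simp add: T_def P_def s_def B_def C1_def C3_def)
  also have "(P - 1) * s * (3 * B - C3 - 2 * C1) \<approx> (P - 1) * s * (3 * B - C3 - 2 * (B / 2 * (1 + P * (q - 2))))"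
    by (intro qcong_cmult qcong_diff qcong_refl C1 pint_mult pint_diff pi pint_numeral)
  \<comment> \<open>The \<open>-2\<close> next to \<open>q\<close> compensates the contribution of
    \<open>P\<close> from \<open>P - 1\<close>, so that exactly the approximation of
    \<open>leg_val\<close> appears.\<close>
  also have "(P - 1) * s * (3 * B - C3 - 2 * (B / 2 * (1 + P * (q - 2))))
      = - 2 * (s * (B / 2) * (2 - P * q)) + s * C3 + P ^ 2 * (s * (2 * B - B * q - X / B))"
    unfolding C3 by (simp add: field_simps power2_eq_square B)
  also have "\<dots> \<approx> - 2 * leg_val + s * C3 + 0"
    unfolding P_def
    by (intro qcong_add qcong_cmult qcong_refl qcong_sym[OF u[unfolded P_def]] p2_mult_cong2 pint_mult pint_diff pi XB pint_numeral pint_uminus)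
  finally have "1/2 * (2 * T) \<approx> 1/2 * (- 2 * leg_val + s * C3 + 0)" by (rule qcong_cmult[OF _ pint_half])
  then have T: "T \<approx> s * C3 / 2 - leg_val" by (simp add: algebra_simps)
  have "T ^ 2 \<approx> (s * C3 / 2 - leg_val) ^ 2"
    by (intro qcong_power T pint_diff pint_divide pint_mult pi pint_inverse_2 pint_leg)
  also have "(s * C3 / 2 - leg_val) ^ 2 = leg_val ^ 2 - P * (s * (X / B) * leg_val) + P ^ 2 * ((X / B) ^ 2 * (1/2) ^ 2)"
  proof -
    have "(s * C3 / 2 - leg_val) ^ 2 = leg_val ^ 2 - s * C3 * leg_val + (s * s) * C3 ^ 2 * (1/2) ^ 2"
      by (simp add: power2_eq_square field_simps)
    then show ?thesis unfolding ss C3 by (simp add: power2_eq_square field_simps)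
  qed
  also have "\<dots> \<approx> leg_val ^ 2 - P * (- 2) + 0"
  proof -
    have "s * (X / B) * leg_val \<sim> s * (X / B) * (s * B)" by (intro qcong_cmult u1 pint_mult pi XB)
    also have "s * (X / B) * (s * B) = (s * s) * X" using B by simp
    also have "(s * s) * X \<sim> 1 * (- 2)" unfolding ss by (intro qcong_cmult X2 pint_numeral)
    finally have "s * (X / B) * leg_val \<sim> - 2" by simp
    then show ?thesis unfolding P_def
      by (intro qcong_add qcong_diff qcong_refl cong1_mult_p p2_mult_cong2 pint_mult pint_power XB pint_half)
  qed
  finally have "T ^ 2 - 2 * P \<approx> leg_val ^ 2 - P * (- 2) + 0 - 2 * P" by (intro qcong_diff qcong_refl)
  then have "leg_val ^ 2 \<approx> T ^ 2 - 2 * P" using qcong_sym by simp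
  moreover have "T ^ 2 = 4 * of_int (x ^ 2)"
  proof -
    have "T ^ 2 = of_int (jacobsthal 1 ^ 2)" by (simp add: T_def)
    also have "jacobsthal 1 ^ 2 = 4 * x ^ 2" by (rule jacobsthal_1_sq[OF _ xy]) (simp add: n)
    finally show ?thesis by simp
  qed
  ultimately show ?thesis by (simp add: P_def)
qed

end

theorem theorem5p7:
  fixes p :: nat
  assumes "prime p" and "odd p"
  shows "(p mod 4 = 1 \<longrightarrow> (\<forall>x y :: int. int p = x^2 + 4 * y^2 \<longrightarrow>
            qcong (\<Sum>k = 0..p - 1. of_nat ((2 * k) choose k) ^ 3
                     / ((-8) ^ k * (2 * of_nat k - 1))) (- 4 * of_int (x^2)) p 2))
       \<and> (p mod 4 = 3 \<longrightarrow>
            qcong (\<Sum>k = 0..p - 1. of_nat ((2 * k) choose k) ^ 3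
                     / ((-8) ^ k * (2 * of_nat k - 1))) (2 * of_nat p - 2 * of_int (R1 p)) p 2)
       \<and> (p mod 4 = 1 \<longrightarrow> (\<forall>x y :: int. int p = x^2 + 4 * y^2 \<longrightarrow>
            qcong (\<Sum>k = 0..p - 1. of_nat ((2 * k) choose k) ^ 3
                     / ((-8) ^ k * (2 * of_nat k - 1) ^ 2)) (- 4 * of_int (x^2) + 2 * of_nat p) p 2))
       \<and> (p mod 4 = 3 \<longrightarrow>
            qcong (\<Sum>k = 0..p - 1. of_nat ((2 * k) choose k) ^ 3
                     / ((-8) ^ k * (2 * of_nat k - 1) ^ 2)) (6 * of_int (R1 p)) p 2)"
proof -
  interpret odd_prime p using assms by unfold_locales
  let ?S1 = "\<Sum>k = 0..p - 1. of_nat ((2 * k) choose k) ^ 3 / ((-8) ^ k * (2 * of_nat k - 1)) :: rat"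
  let ?S2 = "\<Sum>k = 0..p - 1. of_nat ((2 * k) choose k) ^ 3 / ((-8) ^ k * (2 * of_nat k - 1) ^ 2) :: rat"
  have S: "?S1 = (\<Sum>k\<le>p - 1. cube_term k / (2 * of_nat k - 1))"
    "?S2 = (\<Sum>k\<le>p - 1. cube_term k / (2 * of_nat k - 1) ^ 2)"
    by (simp_all add: cube_term_def atLeast0AtMost)
  have one: "?S1 \<approx> - 4 * of_int (x ^ 2)" "?S2 \<approx> - 4 * of_int (x ^ 2) + 2 * of_nat p"
    if "p mod 4 = 1" and xy: "int p = x ^ 2 + 4 * y ^ 2" for x y
  proof -
    have p: "p = 4 * (p div 4) + 1" using that by presburger
    note l = leg_1_mod_4(3,4)[OF p] and sq = leg_val_sq[OF p xy]
    \<comment> \<open>The \<open>2 * p\<close> from the mixed product cancels the one in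
      \<open>leg_val ^ 2\<close>; the second sum has no mixed product and keeps it.\<close>
    have "- 2 * leg_aux ^ 2 - 2 * (leg_val * leg_aux) - leg_val ^ 2
        \<approx> - 2 * 0 - 2 * of_nat p - (4 * of_int (x ^ 2) - 2 * of_nat p)"
      by (intro qcong_diff qcong_cmult l sq pint_uminus pint_numeral)
    from qcong_trans[OF cube_sums_cong(1) this] show "?S1 \<approx> - 4 * of_int (x ^ 2)" unfolding S by simp
    have "6 * leg_aux ^ 2 - leg_val ^ 2 \<approx> 6 * 0 - (4 * of_int (x ^ 2) - 2 * of_nat p)"
      by (intro qcong_diff qcong_cmult l sq pint_numeral)
    from qcong_trans[OF cube_sums_cong(2) this] show "?S2 \<approx> - 4 * of_int (x ^ 2) + 2 * of_nat p" unfolding S by simp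
  qed
  have three: "?S1 \<approx> 2 * of_nat p - 2 * of_int (R1 p)" "?S2 \<approx> 6 * of_int (R1 p)" if "p mod 4 = 3"
  proof -
    have p: "p = 4 * (p div 4) + 3" using that by presburger
    note l = leg_3_mod_4[OF p]
    have "- 2 * leg_aux ^ 2 - 2 * (leg_val * leg_aux) - leg_val ^ 2 \<approx> - 2 * of_int (R1 p) - 2 * (- of_nat p) - 0"
      by (intro qcong_diff qcong_cmult l pint_uminus pint_numeral)
    from qcong_trans[OF cube_sums_cong(1) this] show "?S1 \<approx> 2 * of_nat p - 2 * of_int (R1 p)" unfolding S by simp
    have "6 * leg_aux ^ 2 - leg_val ^ 2 \<approx> 6 * of_int (R1 p) - 0"
      by (intro qcong_diff qcong_cmult l pint_numeral)
    from qcong_trans[OF cube_sums_cong(2) this] show "?S2 \<approx> 6 * of_int (R1 p)" unfolding S by simp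
  qed
  show ?thesis using one three by blast
qed

end
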